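(* Let $k\ge1$ and let $h=(h_0,h_1,h_2,\dots)$ be a sequence of unit vectors $h_j=p_jt_{21}+q_jt_{12}\in H((k+j,j),(k+j+1,j+1))$, $p_j^2+q_j^2=1$. Let $\Pi_k(h)$ be the irreducible Schur--Weyl representation of the infinite symmetric group $\mathfrak S_{\mathbb N}$ determined by $h$, and let $\mu^{(k)}=\sum_{t\in\mathcal T^{\rm proper}_k}\mu^h_t$ be the associated measure on the space $\mathcal T$ of infinite Young tableaux. Then the representation $\Pi_k(h)$ has a simple spectrum with respect to the Gelfand--Tsetlin algebra, and $$\Pi_k(h)\simeq L^2(\mathcal T,\mu^{(k)}).$$
   Context: $\mathfrak S_{\mathbb N}=\bigcup_N\mathfrak S_N$. A Young tableau with diagram $\lambda$ is identified with a path in the Young graph from $\emptyset$ to $\lambda$; an infinite Young tableau is an infinite path in the Young graph starting at $\emptyset$, and $\mathcal T$ is the space of infinite Young tableaux. $[t]_N$ is the initial segment of length $N$ of a tableau $t$. The irreducible unitary representation $\pi_\lambda$ of $\mathfrak S_N$ has the Young orthogonal basis consisting of the tableaux with diagram $\lambda$. For $\lambda\subset\mu$, $H(\lambda,\mu)$ is the Hilbert space whose orthonormal basis is the set of paths in the Young graph from $\lambda$ to $\mu$. For $k\ge1$, $\lambda=(k+j,j)$, $\mu=(k+j+1,j+1)$, $N=k+2j$, there are exactly two such paths: $t_{21}$ (the element $N+1$ is put into the second row, $N+2$ into the first row) and $t_{12}$ ($N+1$ into the first row, $N+2$ into the second row). A unit vector $h_j=p_jt_{21}+q_jt_{12}$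 determines the isometric $\mathfrak S_N$-equivariant embedding $\pi_{(k+j,j)}\hookrightarrow\pi_{(k+j+1,j+1)}$, $t\mapsto p_j(t\text{ followed by }t_{21})+q_j(t\text{ followed by }t_{12})$. The irreducible Schur--Weyl representation $\Pi_k(h)$ is the inductive limit of the irreducible representations $\pi_{(k)},\pi_{(k+1,1)},\pi_{(k+2,2)},\dots$ of $\mathfrak S_k,\mathfrak S_{k+2},\mathfrak S_{k+4},\dots$ under these embeddings. The Gelfand--Tsetlin algebra is the commutative algebra generated by the centers of the group algebras $\mathbb C[\mathfrak S_n]$, $n\ge1$. The isomorphism $\simeq$ means that $\Pi_k(h)$ is realized in the space $L^2(\mathcal T,\mu^{(k)})$, the measure $\mu^{(k)}$ determining the spectral type of $\Pi_k(h)$ with respect to the Gelfand--Tsetlin algebra. A pair $(\lambda,\mu)$ of Young diagrams with at most two rows, with $N$ and $N+2$ cells respectively, is called nice if $\mu$ is obtained from $\lambda$ by adding one cell to each row. $\mathcal T^{\rm proper}_k$ is the set of finite Young tableaux $t$, with any number $N$ of cells and with two-row (or one-row) diagram $(\lambda_1,\lambda_2)$ satisfying $\lambda_1-\lambda_2=k$, such that the pair (diagram of $[t]_{N-2}$, diagram of $t$) is not nice, that is, $N-1$ and $N$ lie in the same row of $t$; for $k=1$ the one-cell tableau is also included. For $t\in\mathcal T_k^{\rm proper}$ with $N$ cells, $\mu_t^h$ is the measure on $\mathcal T$ that is the distribution of the following random walk: start from $t$, and at each step, passing from level $n$ to level $n+2$ ($n=N,N+2,N+4,\dots$), choose the path corresponding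 to $t_{21}$ with probability $p_j^2$ and the path corresponding to $t_{12}$ with probability $q_j^2$, where $j=[(n-k)/2]$.
   Formalization: The isomorphism with L²(T, μ^(k)) is stated only when all p_j and q_j are nonzero; if some p_j or q_j vanishes, it fails, since a tableau ending with the zero-probability step gives a vector whose spectral measure lives on a μ^(k)-null set. Simple spectrum is stated for all h. *)

theory Defs
  imports
    "HOL-Probability.Probability"
    "HOL-Combinatorics.Perm"
    "HOL-Library.Poly_Mapping"
begin

section \<open>Complex Hilbert spaces\<close>

text \<open>The inner product is conjugate-linear in its first argument.\<close>

class scaleC =
  fixes scaleC :: "complex \<Rightarrow> 'a \<Rightarrow> 'a"  (infixr \<open>*\<^sub>C\<close> 75)

class complex_inner = real_normed_vector + scaleC +
  fixes cinner :: "'a \<Rightarrow> 'a \<Rightarrow> complex"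
  assumes scaleC_add_right: "a *\<^sub>C (x + y) = a *\<^sub>C x + a *\<^sub>C y"
    and scaleC_add_left: "(a + b) *\<^sub>C x = a *\<^sub>C x + b *\<^sub>C x"
    and scaleC_scaleC: "a *\<^sub>C (b *\<^sub>C x) = (a * b) *\<^sub>C x"
    and scaleC_of_real: "of_real r *\<^sub>C x = r *\<^sub>R x"
    and cinner_commute: "cinner x y = cnj (cinner y x)"
    and cinner_add_right: "cinner x (y + z) = cinner x y + cinner x z"
    and cinner_scaleC_right: "cinner x (a *\<^sub>C y) = a * cinner x y"
    and cinner_nonneg: "0 \<le> Re (cinner x x)"
    and norm_eq_sqrt_cinner: "norm x = sqrt (Re (cinner x x))"

class chilbert_space = complex_inner + complete_space


section \<open>The Young graph and Young tableaux\<close>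

text \<open>A diagram is the set of its cells (row, column), both counted from 0.\<close>

type_synonym diagram = "(nat \<times> nat) set"

definition young_diagram :: "diagram \<Rightarrow> bool" where
  "young_diagram \<kappa> \<longleftrightarrow>
     finite \<kappa> \<and> (\<forall>(r, c)\<in>\<kappa>. \<forall>r'\<le>r. \<forall>c'\<le>c. (r', c') \<in> \<kappa>)"

definition young_edge :: "diagram \<Rightarrow> diagram \<Rightarrow> bool"  (infix \<open>\<nearrow>\<close> 50) where
  "\<kappa> \<nearrow> \<mu> \<longleftrightarrow>
     young_diagram \<kappa> \<and> young_diagram \<mu> \<and> \<kappa> \<subseteq> \<mu> \<and> card \<mu> = Suc (card \<kappa>)"

definition two_row :: "nat \<Rightarrow> nat \<Rightarrow> diagram" where
  "two_row a b = {0} \<times> {..<a} \<union> {1} \<times> {..<b}"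

text \<open>A path is the list of all diagrams that it visits, including both end points.\<close>

type_synonym path = "diagram list"

definition paths :: "diagram \<Rightarrow> diagram \<Rightarrow> path set" where
  "paths \<kappa> \<mu> = {t. t \<noteq> [] \<and> hd t = \<kappa> \<and> last t = \<mu> \<and> successively (\<nearrow>) t}"

definition followed_by :: "path \<Rightarrow> path \<Rightarrow> path" where
  "followed_by t u = t @ tl u"

definition tableaux :: "diagram \<Rightarrow> path set" where
  "tableaux \<kappa> = paths {} \<kappa>"

definition cells :: "path \<Rightarrow> nat" where
  "cells t = length t - 1"

definition infinite_tableaux :: "(nat \<Rightarrow> diagram) set" where
  "infinite_tableaux = {t. t 0 = {} \<and> (\<forall>n. t n \<nearrow> t (Suc n))}"

definition initial_segment :: "(nat \<Rightarrow> diagram) \<Rightarrow> nat \<Rightarrow> path" where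
  "initial_segment t N = map t [0..<Suc N]"


section \<open>Young's orthogonal form\<close>

text \<open>
  For a finite set \<open>A\<close>, \<open>vecs A\<close> with \<open>vinner A\<close> is the complex Hilbert space whose
  orthonormal basis is \<open>A\<close>; its basis vectors are \<open>basis x\<close> for \<open>x \<in> A\<close>.
\<close>

definition vecs :: "'a set \<Rightarrow> ('a \<Rightarrow> complex) set" where
  "vecs A = {v. \<forall>x. x \<notin> A \<longrightarrow> v x = 0}"

definition vinner :: "'a set \<Rightarrow> ('a \<Rightarrow> complex) \<Rightarrow> ('a \<Rightarrow> complex) \<Rightarrow> complex" where
  "vinner A v w = (\<Sum>x\<in>A. cnj (v x) * w x)"

definition basis :: "'a \<Rightarrow> 'a \<Rightarrow> complex" where
  "basis x = (\<lambda>y. if y = x then 1 else 0)"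

text \<open>
  The entries of tableaux are counted from 0, so that \<open>nat perm\<close>, the group of all
  finitary permutations of \<open>nat\<close>, is the infinite symmetric group; entry \<open>i\<close> is added
  in the step from level \<open>i\<close> to level \<open>Suc i\<close>.
\<close>

definition sym_group :: "nat \<Rightarrow> nat perm set" where
  "sym_group N = {\<sigma>. affected \<sigma> \<subseteq> {..<N}}"

definition cell_of :: "path \<Rightarrow> nat \<Rightarrow> nat \<times> nat" where
  "cell_of t i = the_elem (t ! Suc i - t ! i)"

definition cell_content :: "nat \<times> nat \<Rightarrow> int" where
  "cell_content x = int (snd x) - int (fst x)"

definition axial_distance :: "path \<Rightarrow> nat \<Rightarrow> int" where
  "axial_distance t i = cell_content (cell_of t (Suc i)) - cell_content (cell_of t i)"

text \<open>Interchanging the entries \<open>i\<close> and \<open>Suc i\<close> only changes the diagram at level \<open>Suc i\<close>.\<close>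

definition swap_entries :: "nat \<Rightarrow> path \<Rightarrow> path" where
  "swap_entries i t = t[Suc i := insert (cell_of t (Suc i)) (t ! i)]"

text \<open>
  The last clause determines \<open>\<pi>\<close>, since the Coxeter generators generate the symmetric
  group. If the result of the swap is not a tableau, then the axial distance is 1 or -1 and
  the coefficient of the second term is 0.
\<close>

definition young_orthogonal_rep ::
    "diagram \<Rightarrow> (nat perm \<Rightarrow> (path \<Rightarrow> complex) \<Rightarrow> (path \<Rightarrow> complex)) \<Rightarrow> bool" where
  "young_orthogonal_rep \<kappa> \<pi> \<longleftrightarrow>
     (\<forall>\<sigma>\<in>sym_group (card \<kappa>). \<forall>v\<in>vecs (tableaux \<kappa>). \<pi> \<sigma> v \<in> vecs (tableaux \<kappa>)) \<and>
     (\<forall>\<sigma>\<in>sym_group (card \<kappa>). \<forall>v\<in>vecs (tableaux \<kappa>). \<forall>w\<in>vecs (tableaux \<kappa>). \<forall>a b.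
        \<pi> \<sigma> (\<lambda>t. a * v t + b * w t) = (\<lambda>t. a * \<pi> \<sigma> v t + b * \<pi> \<sigma> w t)) \<and>
     (\<forall>v\<in>vecs (tableaux \<kappa>). \<pi> 1 v = v) \<and>
     (\<forall>\<sigma>\<in>sym_group (card \<kappa>). \<forall>\<tau>\<in>sym_group (card \<kappa>). \<forall>v\<in>vecs (tableaux \<kappa>).
        \<pi> (\<sigma> * \<tau>) v = \<pi> \<sigma> (\<pi> \<tau> v)) \<and>
     (\<forall>i t. Suc i < card \<kappa> \<longrightarrow> t \<in> tableaux \<kappa> \<longrightarrow>
        (let r = real_of_int (axial_distance t i) in
         \<pi> (Perm.swap i (Suc i)) (basis t) =
           (\<lambda>s. of_real (1 / r) * basis t s
               + of_real (sqrt (1 - 1 / r\<^sup>2)) * basis (swap_entries i t) s)))"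


section \<open>Schur--Weyl representations\<close>

definition unitary_rep :: "(nat perm \<Rightarrow> 'h::complex_inner \<Rightarrow> 'h) \<Rightarrow> bool" where
  "unitary_rep U \<longleftrightarrow>
     (\<forall>\<sigma> x y. U \<sigma> (x + y) = U \<sigma> x + U \<sigma> y) \<and>
     (\<forall>\<sigma> a x. U \<sigma> (a *\<^sub>C x) = a *\<^sub>C U \<sigma> x) \<and>
     (\<forall>\<sigma> x y. cinner (U \<sigma> x) (U \<sigma> y) = cinner x y) \<and>
     (\<forall>x. U 1 x = x) \<and>
     (\<forall>\<sigma> \<tau> x. U (\<sigma> * \<tau>) x = U \<sigma> (U \<tau> x))"

text \<open>
  The representation \<open>U\<close> of the infinite symmetric group on the whole Hilbert space \<open>'h\<close> is
  the inductive limit of the representations with diagrams \<open>\<Lambda> 0, \<Lambda> 1, \<dots>\<close> of the symmetric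
  groups of degrees \<open>card (\<Lambda> 0), card (\<Lambda> 1), \<dots>\<close> under the embeddings \<open>E 0, E 1, \<dots>\<close>.
  This determines \<open>U\<close> up to unitary equivalence.
\<close>

definition is_inductive_limit ::
    "(nat \<Rightarrow> diagram) \<Rightarrow> (diagram \<Rightarrow> nat perm \<Rightarrow> (path \<Rightarrow> complex) \<Rightarrow> (path \<Rightarrow> complex)) \<Rightarrow>
     (nat \<Rightarrow> (path \<Rightarrow> complex) \<Rightarrow> (path \<Rightarrow> complex)) \<Rightarrow>
     (nat perm \<Rightarrow> 'h::chilbert_space \<Rightarrow> 'h) \<Rightarrow> bool" where
  "is_inductive_limit \<Lambda> \<pi> E U \<longleftrightarrow>
     unitary_rep U \<and>
     (\<exists>\<iota> :: nat \<Rightarrow> (path \<Rightarrow> complex) \<Rightarrow> 'h.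
        (\<forall>j. \<forall>v\<in>vecs (tableaux (\<Lambda> j)). \<forall>w\<in>vecs (tableaux (\<Lambda> j)). \<forall>a b.
           \<iota> j (\<lambda>t. a * v t + b * w t) = a *\<^sub>C \<iota> j v + b *\<^sub>C \<iota> j w) \<and>
        (\<forall>j. \<forall>v\<in>vecs (tableaux (\<Lambda> j)). \<forall>w\<in>vecs (tableaux (\<Lambda> j)).
           cinner (\<iota> j v) (\<iota> j w) = vinner (tableaux (\<Lambda> j)) v w) \<and>
        (\<forall>j. \<forall>\<sigma>\<in>sym_group (card (\<Lambda> j)). \<forall>v\<in>vecs (tableaux (\<Lambda> j)).
           U \<sigma> (\<iota> j v) = \<iota> j (\<pi> (\<Lambda> j) \<sigma> v)) \<and>
        (\<forall>j. \<forall>v\<in>vecs (tableaux (\<Lambda> j)). \<iota> (Suc j) (E j v) = \<iota> j v) \<and>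
        closure (\<Union>j. \<iota> j ` vecs (tableaux (\<Lambda> j))) = UNIV)"

definition t21 :: "nat \<Rightarrow> nat \<Rightarrow> path" where
  "t21 k j = [two_row (k + j) j, two_row (k + j) (j + 1), two_row (k + j + 1) (j + 1)]"

definition t12 :: "nat \<Rightarrow> nat \<Rightarrow> path" where
  "t12 k j = [two_row (k + j) j, two_row (k + j + 1) j, two_row (k + j + 1) (j + 1)]"

text \<open>
  The map from the representation with diagram \<open>\<kappa>\<close> to the one with diagram \<open>\<mu>\<close> determined by
  \<open>h \<in> vecs (paths \<kappa> \<mu>)\<close>: it sends the tableau \<open>t\<close> to the sum over all paths \<open>u\<close> of
  \<open>h u\<close> times (\<open>t\<close> followed by \<open>u\<close>).
\<close>

definition path_embedding ::
    "diagram \<Rightarrow> diagram \<Rightarrow> (path \<Rightarrow> complex) \<Rightarrow> (path \<Rightarrow> complex) \<Rightarrow> (path \<Rightarrow> complex)" where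
  "path_embedding \<kappa> \<mu> h v =
     (\<lambda>s. \<Sum>t\<in>tableaux \<kappa>. \<Sum>u\<in>paths \<kappa> \<mu>. v t * h u * basis (followed_by t u) s)"

definition is_schur_weyl_rep ::
    "nat \<Rightarrow> (nat \<Rightarrow> path \<Rightarrow> complex) \<Rightarrow>
     (diagram \<Rightarrow> nat perm \<Rightarrow> (path \<Rightarrow> complex) \<Rightarrow> (path \<Rightarrow> complex)) \<Rightarrow>
     (nat perm \<Rightarrow> 'h::chilbert_space \<Rightarrow> 'h) \<Rightarrow> bool" where
  "is_schur_weyl_rep k h \<pi> U \<longleftrightarrow>
     is_inductive_limit (\<lambda>j. two_row (k + j) j) \<pi>
       (\<lambda>j. path_embedding (two_row (k + j) j) (two_row (k + j + 1) (j + 1)) (h j)) U"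


section \<open>The Gelfand--Tsetlin algebra\<close>

text \<open>
  The multiplication of type \<open>poly_mapping\<close> is the convolution for an additive monoid of
  keys, whereas \<open>nat perm\<close> is a multiplicative one.
\<close>

type_synonym group_algebra = "nat perm \<Rightarrow>\<^sub>0 complex"

definition ga_mult :: "group_algebra \<Rightarrow> group_algebra \<Rightarrow> group_algebra" where
  "ga_mult a b = (\<Sum>\<sigma>\<in>Poly_Mapping.keys a. \<Sum>\<tau>\<in>Poly_Mapping.keys b.
     Poly_Mapping.single (\<sigma> * \<tau>) (Poly_Mapping.lookup a \<sigma> * Poly_Mapping.lookup b \<tau>))"

definition sym_algebra :: "nat \<Rightarrow> group_algebra set" where
  "sym_algebra N = {a. Poly_Mapping.keys a \<subseteq> sym_group N}"

definition sym_algebra_center :: "nat \<Rightarrow> group_algebra set" where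
  "sym_algebra_center N =
     {a \<in> sym_algebra N. \<forall>b\<in>sym_algebra N. ga_mult a b = ga_mult b a}"

text \<open>Closure under scalar multiplication is automatic: the scalars lie in every center.\<close>

inductive_set gelfand_tsetlin :: "group_algebra set" where
  center: "1 \<le> N \<Longrightarrow> a \<in> sym_algebra_center N \<Longrightarrow> a \<in> gelfand_tsetlin"
| add: "a \<in> gelfand_tsetlin \<Longrightarrow> b \<in> gelfand_tsetlin \<Longrightarrow> a + b \<in> gelfand_tsetlin"
| mult: "a \<in> gelfand_tsetlin \<Longrightarrow> b \<in> gelfand_tsetlin \<Longrightarrow> ga_mult a b \<in> gelfand_tsetlin"

definition ga_act ::
    "(nat perm \<Rightarrow> 'h::complex_inner \<Rightarrow> 'h) \<Rightarrow> group_algebra \<Rightarrow> 'h \<Rightarrow> 'h" where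
  "ga_act U a x = (\<Sum>\<sigma>\<in>Poly_Mapping.keys a. Poly_Mapping.lookup a \<sigma> *\<^sub>C U \<sigma> x)"

definition ga_act_vec ::
    "(nat perm \<Rightarrow> (path \<Rightarrow> complex) \<Rightarrow> (path \<Rightarrow> complex)) \<Rightarrow>
     group_algebra \<Rightarrow> (path \<Rightarrow> complex) \<Rightarrow> (path \<Rightarrow> complex)" where
  "ga_act_vec \<pi> a v =
     (\<lambda>t. \<Sum>\<sigma>\<in>Poly_Mapping.keys a. Poly_Mapping.lookup a \<sigma> * \<pi> \<sigma> v t)"

text \<open>A commutative algebra of operators has a simple spectrum iff it has a cyclic vector.\<close>

definition simple_gt_spectrum :: "(nat perm \<Rightarrow> 'h::chilbert_space \<Rightarrow> 'h) \<Rightarrow> bool" where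
  "simple_gt_spectrum U \<longleftrightarrow>
     (\<exists>x. closure ((\<lambda>a. ga_act U a x) ` gelfand_tsetlin) = UNIV)"

text \<open>
  The point of the spectrum of the algebra given by the infinite tableau \<open>t\<close> takes the value
  \<open>c\<close> at \<open>a\<close>: every initial segment of \<open>t\<close> that is long enough for \<open>a\<close> to act on it is an
  eigenvector of \<open>a\<close> with eigenvalue \<open>c\<close>.
\<close>

definition gt_eigenvalue ::
    "(diagram \<Rightarrow> nat perm \<Rightarrow> (path \<Rightarrow> complex) \<Rightarrow> (path \<Rightarrow> complex)) \<Rightarrow>
     group_algebra \<Rightarrow> (nat \<Rightarrow> diagram) \<Rightarrow> complex \<Rightarrow> bool" where
  "gt_eigenvalue \<pi> a t c \<longleftrightarrow>
     (\<forall>N. a \<in> sym_algebra N \<longrightarrow>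
        ga_act_vec (\<pi> (t N)) a (basis (initial_segment t N)) =
          (\<lambda>s. c * basis (initial_segment t N) s))"


section \<open>Realization in a space of square-integrable functions\<close>

definition square_integrable :: "'a measure \<Rightarrow> ('a \<Rightarrow> complex) \<Rightarrow> bool" where
  "square_integrable M f \<longleftrightarrow>
     f \<in> borel_measurable M \<and> integrable M (\<lambda>t. (cmod (f t))\<^sup>2)"

text \<open>
  A unitary map from \<open>'h\<close> onto the space of square-integrable functions modulo equality almost
  everywhere, given by a choice of representatives.
\<close>

definition unitary_onto_L2 :: "'a measure \<Rightarrow> ('h::chilbert_space \<Rightarrow> 'a \<Rightarrow> complex) \<Rightarrow> bool" where
  "unitary_onto_L2 M \<Phi> \<longleftrightarrow>
     (\<forall>x. square_integrable M (\<Phi> x)) \<and>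
     (\<forall>x y. AE t in M. \<Phi> (x + y) t = \<Phi> x t + \<Phi> y t) \<and>
     (\<forall>a x. AE t in M. \<Phi> (a *\<^sub>C x) t = a * \<Phi> x t) \<and>
     (\<forall>x y. (LINT t|M. cnj (\<Phi> x t) * \<Phi> y t) = cinner x y) \<and>
     (\<forall>f. square_integrable M f \<longrightarrow> (\<exists>x. AE t in M. \<Phi> x t = f t))"

text \<open>
  \<open>U\<close> can be transferred to the \<open>L2\<close> space over a measure on the space of infinite tableaux in
  such a way that every element of the Gelfand--Tsetlin algebra acts there as the multiplication
  by its eigenvalue at the tableau, so that the measure gives the spectral type.
\<close>

definition realized_in_L2 ::
    "(diagram \<Rightarrow> nat perm \<Rightarrow> (path \<Rightarrow> complex) \<Rightarrow> (path \<Rightarrow> complex)) \<Rightarrow>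
     (nat perm \<Rightarrow> 'h::chilbert_space \<Rightarrow> 'h) \<Rightarrow> (nat \<Rightarrow> diagram) measure \<Rightarrow> bool" where
  "realized_in_L2 \<pi> U M \<longleftrightarrow>
     (\<exists>\<Phi>. unitary_onto_L2 M \<Phi> \<and>
        (\<forall>a\<in>gelfand_tsetlin. \<forall>x. AE t in M.
           \<exists>c. gt_eigenvalue \<pi> a t c \<and> \<Phi> (ga_act U a x) t = c * \<Phi> x t))"


section \<open>The measure on infinite tableaux\<close>

definition cylinder :: "path \<Rightarrow> (nat \<Rightarrow> diagram) set" where
  "cylinder s = {t \<in> infinite_tableaux. initial_segment t (cells s) = s}"

definition tableau_space :: "(nat \<Rightarrow> diagram) measure" where
  "tableau_space = sigma infinite_tableaux (range cylinder)"

definition nice :: "diagram \<Rightarrow> diagram \<Rightarrow> bool" where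
  "nice \<kappa> \<mu> \<longleftrightarrow> (\<exists>a b. b \<le> a \<and> \<kappa> = two_row a b \<and> \<mu> = two_row (a + 1) (b + 1))"

definition proper_tableaux :: "nat \<Rightarrow> path set" where
  "proper_tableaux k =
     {t. (\<exists>b. t \<in> tableaux (two_row (b + k) b)) \<and>
         (2 \<le> cells t \<and> \<not> nice (t ! (cells t - 2)) (last t) \<or> k = 1 \<and> cells t = 1)}"

text \<open>
  The random walk from \<open>t\<close> is driven by independent choices; \<open>\<omega> j\<close> decides which of the two
  paths is taken after the diagram \<open>two_row (k + j) j\<close>.
\<close>

primrec walk_segment :: "nat \<Rightarrow> path \<Rightarrow> (nat \<Rightarrow> bool) \<Rightarrow> nat \<Rightarrow> path" where
  "walk_segment k t \<omega> 0 = t"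
| "walk_segment k t \<omega> (Suc m) =
     (let s = walk_segment k t \<omega> m; j = (cells s - k) div 2
      in followed_by s (if \<omega> j then t21 k j else t12 k j))"

text \<open>\<open>walk_segment k t \<omega> n\<close> has more than \<open>n\<close> entries.\<close>

definition walk_tableau :: "nat \<Rightarrow> path \<Rightarrow> (nat \<Rightarrow> bool) \<Rightarrow> nat \<Rightarrow> diagram" where
  "walk_tableau k t \<omega> n = walk_segment k t \<omega> n ! n"

definition choice_space :: "(nat \<Rightarrow> real) \<Rightarrow> (nat \<Rightarrow> bool) measure" where
  "choice_space p = (\<Pi>\<^sub>M j\<in>UNIV. measure_pmf (bernoulli_pmf ((p j)\<^sup>2)))"

definition walk_measure :: "nat \<Rightarrow> (nat \<Rightarrow> real) \<Rightarrow> path \<Rightarrow> (nat \<Rightarrow> diagram) measure" where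
  "walk_measure k p t = distr (choice_space p) tableau_space (walk_tableau k t)"

definition spectral_measure :: "nat \<Rightarrow> (nat \<Rightarrow> real) \<Rightarrow> (nat \<Rightarrow> diagram) measure" where
  "spectral_measure k p = measure_of infinite_tableaux (sets tableau_space)
     (\<lambda>A. \<integral>\<^sup>+ t. emeasure (walk_measure k p t) A \<partial>count_space (proper_tableaux k))"


section \<open>Basic properties of the measures\<close>

lemma path_bounds:
  "successively (\<nearrow>) t \<Longrightarrow> t \<noteq> [] \<Longrightarrow>
     (\<forall>x\<in>set t. x \<subseteq> last t) \<and> card (last t) = card (hd t) + (length t - 1)"
proof (induction t rule: induct_list012)
  case (3 x y zs)
  then show ?case by (auto simp: young_edge_def)
qed auto

lemma finite_paths:
  assumes "finite \<mu>"
  shows "finite (paths \<kappa> \<mu>)"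
proof (rule finite_subset)
  show "paths \<kappa> \<mu> \<subseteq> {t. set t \<subseteq> Pow \<mu> \<and> length t \<le> Suc (card \<mu>)}"
    unfolding paths_def using path_bounds by fastforce
  show "finite {t. set t \<subseteq> Pow \<mu> \<and> length t \<le> Suc (card \<mu>)}"
    by (rule finite_lists_length_le) (use assms in simp)
qed

lemma finite_two_row [simp]: "finite (two_row a b)"
  by (simp add: two_row_def)

lemma card_two_row [simp]: "card (two_row a b) = a + b"
  unfolding two_row_def by (subst card_Un_disjoint) auto

lemma young_diagram_two_row: "b \<le> a \<Longrightarrow> young_diagram (two_row a b)"
  by (auto simp: young_diagram_def two_row_def le_Suc_eq)

lemma two_row_edge1: "b \<le> a \<Longrightarrow> two_row a b \<nearrow> two_row (Suc a) b"
  by (auto simp: young_edge_def young_diagram_two_row) (auto simp: two_row_def)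

lemma two_row_edge2: "b < a \<Longrightarrow> two_row a b \<nearrow> two_row a (Suc b)"
  by (auto simp: young_edge_def young_diagram_two_row) (auto simp: two_row_def)

lemma t21_path:
  "1 \<le> k \<Longrightarrow> t21 k j \<in> paths (two_row (k + j) j) (two_row (k + j + 1) (j + 1))"
  unfolding paths_def t21_def
  using two_row_edge2[of j "k + j"] two_row_edge1[of "Suc j" "k + j"] by simp

lemma t12_path:
  "1 \<le> k \<Longrightarrow> t12 k j \<in> paths (two_row (k + j) j) (two_row (k + j + 1) (j + 1))"
  unfolding paths_def t12_def
  using two_row_edge1[of j "k + j"] two_row_edge2[of j "Suc (k + j)"] by simp

lemma followed_by_paths:
  assumes t: "t \<in> paths \<kappa> \<mu>" and u: "u \<in> paths \<mu> \<nu>"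
  shows "followed_by t u \<in> paths \<kappa> \<nu>"
proof (cases u)
  case Nil
  with u show ?thesis by (simp add: paths_def)
next
  case (Cons x us)
  with t u show ?thesis
    by (cases us) (auto simp: paths_def followed_by_def successively_append_iff)
qed

lemma tableaux_two_row_cells:
  assumes "t \<in> tableaux (two_row a b)"
  shows "cells t = a + b" "length t = Suc (a + b)"
  using assms path_bounds[of t] by (cases t; auto simp: tableaux_def paths_def cells_def)+

lemma walk_segment_tableaux:
  assumes "1 \<le> k" and "t \<in> tableaux (two_row (k + b) b)"
  shows "walk_segment k t \<omega> m \<in> tableaux (two_row (k + (b + m)) (b + m))"
proof (induction m)
  case 0
  show ?case using assms(2) by simp
next
  case (Suc m)
  let ?s = "walk_segment k t \<omega> m"
  have "(cells ?s - k) div 2 = b + m"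
    using tableaux_two_row_cells(1)[OF Suc] by simp
  then show ?case
    using Suc followed_by_paths[OF _ t21_path[OF assms(1)], of ?s "{}" "b + m"]
      followed_by_paths[OF _ t12_path[OF assms(1)], of ?s "{}" "b + m"]
    by (auto simp: Let_def tableaux_def)
qed

lemma walk_segment_Suc:
  assumes "1 \<le> k" and "t \<in> tableaux (two_row (k + b) b)"
  shows "walk_segment k t \<omega> (Suc m) = followed_by (walk_segment k t \<omega> m)
           (if \<omega> (b + m) then t21 k (b + m) else t12 k (b + m))"
proof -
  have "(cells (walk_segment k t \<omega> m) - k) div 2 = b + m"
    using tableaux_two_row_cells(1)[OF walk_segment_tableaux[OF assms]] by simp
  then show ?thesis by (simp add: Let_def)
qed

lemma walk_segment_length:
  assumes "1 \<le> k" and "t \<in> tableaux (two_row (k + b) b)"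
  shows "length (walk_segment k t \<omega> m) = Suc (k + 2 * (b + m))"
  using tableaux_two_row_cells(2)[OF walk_segment_tableaux[OF assms]] by simp

lemma walk_segment_nth:
  assumes "1 \<le> k" and "t \<in> tableaux (two_row (k + b) b)" and "n \<le> k + 2 * (b + m)" and "m \<le> m'"
  shows "walk_segment k t \<omega> m' ! n = walk_segment k t \<omega> m ! n"
  using assms(4)
proof (induction m' rule: dec_induct)
  case (step m')
  then show ?case
    using assms(3) by (simp add: walk_segment_Suc[OF assms(1,2)] followed_by_def nth_append
        walk_segment_length[OF assms(1,2)] del: walk_segment.simps)
qed simp

lemma walk_tableau_nth:
  assumes "1 \<le> k" and "t \<in> tableaux (two_row (k + b) b)" and "n \<le> k + 2 * (b + m)"
  shows "walk_tableau k t \<omega> n = walk_segment k t \<omega> m ! n"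
  using walk_segment_nth[OF assms(1,2), of n n "max m n" \<omega>]
    walk_segment_nth[OF assms(1,2), of n m "max m n" \<omega>] assms(3)
  by (simp add: walk_tableau_def)

lemma walk_tableau_infinite:
  assumes "1 \<le> k" and "t \<in> tableaux (two_row (k + b) b)"
  shows "walk_tableau k t \<omega> \<in> infinite_tableaux"
proof -
  have "walk_tableau k t \<omega> 0 = {}"
    using assms(2) by (cases t) (auto simp: walk_tableau_def tableaux_def paths_def)
  moreover have "walk_tableau k t \<omega> n \<nearrow> walk_tableau k t \<omega> (Suc n)" for n
  proof -
    have "successively (\<nearrow>) (walk_segment k t \<omega> (Suc n))"
      using walk_segment_tableaux[OF assms] by (auto simp: tableaux_def paths_def simp del: walk_segment.simps)
    then have "walk_segment k t \<omega> (Suc n) ! n \<nearrow> walk_segment k t \<omega> (Suc n) ! Suc n"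
      using walk_segment_length[OF assms, of \<omega> "Suc n"]
      by (auto simp: successively_conv_nth simp del: walk_segment.simps)
    then show ?thesis
      using walk_tableau_nth[OF assms, of n "Suc n" \<omega>] walk_tableau_nth[OF assms, of "Suc n" "Suc n" \<omega>]
      by (simp del: walk_segment.simps)
  qed
  ultimately show ?thesis by (simp add: infinite_tableaux_def)
qed

lemma space_tableau_space [simp]: "space tableau_space = infinite_tableaux"
  by (auto simp: tableau_space_def space_measure_of_conv)

lemma cylinder_subset: "range cylinder \<subseteq> Pow infinite_tableaux"
  by (auto simp: cylinder_def)

lemma space_choice_space [simp]: "space (choice_space p) = UNIV"
  by (simp add: choice_space_def space_PiM)

lemma prob_space_choice_space: "prob_space (choice_space p)"
  unfolding choice_space_def by (intro prob_space_PiM prob_space_measure_pmf)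

lemma measurable_walk_segment:
  assumes "1 \<le> k" and "t \<in> tableaux (two_row (k + b) b)"
  shows "(\<lambda>\<omega>. walk_segment k t \<omega> m) \<in> choice_space p \<rightarrow>\<^sub>M count_space UNIV"
proof (induction m)
  case (Suc m)
  have choice: "(\<lambda>\<omega>. \<omega> j) \<in> choice_space p \<rightarrow>\<^sub>M count_space UNIV" for j
    unfolding choice_space_def
    by (rule measurable_cong_sets[THEN equalityD1, THEN subsetD, rotated 2,
          OF measurable_component_singleton[of j UNIV]]) auto
  have set: "{\<omega> \<in> space (choice_space p). \<omega> j} \<in> sets (choice_space p)" for j
    using measurable_sets[OF choice[of j], of "{True}"] by (simp add: vimage_def)
  have "(\<lambda>\<omega>. followed_by (walk_segment k t \<omega> m) u) \<in> choice_space p \<rightarrow>\<^sub>M count_space UNIV" for u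
    using measurable_compose[OF Suc, of "\<lambda>s. followed_by s u"] by simp
  then have "(\<lambda>\<omega>. if \<omega> (b + m) then followed_by (walk_segment k t \<omega> m) (t21 k (b + m))
      else followed_by (walk_segment k t \<omega> m) (t12 k (b + m))) \<in> choice_space p \<rightarrow>\<^sub>M count_space UNIV"
    using set by (intro measurable_If) auto
  also have "?this \<longleftrightarrow> ?case"
    by (intro measurable_cong) (simp add: walk_segment_Suc[OF assms] del: walk_segment.simps)
  finally show ?case .
qed simp

lemma measurable_walk_tableau:
  assumes "1 \<le> k" and "t \<in> proper_tableaux k"
  shows "walk_tableau k t \<in> choice_space p \<rightarrow>\<^sub>M tableau_space"
proof -
  obtain b where t: "t \<in> tableaux (two_row (k + b) b)"
    using assms(2) by (auto simp: proper_tableaux_def add.commute)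
  show ?thesis
    unfolding tableau_space_def
  proof (rule measurable_measure_of[OF cylinder_subset])
    show "walk_tableau k t \<in> space (choice_space p) \<rightarrow> infinite_tableaux"
      using walk_tableau_infinite[OF assms(1) t] by auto
    fix A assume "A \<in> range cylinder"
    then obtain s where A: "A = cylinder s" by auto
    have "initial_segment (walk_tableau k t \<omega>) (cells s)
        = take (Suc (cells s)) (walk_segment k t \<omega> (cells s))" for \<omega>
      using walk_tableau_nth[OF assms(1) t, of _ "cells s" \<omega>]
        walk_segment_length[OF assms(1) t, of \<omega> "cells s"]
      by (intro nth_equalityI) (auto simp: initial_segment_def simp del: upt_Suc)
    then have "walk_tableau k t -` A \<inter> space (choice_space p) =
        (\<lambda>\<omega>. walk_segment k t \<omega> (cells s)) -` {x. take (Suc (cells s)) x = s} \<inter> space (choice_space p)"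
      using walk_tableau_infinite[OF assms(1) t] by (auto simp: A cylinder_def)
    then show "walk_tableau k t -` A \<inter> space (choice_space p) \<in> sets (choice_space p)"
      using measurable_sets[OF measurable_walk_segment[OF assms(1) t],
          of "{x. take (Suc (cells s)) x = s}" "cells s"] by simp
  qed
qed

lemma prob_space_walk_measure:
  "1 \<le> k \<Longrightarrow> t \<in> proper_tableaux k \<Longrightarrow> prob_space (walk_measure k p t)"
  unfolding walk_measure_def
  by (intro prob_space.prob_space_distr prob_space_choice_space measurable_walk_tableau)

lemma sets_spectral_measure [simp]: "sets (spectral_measure k p) = sets tableau_space"
  and space_spectral_measure [simp]: "space (spectral_measure k p) = infinite_tableaux"
  unfolding spectral_measure_def using sets.sigma_sets_eq[of tableau_space] sets.space_closed[of tableau_space]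
  by simp_all

lemma emeasure_spectral_measure:
  assumes "A \<in> sets tableau_space"
  shows "emeasure (spectral_measure k p) A =
    (\<integral>\<^sup>+ t. emeasure (walk_measure k p t) A \<partial>count_space (proper_tableaux k))"
proof (rule emeasure_measure_of[OF spectral_measure_def])
  show "sets tableau_space \<subseteq> Pow infinite_tableaux"
    using sets.space_closed[of tableau_space] by simp
  show "A \<in> sets (spectral_measure k p)"
    using assms by simp
  show "positive (sets (spectral_measure k p))
     (\<lambda>A. \<integral>\<^sup>+ t. emeasure (walk_measure k p t) A \<partial>count_space (proper_tableaux k))"
    by (simp add: positive_def)
  show "countably_additive (sets (spectral_measure k p))
     (\<lambda>A. \<integral>\<^sup>+ t. emeasure (walk_measure k p t) A \<partial>count_space (proper_tableaux k))"
    unfolding countably_additive_def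
  proof (intro allI impI)
    fix B :: "nat \<Rightarrow> (nat \<Rightarrow> diagram) set"
    assume "range B \<subseteq> sets (spectral_measure k p)" "disjoint_family B"
    then have "suminf (\<lambda>i. emeasure (walk_measure k p t) (B i)) = emeasure (walk_measure k p t) (\<Union>i. B i)" for t
      by (intro suminf_emeasure) (auto simp: walk_measure_def)
    then show "suminf (\<lambda>i. \<integral>\<^sup>+ t. emeasure (walk_measure k p t) (B i) \<partial>count_space (proper_tableaux k))
        = (\<integral>\<^sup>+ t. emeasure (walk_measure k p t) (\<Union>i. B i) \<partial>count_space (proper_tableaux k))"
      by (subst nn_integral_suminf[symmetric]) auto
  qed
qed

end

theory Submission
  imports Defs
begin

text \<open>
  A tableau \<open>t\<close> with the diagram \<open>(k + j, j)\<close> of level \<open>j\<close> gives a unit vector of the inductive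
  limit, here \<open>level_vec j t\<close>; this vector is \<open>p j\<close> times the vector of \<open>t\<close> followed by \<open>t21 k j\<close>
  plus \<open>q j\<close> times the vector of \<open>t\<close> followed by \<open>t12 k j\<close>. Linear combinations of these vectors are
  dense.

  The Gelfand-Tsetlin algebra is diagonal on these vectors. It contains the Jucys-Murphy elements, as
  differences of sums of all transpositions of two consecutive symmetric groups, and these have the
  tableaux as eigenvectors with the contents of the cells as eigenvalues
  (\<open>jucys_murphy_level_vec\<close>). The contents determine the tableau, and every element of the algebra
  commutes with the Jucys-Murphy elements, so it has the tableaux as eigenvectors as well
  (\<open>gelfand_tsetlin_eigenvector\<close>). The eigenvalue depends only on an initial segment of the
  tableau, since Young's orthogonal form restricts to smaller symmetric groups
  (\<open>eigenvalue_initial_part\<close>). Conversely, polynomials in the Jucys-Murphy elements produce every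
  function of an initial segment (\<open>gelfand_tsetlin_interpolation\<close>).

  A vector with nonzero coordinates at all tableaux of all levels can be moved at each level to any
  vector of the level. Starting with a vector of level 0 and adding in turn small multiples of the
  basis vectors of each level that do not occur in the previous one gives a limit for which the
  errors at higher levels are controlled, so it is cyclic (\<open>simple_spectrum\<close>).

  If all \<open>p j\<close> and \<open>q j\<close> are nonzero, the infinite tableaux that begin with a tableau \<open>s\<close> of some
  level and only take nice steps afterwards have the measure \<open>(weight j s)^2\<close>, where \<open>weight j s\<close> is
  the product of the coefficients along the nice steps at the end of \<open>s\<close>
  (\<open>spectral_measure_nice_cylinder\<close>). Sending the vector of \<open>s\<close> to the indicator of this set divided
  by \<open>weight j s\<close> is therefore isometric, and it is compatible with the embeddings of the levels
  (\<open>level_fun_lift\<close>). Completeness of both Hilbert spaces extends this map to a unitary map; it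
  is onto because these sets generate the \<open>\<sigma>\<close>-algebra up to a null set
  (\<open>represents_exists\<close>, \<open>represents_surjective\<close>, \<open>zero_on_nice_cylinder\<close>). As the eigenvalue of a
  Gelfand-Tsetlin element is constant on these sets for all high levels, the element becomes the
  multiplication by its eigenvalue (\<open>represents_ga_act\<close>).
\<close>

section \<open>Complex inner products\<close>

context
  fixes x y z :: "'h::complex_inner"
begin

lemma cinner_add_left: "cinner (x + y) z = cinner x z + cinner y z"
  by (metis cinner_add_right cinner_commute complex_cnj_add)

lemma cinner_scaleC_left: "cinner (a *\<^sub>C x) y = cnj a * cinner x y"
  by (metis cinner_commute cinner_scaleC_right complex_cnj_mult)

lemma scaleC_zero_left [simp]: "0 *\<^sub>C x = 0"
  using scaleC_of_real[of 0 x] by simp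

lemma scaleC_one [simp]: "1 *\<^sub>C x = x"
  using scaleC_of_real[of 1 x] by simp

lemma scaleC_minus1: "(- 1) *\<^sub>C x = - x"
  using scaleC_of_real[of "-1" x] by simp

end

lemma scaleC_zero_right [simp]: "a *\<^sub>C (0::'h::complex_inner) = 0"
  using scaleC_scaleC[of a 0 "0::'h"] by simp

lemma scaleC_minus_right: "a *\<^sub>C (- x) = - (a *\<^sub>C (x::'h::complex_inner))"
  using scaleC_add_right[of a x "- x"] by (simp add: eq_neg_iff_add_eq_0 add.commute)

lemma scaleC_diff_right: "a *\<^sub>C (x - y) = a *\<^sub>C x - a *\<^sub>C (y::'h::complex_inner)"
  using scaleC_add_right[of a x "- y"] by (simp add: scaleC_minus_right)

lemma scaleC_diff_left: "(a - b) *\<^sub>C x = a *\<^sub>C x - b *\<^sub>C (x::'h::complex_inner)"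
  using scaleC_add_left[of "a - b" b x] by simp

lemma scaleC_sum_right: "a *\<^sub>C (\<Sum>i\<in>A. f i) = (\<Sum>i\<in>A. a *\<^sub>C (f i :: 'h::complex_inner))"
  by (induction A rule: infinite_finite_induct) (simp_all add: scaleC_add_right)

lemma cinner_zero_right [simp]: "cinner x (0::'h::complex_inner) = 0"
  using cinner_scaleC_right[of x 0 "0::'h"] by simp

lemma cinner_minus_right: "cinner x (- y) = - cinner x (y::'h::complex_inner)"
  using cinner_scaleC_right[of x "-1" y] by (simp add: scaleC_minus1)

lemma cinner_diff_right: "cinner x (y - z) = cinner x y - cinner x (z::'h::complex_inner)"
  using cinner_add_right[of x y "- z"] by (simp add: cinner_minus_right)

lemma cinner_sum_right: "cinner x (\<Sum>i\<in>A. f i) = (\<Sum>i\<in>A. cinner x (f i :: 'h::complex_inner))"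
  by (induction A rule: infinite_finite_induct) (simp_all add: cinner_add_right)

lemma cinner_self: "cinner x x = of_real ((norm (x::'h::complex_inner))\<^sup>2)"
proof (rule complex_eqI)
  show "Re (cinner x x) = Re (of_real ((norm x)\<^sup>2))"
    by (simp add: norm_eq_sqrt_cinner cinner_nonneg)
  have "Im (cinner x x) = - Im (cinner x x)"
    using arg_cong[OF cinner_commute[of x x], of Im] by simp
  then show "Im (cinner x x) = Im (of_real ((norm x)\<^sup>2))"
    by simp
qed

lemma norm_sq_eq_cinner: "(norm (x::'h::complex_inner))\<^sup>2 = Re (cinner x x)"
  by (simp add: cinner_self)

lemma norm_scaleC: "norm (a *\<^sub>C (x::'h::complex_inner)) = cmod a * norm x"
proof -
  have "cinner (a *\<^sub>C x) (a *\<^sub>C x) = of_real ((cmod a * norm x)\<^sup>2)"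
    unfolding cinner_scaleC_left cinner_scaleC_right cinner_self[of x] power_mult_distrib
      of_real_mult complex_norm_square by (simp add: mult_ac)
  then have "(norm (a *\<^sub>C x))\<^sup>2 = (cmod a * norm x)\<^sup>2"
    by (simp only: norm_sq_eq_cinner Re_complex_of_real)
  then show ?thesis
    by (simp add: power2_eq_iff_nonneg)
qed

lemma norm_add_sq: "(norm (x + y))\<^sup>2 = (norm x)\<^sup>2 + (norm y)\<^sup>2 + 2 * Re (cinner x (y::'h::complex_inner))"
proof -
  have "Re (cinner y x) = Re (cinner x y)"
    using arg_cong[OF cinner_commute[of x y], of Re] by simp
  then show ?thesis
    by (simp add: norm_sq_eq_cinner cinner_add_left cinner_add_right)
qed

lemma norm_diff_sq: "(norm (x - y))\<^sup>2 = (norm x)\<^sup>2 + (norm y)\<^sup>2 - 2 * Re (cinner x (y::'h::complex_inner))"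
  using norm_add_sq[of x "- y"] by (simp add: cinner_minus_right)

lemma Re_cinner_polarization:
  "Re (cinner x y) = ((norm (x + y))\<^sup>2 - (norm (x - (y::'h::complex_inner)))\<^sup>2) / 4"
  by (simp add: norm_add_sq norm_diff_sq)

lemma Im_cinner: "Im (cinner x y) = - Re (cinner x (\<i> *\<^sub>C (y::'h::complex_inner)))"
  by (simp add: cinner_scaleC_right)

lemma tendsto_scaleC:
  assumes "(f \<longlongrightarrow> (l::'h::complex_inner)) F"
  shows "((\<lambda>i. a *\<^sub>C f i) \<longlongrightarrow> a *\<^sub>C l) F"
proof -
  have "((\<lambda>i. cmod a * norm (f i - l)) \<longlongrightarrow> 0) F"
    using assms by (auto intro!: tendsto_mult_right_zero tendsto_norm_zero simp: LIM_zero_iff)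
  then have "((\<lambda>i. a *\<^sub>C f i - a *\<^sub>C l) \<longlongrightarrow> 0) F"
    by (auto intro: tendsto_norm_zero_cancel simp flip: norm_scaleC scaleC_diff_right)
  then show ?thesis
    by (simp add: LIM_zero_iff)
qed

lemma tendsto_cinner:
  fixes l m :: "'h::complex_inner"
  assumes "(f \<longlongrightarrow> l) F" "(g \<longlongrightarrow> m) F"
  shows "((\<lambda>i. cinner (f i) (g i)) \<longlongrightarrow> cinner l m) F"
proof -
  have "((\<lambda>i. Re (cinner (f i) (g i))) \<longlongrightarrow> Re (cinner l m)) F"
    if "(g \<longlongrightarrow> m) F" for g and m :: 'h
    unfolding Re_cinner_polarization by (intro tendsto_intros assms(1) that) simp
  from this[OF assms(2)] this[OF tendsto_scaleC[OF assms(2), of \<i>]] show ?thesis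
    unfolding tendsto_complex_iff Im_cinner by (auto intro: tendsto_minus)
qed

section \<open>The infinite symmetric group and its group algebra\<close>

lemma sym_group_mono: "M \<le> N \<Longrightarrow> sym_group M \<subseteq> sym_group N"
  by (auto simp: sym_group_def)

lemma one_in_sym_group: "1 \<in> sym_group N"
  by (simp add: sym_group_def)

lemma times_in_sym_group:
  "\<sigma> \<in> sym_group N \<Longrightarrow> \<tau> \<in> sym_group N \<Longrightarrow> \<sigma> * \<tau> \<in> sym_group N"
  unfolding sym_group_def using affected_times[of \<sigma> \<tau>] by blast

lemma inverse_in_sym_group: "\<sigma> \<in> sym_group N \<Longrightarrow> inverse \<sigma> \<in> sym_group N"
  by (simp add: sym_group_def)

lemma swap_in_sym_group: "i < N \<Longrightarrow> l < N \<Longrightarrow> Perm.swap i l \<in> sym_group N"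
  by (cases "i = l") (auto simp: sym_group_def affected_swap)

lemma sym_group_apply_less:
  assumes "\<sigma> \<in> sym_group N" "i < N"
  shows "Perm.apply \<sigma> i < N"
  using assms apply_affected[of \<sigma> i] by (cases "i \<in> affected \<sigma>") (auto simp: sym_group_def in_affected)

text \<open>
  Bubble sort: if \<open>\<sigma>\<close> moves the last point, composing with an adjacent transposition
  brings its image one step closer to the last point.
\<close>

lemma sym_group_induct [consumes 1, case_names one swap]:
  assumes "\<sigma> \<in> sym_group N" and "P 1"
    and swap: "\<And>i \<tau>. Suc i < N \<Longrightarrow> \<tau> \<in> sym_group N \<Longrightarrow> P \<tau> \<Longrightarrow> P (Perm.swap i (Suc i) * \<tau>)"
  shows "P \<sigma>"
  using assms(1) swap
proof (induction N arbitrary: \<sigma>)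
  case 0
  then have "\<sigma> = 1"
    by (simp add: sym_group_def)
  with assms(2) show ?case by simp
next
  case (Suc N)
  note step = Suc.prems(2)
  have small: "P \<tau>" if "\<tau> \<in> sym_group N" for \<tau>
    by (rule Suc.IH[OF that]) (use Suc.prems(2) sym_group_mono[of N "Suc N"] in auto)
  have "P \<tau>" if "\<tau> \<in> sym_group (Suc N)" "N - Perm.apply \<tau> N = d" for d \<tau>
    using that
  proof (induction d arbitrary: \<tau>)
    case 0
    have "Perm.apply \<tau> N \<le> N"
      using sym_group_apply_less[OF 0(1), of N] by simp
    with 0 have "N \<notin> affected \<tau>"
      by (simp add: in_affected)
    with 0(1) have "\<tau> \<in> sym_group N"
      by (auto simp: sym_group_def lessThan_Suc)
    then show ?case by (rule small)
  next
    case (Suc d)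
    define m where "m = Perm.apply \<tau> N"
    define s where "s = Perm.swap m (Suc m)"
    have m: "Suc m < Suc N"
      using Suc(3) by (simp add: m_def)
    then have s: "s \<in> sym_group (Suc N)"
      unfolding s_def by (intro swap_in_sym_group) auto
    have "P (s * \<tau>)"
    proof (rule Suc.IH)
      show "s * \<tau> \<in> sym_group (Suc N)"
        by (intro times_in_sym_group s Suc.prems)
      show "N - Perm.apply (s * \<tau>) N = d"
        using Suc(3) by (simp add: apply_times s_def flip: m_def)
    qed
    then have "P (s * (s * \<tau>))"
      using step[OF m times_in_sym_group[OF s Suc.prems(1)]] by (simp add: s_def)
    moreover have "s * (s * \<tau>) = \<tau>"
      by (metis mult.assoc swap_self s_def mult_1_left)
    ultimately show ?case by simp
  qed
  then show ?case
    using Suc.prems(1) by blast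
qed

lemma ga_act_superset:
  assumes "finite K" "Poly_Mapping.keys a \<subseteq> K"
  shows "ga_act U a x = (\<Sum>\<sigma>\<in>K. Poly_Mapping.lookup a \<sigma> *\<^sub>C U \<sigma> x)"
  unfolding ga_act_def using assms by (intro sum.mono_neutral_left) (auto simp: in_keys_iff)

lemma ga_act_add: "ga_act U (a + b) x = ga_act U a x + ga_act U b x"
proof -
  let ?K = "Poly_Mapping.keys a \<union> Poly_Mapping.keys b"
  have "Poly_Mapping.keys (a + b) \<subseteq> ?K"
    by (rule Poly_Mapping.keys_add)
  then show ?thesis
    by (simp add: ga_act_superset[of ?K] lookup_add scaleC_add_left sum.distrib)
qed

lemma ga_act_zero [simp]: "ga_act U 0 x = 0"
  by (simp add: ga_act_def)

lemma ga_act_sum: "ga_act U (\<Sum>i\<in>A. f i) x = (\<Sum>i\<in>A. ga_act U (f i) x)"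
  by (induction A rule: infinite_finite_induct) (simp_all add: ga_act_add)

lemma ga_act_single [simp]: "ga_act U (Poly_Mapping.single \<sigma> c) x = c *\<^sub>C U \<sigma> x"
  by (simp add: ga_act_superset[of "{\<sigma>}"])

lemma ga_mult_superset:
  assumes "finite K" "Poly_Mapping.keys a \<subseteq> K" "finite L" "Poly_Mapping.keys b \<subseteq> L"
  shows "ga_mult a b = (\<Sum>\<sigma>\<in>K. \<Sum>\<tau>\<in>L.
     Poly_Mapping.single (\<sigma> * \<tau>) (Poly_Mapping.lookup a \<sigma> * Poly_Mapping.lookup b \<tau>))"
proof -
  have "ga_mult a b = (\<Sum>\<sigma>\<in>Poly_Mapping.keys a. \<Sum>\<tau>\<in>L.
     Poly_Mapping.single (\<sigma> * \<tau>) (Poly_Mapping.lookup a \<sigma> * Poly_Mapping.lookup b \<tau>))"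
    unfolding ga_mult_def using assms
    by (intro sum.cong refl sum.mono_neutral_left) (auto simp: in_keys_iff)
  also have "\<dots> = (\<Sum>\<sigma>\<in>K. \<Sum>\<tau>\<in>L.
     Poly_Mapping.single (\<sigma> * \<tau>) (Poly_Mapping.lookup a \<sigma> * Poly_Mapping.lookup b \<tau>))"
    using assms by (intro sum.mono_neutral_left) (auto simp: in_keys_iff)
  finally show ?thesis .
qed

context
  fixes U :: "nat perm \<Rightarrow> 'h::complex_inner \<Rightarrow> 'h"
  assumes U: "unitary_rep U"
begin

lemma unitary_rep_add: "U \<sigma> (x + y) = U \<sigma> x + U \<sigma> y"
  and unitary_rep_scaleC: "U \<sigma> (a *\<^sub>C x) = a *\<^sub>C U \<sigma> x"
  and unitary_rep_cinner: "cinner (U \<sigma> x) (U \<sigma> y) = cinner x y"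
  and unitary_rep_one: "U 1 x = x"
  and unitary_rep_times: "U (\<sigma> * \<tau>) x = U \<sigma> (U \<tau> x)"
  using U by (simp_all add: unitary_rep_def)

lemma unitary_rep_zero: "U \<sigma> 0 = 0"
  using unitary_rep_add[of \<sigma> 0 0] by simp

lemma unitary_rep_diff: "U \<sigma> (x - y) = U \<sigma> x - U \<sigma> y"
  using unitary_rep_add[of \<sigma> "x - y" y] by simp

lemma unitary_rep_sum: "U \<sigma> (\<Sum>i\<in>A. f i) = (\<Sum>i\<in>A. U \<sigma> (f i))"
  by (induction A rule: infinite_finite_induct) (simp_all add: unitary_rep_add unitary_rep_zero)

lemma unitary_rep_norm: "norm (U \<sigma> x) = norm x"
  by (simp add: norm_eq_sqrt_cinner unitary_rep_cinner)

lemma unitary_rep_adjoint: "cinner x (U \<sigma> y) = cinner (U (inverse \<sigma>) x) y"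
  by (metis unitary_rep_cinner unitary_rep_times unitary_rep_one perm.left_inverse)

lemma ga_act_mult: "ga_act U (ga_mult a b) x = ga_act U a (ga_act U b x)"
proof -
  have "ga_act U a (ga_act U b x) = (\<Sum>\<sigma>\<in>Poly_Mapping.keys a. \<Sum>\<tau>\<in>Poly_Mapping.keys b.
      (Poly_Mapping.lookup a \<sigma> * Poly_Mapping.lookup b \<tau>) *\<^sub>C U (\<sigma> * \<tau>) x)"
    by (simp add: ga_act_def unitary_rep_sum unitary_rep_scaleC unitary_rep_times
        scaleC_sum_right scaleC_scaleC)
  then show ?thesis
    by (simp add: ga_mult_def ga_act_sum)
qed

lemma ga_act_add_right: "ga_act U a (x + y) = ga_act U a x + ga_act U a y"
  by (simp add: ga_act_def unitary_rep_add scaleC_add_right sum.distrib)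

lemma ga_act_scaleC_right: "ga_act U a (c *\<^sub>C x) = c *\<^sub>C ga_act U a x"
  by (simp add: ga_act_def unitary_rep_scaleC scaleC_sum_right scaleC_scaleC mult.commute)

lemma ga_act_diff_right: "ga_act U a (x - y) = ga_act U a x - ga_act U a y"
  by (simp add: ga_act_def unitary_rep_diff scaleC_diff_right sum_subtractf)

lemma ga_act_zero_right: "ga_act U a 0 = 0"
  using ga_act_diff_right[of a 0 0] by simp

lemma ga_act_sum_right: "ga_act U a (\<Sum>i\<in>A. f i) = (\<Sum>i\<in>A. ga_act U a (f i))"
  by (induction A rule: infinite_finite_induct) (simp_all add: ga_act_add_right ga_act_zero_right)

lemma norm_ga_act_le:
  "norm (ga_act U a x) \<le> (\<Sum>\<sigma>\<in>Poly_Mapping.keys a. cmod (Poly_Mapping.lookup a \<sigma>)) * norm x"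
  unfolding ga_act_def sum_distrib_right
  by (rule order_trans[OF norm_sum]) (simp add: norm_scaleC unitary_rep_norm)

lemma tendsto_ga_act:
  assumes "(f \<longlongrightarrow> l) F"
  shows "((\<lambda>i. ga_act U a (f i)) \<longlongrightarrow> ga_act U a l) F"
proof -
  have "((\<lambda>i. (\<Sum>\<sigma>\<in>Poly_Mapping.keys a. cmod (Poly_Mapping.lookup a \<sigma>)) * norm (f i - l)) \<longlongrightarrow> 0) F"
    using assms by (auto intro!: tendsto_mult_right_zero tendsto_norm_zero simp: LIM_zero_iff)
  then have "((\<lambda>i. ga_act U a (f i) - ga_act U a l) \<longlongrightarrow> 0) F"
    by (rule Lim_null_comparison[rotated])
      (use norm_ga_act_le in \<open>auto simp flip: ga_act_diff_right\<close>)
  then show ?thesis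
    by (simp add: LIM_zero_iff)
qed

end

definition class_sum :: "complex \<Rightarrow> nat perm set \<Rightarrow> group_algebra" where
  "class_sum c T = (\<Sum>\<sigma>\<in>T. Poly_Mapping.single \<sigma> c)"

lemma lookup_class_sum:
  "finite T \<Longrightarrow> Poly_Mapping.lookup (class_sum c T) \<sigma> = (if \<sigma> \<in> T then c else 0)"
  by (simp add: class_sum_def lookup_sum lookup_single when_def)

lemma keys_class_sum: "finite T \<Longrightarrow> Poly_Mapping.keys (class_sum c T) \<subseteq> T"
  by (auto simp: in_keys_iff lookup_class_sum split: if_splits)

text \<open>
  Multiplying by a permutation from the left and from the right differs by a conjugation, which
  permutes the summands.
\<close>

lemma class_sum_central:
  assumes "finite T" and "T \<subseteq> sym_group N"
    and conj: "\<And>\<sigma> \<tau>. \<sigma> \<in> T \<Longrightarrow> \<tau> \<in> sym_group N \<Longrightarrow> \<tau> * \<sigma> * inverse \<tau> \<in> T"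
  shows "class_sum c T \<in> sym_algebra_center N"
proof -
  have "ga_mult (class_sum c T) b = ga_mult b (class_sum c T)" if b: "b \<in> sym_algebra N" for b
  proof -
    let ?K = "Poly_Mapping.keys b"
    have "ga_mult (class_sum c T) b =
        (\<Sum>\<tau>\<in>?K. \<Sum>\<sigma>\<in>T. Poly_Mapping.single (\<sigma> * \<tau>) (c * Poly_Mapping.lookup b \<tau>))"
      using assms(1) keys_class_sum[OF assms(1)]
      by (subst ga_mult_superset[of T _ ?K], simp_all, subst sum.swap)
        (simp add: lookup_class_sum cong: sum.cong)
    also have "\<dots> = (\<Sum>\<tau>\<in>?K. \<Sum>\<sigma>\<in>T. Poly_Mapping.single (\<tau> * \<sigma>) (Poly_Mapping.lookup b \<tau> * c))"
    proof (rule sum.cong[OF refl])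
      fix \<tau> assume "\<tau> \<in> ?K"
      then have \<tau>: "\<tau> \<in> sym_group N"
        using b by (auto simp: sym_algebra_def)
      show "(\<Sum>\<sigma>\<in>T. Poly_Mapping.single (\<sigma> * \<tau>) (c * Poly_Mapping.lookup b \<tau>)) =
          (\<Sum>\<sigma>\<in>T. Poly_Mapping.single (\<tau> * \<sigma>) (Poly_Mapping.lookup b \<tau> * c))"
        by (rule sum.reindex_bij_witness[of _ "\<lambda>\<sigma>. \<tau> * \<sigma> * inverse \<tau>" "\<lambda>\<sigma>. inverse \<tau> * \<sigma> * \<tau>"])
          (use conj[OF _ \<tau>] conj[OF _ inverse_in_sym_group[OF \<tau>]] in
            \<open>auto simp: mult.assoc perm.left_inverse perm.right_inverse mult.commute[of c]
              simp flip: mult.assoc[of \<tau> "inverse \<tau>"] mult.assoc[of "inverse \<tau>" \<tau>]\<close>)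
    qed
    also have "\<dots> = ga_mult b (class_sum c T)"
      using assms(1) keys_class_sum[OF assms(1)]
      by (subst ga_mult_superset[of ?K _ T], simp_all) (simp add: lookup_class_sum cong: sum.cong)
    finally show ?thesis .
  qed
  moreover have "class_sum c T \<in> sym_algebra N"
    using keys_class_sum[OF assms(1)] assms(2) by (auto simp: sym_algebra_def)
  ultimately show ?thesis
    by (simp add: sym_algebra_center_def)
qed

definition transpositions :: "nat \<Rightarrow> nat perm set" where
  "transpositions N = {Perm.swap l i | l i. l < i \<and> i < N}"

lemma finite_transpositions: "finite (transpositions N)"
proof -
  have "transpositions N \<subseteq> (\<lambda>(l, i). Perm.swap l i) ` ({..<N} \<times> {..<N})"
    by (force simp: transpositions_def)
  then show ?thesis
    by (rule finite_subset) simp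
qed

lemma conj_swap: "\<tau> * Perm.swap l i * inverse \<tau> = Perm.swap (Perm.apply \<tau> l) (Perm.apply \<tau> i)"
proof -
  have "\<tau> * Perm.swap l i = Perm.swap (Perm.apply \<tau> l) (Perm.apply \<tau> i) * \<tau>"
    by (rule perm_eqI) (auto simp: apply_times Perm.swap.rep_eq Transposition.transpose_def apply_inj)
  then show ?thesis
    by (simp add: mult.assoc perm.right_inverse)
qed

lemma swap_in_transpositions: "l < N \<Longrightarrow> i < N \<Longrightarrow> l \<noteq> i \<Longrightarrow> Perm.swap l i \<in> transpositions N"
  by (cases "l < i") (auto simp: transpositions_def, metis swap_sym linorder_neqE_nat)

lemma transpositions_central: "class_sum c (transpositions N) \<in> sym_algebra_center N"
proof (rule class_sum_central[OF finite_transpositions])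
  show "transpositions N \<subseteq> sym_group N"
    by (auto simp: transpositions_def intro: swap_in_sym_group)
  fix \<sigma> \<tau> assume \<sigma>: "\<sigma> \<in> transpositions N" and \<tau>: "\<tau> \<in> sym_group N"
  then obtain l i where "\<sigma> = Perm.swap l i" "l < i" "i < N"
    by (auto simp: transpositions_def)
  with \<tau> show "\<tau> * \<sigma> * inverse \<tau> \<in> transpositions N"
    by (auto simp: conj_swap apply_inj sym_group_apply_less intro!: swap_in_transpositions)
qed

lemma scalar_in_gelfand_tsetlin: "Poly_Mapping.single 1 c \<in> gelfand_tsetlin"
proof -
  have "class_sum c {1} \<in> sym_algebra_center 1"
    by (rule class_sum_central) (auto simp: one_in_sym_group perm.right_inverse)
  then show ?thesis
    using gelfand_tsetlin.center[of 1] by (simp add: class_sum_def)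
qed

text \<open>
  The sum of the transpositions of \<open>i\<close> with all smaller numbers (\<open>jucys_murphy_eq\<close>). As a
  difference of two central class sums it visibly lies in the Gelfand-Tsetlin algebra.
\<close>

definition jucys_murphy :: "nat \<Rightarrow> group_algebra" where
  "jucys_murphy i = class_sum 1 (transpositions (Suc i)) + class_sum (- 1) (transpositions i)"

lemma jucys_murphy_in_gelfand_tsetlin: "jucys_murphy i \<in> gelfand_tsetlin"
proof -
  have "class_sum (- 1) (transpositions i) \<in> gelfand_tsetlin"
  proof (cases "i = 0")
    case True
    then show ?thesis
      using scalar_in_gelfand_tsetlin[of 0] by (simp add: class_sum_def transpositions_def)
  next
    case False
    then have "1 \<le> i" by simp
    from gelfand_tsetlin.center[OF this transpositions_central] show ?thesis .
  qed
  then show ?thesis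
    unfolding jucys_murphy_def
    using gelfand_tsetlin.add[OF gelfand_tsetlin.center[OF _ transpositions_central[of 1 "Suc i"]]]
    by simp
qed

lemma jucys_murphy_eq: "jucys_murphy i = (\<Sum>l<i. Poly_Mapping.single (Perm.swap l i) 1)"
proof -
  have new: "transpositions (Suc i) = transpositions i \<union> (\<lambda>l. Perm.swap l i) ` {..<i}"
    by (auto simp: transpositions_def less_Suc_eq)
  have "i \<notin> affected \<sigma>" if "\<sigma> \<in> transpositions i" for \<sigma>
    using that by (auto simp: transpositions_def affected_swap)
  moreover have "i \<in> affected (Perm.swap l i)" if "l < i" for l
    using that by (simp add: affected_swap)
  ultimately have disj: "transpositions i \<inter> (\<lambda>l. Perm.swap l i) ` {..<i} = {}"
    by blast
  have inj: "inj_on (\<lambda>l. Perm.swap l i) {..<i}"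
    by (rule inj_onI) (metis apply_swap_simp swap_sym)
  have "class_sum 1 (transpositions (Suc i)) =
      class_sum 1 (transpositions i) + (\<Sum>l<i. Poly_Mapping.single (Perm.swap l i) 1)"
    unfolding class_sum_def new
    by (subst sum.union_disjoint[OF finite_transpositions _ disj]) (simp_all add: sum.reindex[OF inj])
  moreover have "class_sum (- 1) (transpositions i) = - class_sum 1 (transpositions i)"
    by (simp add: class_sum_def single_uminus flip: sum_negf)
  ultimately show ?thesis
    by (simp add: jucys_murphy_def)
qed

section \<open>Tableaux with at most two rows\<close>

lemma two_row_mem: "(r, c) \<in> two_row a b \<longleftrightarrow> r = 0 \<and> c < a \<or> r = 1 \<and> c < b"
  by (auto simp: two_row_def)

lemma two_row_subset_iff: "two_row a b \<subseteq> two_row a' b' \<longleftrightarrow> a \<le> a' \<and> b \<le> b'"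
proof
  assume sub: "two_row a b \<subseteq> two_row a' b'"
  have "a \<le> a'"
    using subsetD[OF sub, of "(0, a - 1)"] by (cases a) (auto simp: two_row_mem)
  moreover have "b \<le> b'"
    using subsetD[OF sub, of "(1, b - 1)"] by (cases b) (auto simp: two_row_mem)
  ultimately show "a \<le> a' \<and> b \<le> b'" ..
qed (auto simp: two_row_def)

lemma two_row_eq_iff [simp]: "two_row a b = two_row a' b' \<longleftrightarrow> a = a' \<and> b = b'"
  by (auto simp: set_eq_subset two_row_subset_iff)

lemma two_row_0_0: "two_row 0 0 = {}"
  by (simp add: two_row_def)

lemma two_row_diff1: "two_row (Suc a) b - two_row a b = {(0, a)}"
  and two_row_diff2: "two_row a (Suc b) - two_row a b = {(1, b)}"
  and two_row_insert1: "insert (0, a) (two_row a b) = two_row (Suc a) b"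
  and two_row_insert2: "insert (1, b) (two_row a b) = two_row a (Suc b)"
  by (auto simp: two_row_def)

text \<open>
  The cell that is removed must be the last one of its row, because the smaller diagram is closed
  under moving left and up.
\<close>

lemma edge_two_row_cases:
  assumes "\<kappa> \<nearrow> two_row a b"
  obtains a' b' where "\<kappa> = two_row a' b'" "b' \<le> a'"
    "a = Suc a' \<and> b = b' \<or> a = a' \<and> b = Suc b'"
proof -
  have Y: "young_diagram \<kappa>" "young_diagram (two_row a b)" "\<kappa> \<subseteq> two_row a b"
    "card (two_row a b) = Suc (card \<kappa>)"
    using assms by (auto simp: young_edge_def)
  have fin: "finite \<kappa>"
    using Y(1) by (simp add: young_diagram_def)
  have closed: "(r', c') \<in> \<kappa>" if "(r, c) \<in> \<kappa>" "r' \<le> r" "c' \<le> c" for r c r' c'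
    using Y(1) that by (force simp: young_diagram_def)
  have ba: "b \<le> a"
  proof (cases b)
    case (Suc b')
    then have "(1, b') \<in> two_row a b" by (simp add: two_row_mem)
    then have "(0, b') \<in> two_row a b"
      using Y(2) by (force simp: young_diagram_def)
    with Suc show ?thesis by (simp add: two_row_mem)
  qed simp
  have "card (two_row a b - \<kappa>) = 1"
    using Y fin by (simp add: card_Diff_subset)
  then obtain r x where rx: "two_row a b - \<kappa> = {(r, x)}"
    by (metis card_1_singletonE surj_pair)
  then have \<kappa>: "\<kappa> = two_row a b - {(r, x)}" and notin: "(r, x) \<notin> \<kappa>"
    and isin: "(r, x) \<in> two_row a b"
    using Y(3) by blast+
  then have "r = 0 \<and> x < a \<or> r = 1 \<and> x < b"
    by (simp add: two_row_mem)
  then show thesis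
  proof
    assume *: "r = 0 \<and> x < a"
    have "\<not> Suc x < a"
      using closed[of 0 "Suc x" 0 x] notin * by (auto simp: \<kappa> two_row_mem)
    then have a: "a = Suc x" using * by simp
    have "\<not> x < b"
      using closed[of 1 x 0 x] notin * by (auto simp: \<kappa> two_row_mem)
    moreover have "\<kappa> = two_row x b"
      unfolding \<kappa> a using * by (auto simp: two_row_def)
    ultimately show thesis
      using that[of x b] a by simp
  next
    assume *: "r = 1 \<and> x < b"
    have "\<not> Suc x < b"
      using closed[of 1 "Suc x" 1 x] notin * by (auto simp: \<kappa> two_row_mem)
    then have b: "b = Suc x" using * by simp
    moreover have "\<kappa> = two_row a x"
      unfolding \<kappa> b using * by (auto simp: two_row_def)
    ultimately show thesis
      using that[of a x] ba by simp
  qed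
qed

lemma paths_take_drop:
  assumes "t \<in> paths \<kappa> \<mu>" "n < length t"
  shows "take (Suc n) t \<in> paths \<kappa> (t ! n)" and "drop n t \<in> paths (t ! n) \<mu>"
proof -
  have t: "t \<noteq> []" "hd t = \<kappa>" "last t = \<mu>" "successively (\<nearrow>) t"
    using assms by (auto simp: paths_def)
  have "successively (\<nearrow>) (take (Suc n) t)"
    using t(4) assms(2) by (auto simp: successively_conv_nth)
  then show "take (Suc n) t \<in> paths \<kappa> (t ! n)"
    using t assms(2) by (simp add: paths_def) (simp add: take_Suc_conv_app_nth)
  have "successively (\<nearrow>) (drop n t)"
    using t(4) assms(2) by (auto simp: successively_conv_nth)
  then show "drop n t \<in> paths (t ! n) \<mu>"
    using t assms(2) by (simp add: paths_def hd_drop_conv_nth)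
qed

lemma followed_by_take_drop: "n < length t \<Longrightarrow> followed_by (take (Suc n) t) (drop n t) = t"
  unfolding followed_by_def by (metis append_take_drop_id drop_Suc tl_drop)

lemma tableaux_length: "t \<in> tableaux \<kappa> \<Longrightarrow> length t = Suc (card \<kappa>)"
  using path_bounds[of t] by (cases t) (auto simp: tableaux_def paths_def)

lemma tableaux_last: "t \<in> tableaux \<kappa> \<Longrightarrow> t ! card \<kappa> = \<kappa>"
  using tableaux_length[of t \<kappa>] last_conv_nth[of t] by (auto simp: tableaux_def paths_def)

lemma tableaux_edge: "t \<in> tableaux \<kappa> \<Longrightarrow> n < card \<kappa> \<Longrightarrow> t ! n \<nearrow> t ! Suc n"
  using tableaux_length[of t \<kappa>] by (auto simp: tableaux_def paths_def successively_conv_nth)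

lemma tableaux_0: "t \<in> tableaux \<kappa> \<Longrightarrow> t ! 0 = {}"
  by (auto simp: tableaux_def paths_def hd_conv_nth)

lemma tableaux_take: "t \<in> tableaux \<kappa> \<Longrightarrow> n \<le> card \<kappa> \<Longrightarrow> take (Suc n) t \<in> tableaux (t ! n)"
  using paths_take_drop(1)[of t "{}" \<kappa> n] tableaux_length[of t \<kappa>] by (simp add: tableaux_def)

lemma tableauxI:
  assumes "length t = Suc n" "t ! 0 = {}" "t ! n = \<kappa>" "\<And>i. i < n \<Longrightarrow> t ! i \<nearrow> t ! Suc i"
  shows "t \<in> tableaux \<kappa>"
proof -
  have "t \<noteq> []" using assms(1) by auto
  with assms show ?thesis
    by (simp add: tableaux_def paths_def successively_conv_nth hd_conv_nth last_conv_nth)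
qed

lemma finite_tableaux: "finite \<kappa> \<Longrightarrow> finite (tableaux \<kappa>)"
  by (simp add: tableaux_def finite_paths)

lemma two_row_tableaux_nth:
  assumes "t \<in> tableaux (two_row a b)" "b \<le> a" "n \<le> a + b"
  obtains a' b' where "t ! n = two_row a' b'" "b' \<le> a'" "a' + b' = n"
proof -
  have "\<exists>a' b'. t ! n = two_row a' b' \<and> b' \<le> a' \<and> a' + b' = n"
    using assms(3)
  proof (induction n rule: inc_induct)
    case base
    then show ?case using tableaux_last[OF assms(1)] assms(2) by auto
  next
    case (step n)
    then obtain a' b' where "t ! Suc n = two_row a' b'" "b' \<le> a'" "a' + b' = Suc n"
      by auto
    moreover have "t ! n \<nearrow> t ! Suc n"
      using tableaux_edge[OF assms(1)] step by simp
    ultimately show ?case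
      by (auto elim!: edge_two_row_cases)
  qed
  with that show ?thesis by blast
qed

lemma two_row_tableaux_step:
  assumes "t \<in> tableaux (two_row a b)" "b \<le> a" "Suc n \<le> a + b" "t ! n = two_row a' b'"
  shows "t ! Suc n = two_row (Suc a') b' \<and> cell_of t n = (0, a') \<or>
    t ! Suc n = two_row a' (Suc b') \<and> b' < a' \<and> cell_of t n = (1, b')"
proof -
  obtain a'' b'' where *: "t ! Suc n = two_row a'' b''" "b'' \<le> a''" "a'' + b'' = Suc n"
    using two_row_tableaux_nth[OF assms(1-3)] .
  have "t ! n \<nearrow> two_row a'' b''"
    using tableaux_edge[OF assms(1), of n] assms(3) * by simp
  then show ?thesis
    using * assms(4) two_row_diff1[of a' b'] two_row_diff2[of a' b']
    by (elim edge_two_row_cases) (auto simp: cell_of_def)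
qed

lemma tableaux_update:
  assumes "t \<in> tableaux \<kappa>" "Suc n < card \<kappa>" "t ! n \<nearrow> \<mu>" "\<mu> \<nearrow> t ! Suc (Suc n)"
  shows "t[Suc n := \<mu>] \<in> tableaux \<kappa>"
proof (rule tableauxI)
  show "length (t[Suc n := \<mu>]) = Suc (card \<kappa>)"
    using tableaux_length[OF assms(1)] by simp
  show "t[Suc n := \<mu>] ! 0 = {}" "t[Suc n := \<mu>] ! card \<kappa> = \<kappa>"
    using assms(2) tableaux_0[OF assms(1)] tableaux_last[OF assms(1)] by auto
  show "t[Suc n := \<mu>] ! i \<nearrow> t[Suc n := \<mu>] ! Suc i" if "i < card \<kappa>" for i
    using that assms tableaux_edge[OF assms(1) that] tableaux_length[OF assms(1)]
    by (auto simp: nth_list_update)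
qed

text \<open>
  Two consecutive entries in the same row are neighbours. In different rows, they can only fail to be
  interchangeable when one stands right below the other. In these cases the axial distance is 1 or -1.
\<close>

lemma two_row_swap_cases:
  assumes t: "t \<in> tableaux (two_row a b)" "b \<le> a" "Suc i < a + b"
  shows "\<bar>axial_distance t i\<bar> = 1 \<or>
    axial_distance t i \<noteq> 0 \<and> swap_entries i t \<in> tableaux (two_row a b) \<and>
    cell_of (swap_entries i t) i = cell_of t (Suc i)"
proof -
  obtain a' b' where 0: "t ! i = two_row a' b'" "b' \<le> a'"
    by (rule two_row_tableaux_nth[OF t(1,2), of i]) (use t(3) in auto)
  have len: "length t = Suc (a + b)"
    using tableaux_length[OF t(1)] by simp
  have swap: "cell_of (swap_entries i t) i = cell_of t (Suc i)" if "cell_of t (Suc i) \<notin> t ! i"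
    using that len t(3) unfolding swap_entries_def by (simp add: cell_of_def[of "t[_ := _]"] insert_Diff_if)
  have upd: "swap_entries i t \<in> tableaux (two_row a b)"
    if "t ! i \<nearrow> insert (cell_of t (Suc i)) (t ! i)"
      "insert (cell_of t (Suc i)) (t ! i) \<nearrow> t ! Suc (Suc i)"
    unfolding swap_entries_def using tableaux_update[OF t(1) _ that] t(3) by simp
  consider
    (1) "t ! Suc i = two_row (Suc a') b'" "cell_of t i = (0, a')"
  | (2) "t ! Suc i = two_row a' (Suc b')" "b' < a'" "cell_of t i = (1, b')"
    using two_row_tableaux_step[OF t(1,2) _ 0(1)] t(3) by auto
  then show ?thesis
  proof cases
    case 1
    from two_row_tableaux_step[OF t(1,2) _ 1(1)] t(3)
    consider
      (11) "cell_of t (Suc i) = (0, Suc a')"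
    | (12) "t ! Suc (Suc i) = two_row (Suc a') (Suc b')" "cell_of t (Suc i) = (1, b')"
      by auto
    then show ?thesis
    proof cases
      case 11
      with 1 show ?thesis by (simp add: axial_distance_def cell_content_def)
    next
      case 12
      show ?thesis
      proof (cases "b' = a'")
        case True
        with 1 12 show ?thesis by (simp add: axial_distance_def cell_content_def)
      next
        case False
        then have b': "b' < a'" using 0 by simp
        have "axial_distance t i \<noteq> 0"
          using 1 12 b' by (simp add: axial_distance_def cell_content_def)
        moreover have "cell_of t (Suc i) \<notin> t ! i"
          using 0 12 by (simp add: two_row_mem)
        moreover have "swap_entries i t \<in> tableaux (two_row a b)"
          by (rule upd) (use 0 12 b' two_row_edge2[of b' a'] two_row_edge1[of "Suc b'" a']
              in \<open>simp_all add: two_row_insert2[simplified]\<close>)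
        ultimately show ?thesis using swap by simp
      qed
    qed
  next
    case 2
    from two_row_tableaux_step[OF t(1,2) _ 2(1)] t(3)
    consider
      (21) "t ! Suc (Suc i) = two_row (Suc a') (Suc b')" "cell_of t (Suc i) = (0, a')"
    | (22) "cell_of t (Suc i) = (1, Suc b')"
      by auto
    then show ?thesis
    proof cases
      case 21
      have "axial_distance t i \<noteq> 0"
        using 2 21 by (simp add: axial_distance_def cell_content_def)
      moreover have "cell_of t (Suc i) \<notin> t ! i"
        using 0 21 by (simp add: two_row_mem)
      moreover have "swap_entries i t \<in> tableaux (two_row a b)"
        by (rule upd) (use 0 21 2 two_row_edge1[of b' a'] two_row_edge2[of b' "Suc a'"]
            in \<open>simp_all add: two_row_insert1\<close>)
      ultimately show ?thesis using swap by simp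
    next
      case 22
      with 2 show ?thesis by (simp add: axial_distance_def cell_content_def)
    qed
  qed
qed

lemma two_row_cell_of_0:
  assumes "t \<in> tableaux (two_row a b)" "b \<le> a" "0 < a + b"
  shows "cell_of t 0 = (0, 0)"
  using two_row_tableaux_step[OF assms(1,2), of 0 0 0] assms(3) tableaux_0[OF assms(1)]
  by (auto simp: two_row_0_0)

text \<open>
  A two-row diagram has at most one addable cell in each row, and these two cells have
  different contents.
\<close>

lemma two_row_contents_inj:
  assumes s: "s \<in> tableaux (two_row a b)" "b \<le> a" and t: "t \<in> tableaux (two_row c d)" "d \<le> c"
    and "a + b = c + d"
    and contents: "\<And>i. i < a + b \<Longrightarrow> cell_content (cell_of s i) = cell_content (cell_of t i)"
  shows "s = t"
proof (rule nth_equalityI)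
  show "length s = length t"
    using tableaux_length[OF s(1)] tableaux_length[OF t(1)] assms(5) by simp
  have "s ! i = t ! i" if "i \<le> a + b" for i
    using that
  proof (induction i)
    case 0
    then show ?case
      using tableaux_0[OF s(1)] tableaux_0[OF t(1)] by simp
  next
    case (Suc i)
    obtain a' b' where i: "s ! i = two_row a' b'" "b' \<le> a'"
      by (rule two_row_tableaux_nth[OF s, of i]) (use Suc.prems in auto)
    with Suc have ti: "t ! i = two_row a' b'" by simp
    have "cell_content (cell_of s i) = cell_content (cell_of t i)"
      using contents Suc.prems by simp
    then show ?case
      using two_row_tableaux_step[OF s Suc.prems i(1)]
        two_row_tableaux_step[OF t Suc.prems[unfolded assms(5)] ti] i(2)
      by (auto simp: cell_content_def)
  qed
  then show "s ! i = t ! i" if "i < length s" for i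
    using that tableaux_length[OF s(1)] by simp
qed

section \<open>Restriction of Young's orthogonal form to a smaller symmetric group\<close>

lemma basis_in_vecs: "x \<in> A \<Longrightarrow> basis x \<in> vecs A"
  by (auto simp: vecs_def basis_def)

lemma zero_in_vecs: "(\<lambda>_. 0) \<in> vecs A"
  by (auto simp: vecs_def)

lemma vecs_lincomb: "v \<in> vecs A \<Longrightarrow> w \<in> vecs A \<Longrightarrow> (\<lambda>t. a * v t + b * w t) \<in> vecs A"
  by (auto simp: vecs_def)

lemma vecs_diff: "v \<in> vecs A \<Longrightarrow> w \<in> vecs A \<Longrightarrow> (\<lambda>t. v t - w t) \<in> vecs A"
  and vecs_scale: "v \<in> vecs A \<Longrightarrow> (\<lambda>t. a * v t) \<in> vecs A"
  by (auto simp: vecs_def)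

lemma vecs_sum: "(\<And>i. i \<in> I \<Longrightarrow> f i \<in> vecs A) \<Longrightarrow> (\<lambda>t. \<Sum>i\<in>I. c i * f i t) \<in> vecs A"
  by (auto simp: vecs_def)

lemma vecs_expand:
  assumes "finite A" "v \<in> vecs A"
  shows "v = (\<lambda>x. \<Sum>t\<in>A. v t * basis t x)"
proof
  fix x
  show "v x = (\<Sum>t\<in>A. v t * basis t x)"
    using assms by (cases "x \<in> A") (auto simp: basis_def vecs_def if_distrib cong: if_cong)
qed

lemma vecs_linear_expand:
  fixes f :: "('a \<Rightarrow> complex) \<Rightarrow> 'b \<Rightarrow> complex"
  assumes A: "finite A"
    and lin: "\<And>v w a b. v \<in> vecs A \<Longrightarrow> w \<in> vecs A \<Longrightarrow>
      f (\<lambda>t. a * v t + b * w t) = (\<lambda>x. a * f v x + b * f w x)"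
    and v: "v \<in> vecs A"
  shows "f v = (\<lambda>x. \<Sum>t\<in>A. v t * f (basis t) x)"
proof -
  have "f (\<lambda>x. \<Sum>t\<in>B. v t * basis t x) = (\<lambda>x. \<Sum>t\<in>B. v t * f (basis t) x)" if "B \<subseteq> A" for B
    using finite_subset[OF that A] that
  proof (induction B rule: finite_induct)
    case empty
    show ?case using lin[OF zero_in_vecs zero_in_vecs, of 0 0] by simp
  next
    case (insert t B)
    then show ?case
      using lin[of "basis t" "\<lambda>x. \<Sum>t\<in>B. v t * basis t x" "v t" 1]
        vecs_sum[of B basis A v] by (auto simp: basis_in_vecs subset_iff)
  qed
  from this[of A] show ?thesis
    using vecs_expand[OF A v] by simp
qed

text \<open>
  The linear extension of \<open>y \<mapsto> followed_by y u\<close> from lists \<open>y\<close> with \<open>Suc N\<close> entries. It makes sense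
  for all such lists and not only for tableaux, so it also applies to the second term of Young's
  formula when the swap does not give a tableau.
\<close>

definition extend_vec :: "nat \<Rightarrow> path \<Rightarrow> (path \<Rightarrow> complex) \<Rightarrow> (path \<Rightarrow> complex)" where
  "extend_vec N u v = (\<lambda>x. if drop N x = u then v (take (Suc N) x) else 0)"

lemma followed_by_iff:
  assumes "length y = Suc N" "u \<noteq> []" "last y = hd u"
  shows "x = followed_by y u \<longleftrightarrow> drop N x = u \<and> take (Suc N) x = y"
proof
  assume x: "x = followed_by y u"
  have "drop N y = [last y]"
    using assms(1) by (metis append_butlast_last_id append_eq_conv_conj length_butlast diff_Suc_1 list.size(3) nat.distinct(1))
  then show "drop N x = u \<and> take (Suc N) x = y"
    using assms by (simp add: x followed_by_def)
next
  assume "drop N x = u \<and> take (Suc N) x = y"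
  then show "x = followed_by y u"
    unfolding followed_by_def by (metis append_take_drop_id drop_Suc tl_drop)
qed

lemma extend_vec_basis:
  "length y = Suc N \<Longrightarrow> u \<noteq> [] \<Longrightarrow> last y = hd u \<Longrightarrow>
    extend_vec N u (basis y) = basis (followed_by y u)"
  using followed_by_iff[of y N u] by (auto simp: extend_vec_def basis_def fun_eq_iff)

lemma extend_vec_lincomb:
  "extend_vec N u (\<lambda>t. a * v t + b * w t) = (\<lambda>x. a * extend_vec N u v x + b * extend_vec N u w x)"
  by (auto simp: extend_vec_def)

lemma extend_vec_sum:
  "extend_vec N u (\<lambda>t. \<Sum>i\<in>I. c i * f i t) = (\<lambda>x. \<Sum>i\<in>I. c i * extend_vec N u (f i) x)"
  by (auto simp: extend_vec_def)

lemma extend_vec_in_vecs: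
  assumes "v \<in> vecs (tableaux \<kappa>)" "u \<in> paths \<kappa> \<mu>"
  shows "extend_vec (card \<kappa>) u v \<in> vecs (tableaux \<mu>)"
  unfolding vecs_def
proof (intro CollectI allI impI)
  fix x assume x: "x \<notin> tableaux \<mu>"
  show "extend_vec (card \<kappa>) u v x = 0"
  proof (rule ccontr)
    assume "extend_vec (card \<kappa>) u v x \<noteq> 0"
    then have d: "drop (card \<kappa>) x = u" and "v (take (Suc (card \<kappa>)) x) \<noteq> 0"
      by (auto simp: extend_vec_def split: if_splits)
    then have t: "take (Suc (card \<kappa>)) x \<in> tableaux \<kappa>"
      using assms(1) by (auto simp: vecs_def)
    have "u \<noteq> []" using assms(2) by (simp add: paths_def)
    then have "card \<kappa> < length x" using d by auto
    then have "followed_by (take (Suc (card \<kappa>)) x) u = x"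
      using followed_by_take_drop[of "card \<kappa>" x] d by simp
    then have "x \<in> tableaux \<mu>"
      using followed_by_paths[OF _ assms(2)] t by (metis tableaux_def)
    with x show False by simp
  qed
qed

lemma extend_vec_inj:
  assumes "v \<in> vecs (tableaux \<kappa>)" "w \<in> vecs (tableaux \<kappa>)" "u \<in> paths \<kappa> \<mu>"
    and eq: "extend_vec (card \<kappa>) u v = extend_vec (card \<kappa>) u w"
  shows "v = w"
proof
  fix y
  show "v y = w y"
  proof (cases "y \<in> tableaux \<kappa>")
    case True
    then have "length y = Suc (card \<kappa>)" "u \<noteq> []" "last y = hd u"
      using tableaux_length[OF True] True assms(3) by (auto simp: tableaux_def paths_def)
    from followed_by_iff[OF this, of "followed_by y u"] show ?thesis
      using fun_cong[OF eq, of "followed_by y u"] by (simp add: extend_vec_def)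
  qed (use assms in \<open>auto simp: vecs_def\<close>)
qed

context
  fixes \<kappa> :: diagram and \<pi> :: "nat perm \<Rightarrow> (path \<Rightarrow> complex) \<Rightarrow> (path \<Rightarrow> complex)"
  assumes \<pi>: "young_orthogonal_rep \<kappa> \<pi>"
begin

lemma young_rep_in_vecs:
  "\<sigma> \<in> sym_group (card \<kappa>) \<Longrightarrow> v \<in> vecs (tableaux \<kappa>) \<Longrightarrow> \<pi> \<sigma> v \<in> vecs (tableaux \<kappa>)"
  using \<pi> unfolding young_orthogonal_rep_def by blast

lemma young_rep_lincomb:
  "\<sigma> \<in> sym_group (card \<kappa>) \<Longrightarrow> v \<in> vecs (tableaux \<kappa>) \<Longrightarrow> w \<in> vecs (tableaux \<kappa>) \<Longrightarrow>
    \<pi> \<sigma> (\<lambda>t. a * v t + b * w t) = (\<lambda>t. a * \<pi> \<sigma> v t + b * \<pi> \<sigma> w t)"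
  using \<pi> unfolding young_orthogonal_rep_def by blast

lemma young_rep_one: "v \<in> vecs (tableaux \<kappa>) \<Longrightarrow> \<pi> 1 v = v"
  using \<pi> unfolding young_orthogonal_rep_def by blast

lemma young_rep_times:
  "\<sigma> \<in> sym_group (card \<kappa>) \<Longrightarrow> \<tau> \<in> sym_group (card \<kappa>) \<Longrightarrow> v \<in> vecs (tableaux \<kappa>) \<Longrightarrow>
    \<pi> (\<sigma> * \<tau>) v = \<pi> \<sigma> (\<pi> \<tau> v)"
  using \<pi> unfolding young_orthogonal_rep_def by blast

lemma young_rep_swap:
  "Suc i < card \<kappa> \<Longrightarrow> t \<in> tableaux \<kappa> \<Longrightarrow> r = real_of_int (axial_distance t i) \<Longrightarrow>
    \<pi> (Perm.swap i (Suc i)) (basis t) =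
      (\<lambda>s. of_real (1 / r) * basis t s + of_real (sqrt (1 - 1 / r\<^sup>2)) * basis (swap_entries i t) s)"
  using \<pi> unfolding young_orthogonal_rep_def Let_def by blast

lemma ga_act_vec_in_vecs:
  "a \<in> sym_algebra (card \<kappa>) \<Longrightarrow> v \<in> vecs (tableaux \<kappa>) \<Longrightarrow> ga_act_vec \<pi> a v \<in> vecs (tableaux \<kappa>)"
  unfolding ga_act_vec_def by (intro vecs_sum young_rep_in_vecs) (auto simp: sym_algebra_def)

end

text \<open>
  The generators of the smaller group only change entries inside the initial segment,
  so they do not see the rest of the tableau.
\<close>

lemma restriction_swap:
  assumes \<pi>: "young_orthogonal_rep \<kappa> \<pi>" and \<rho>: "young_orthogonal_rep \<mu> \<rho>"
    and "finite \<kappa>" and u: "u \<in> paths \<kappa> \<mu>" and "card \<kappa> \<le> card \<mu>"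
    and i: "Suc i < card \<kappa>" and v: "v \<in> vecs (tableaux \<kappa>)"
  shows "\<rho> (Perm.swap i (Suc i)) (extend_vec (card \<kappa>) u v) =
    extend_vec (card \<kappa>) u (\<pi> (Perm.swap i (Suc i)) v)" (is "\<rho> ?s _ = _")
proof -
  let ?N = "card \<kappa>"
  have s: "?s \<in> sym_group (card \<kappa>)" "?s \<in> sym_group (card \<mu>)"
    using i assms(5) by (auto intro!: swap_in_sym_group)
  have u': "u \<noteq> []" "hd u = \<kappa>"
    using u by (auto simp: paths_def)
  have on_basis: "\<rho> ?s (extend_vec ?N u (basis t)) = extend_vec ?N u (\<pi> ?s (basis t))"
    if t: "t \<in> tableaux \<kappa>" for t
  proof -
    have len: "length t = Suc ?N" "last t = \<kappa>"
      using tableaux_length[OF t] t by (auto simp: tableaux_def paths_def)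
    have tu: "followed_by t u \<in> tableaux \<mu>"
      using t followed_by_paths[OF _ u] by (simp add: tableaux_def)
    have nth: "followed_by t u ! n = t ! n" if "n \<le> ?N" for n
      using that len by (simp add: followed_by_def nth_append)
    have ax: "axial_distance (followed_by t u) i = axial_distance t i"
      using i nth by (simp add: axial_distance_def cell_of_def)
    have sw: "swap_entries i (followed_by t u) = followed_by (swap_entries i t) u"
      unfolding swap_entries_def using i nth len
      by (simp add: cell_of_def) (simp add: followed_by_def list_update_append)
    have last: "length (swap_entries i t) = Suc ?N" "last (swap_entries i t) = \<kappa>"
      using len i last_list_update[of t "Suc i"] by (cases t; simp add: swap_entries_def)+
    have i': "Suc i < card \<mu>" using i assms(5) by simp
    have "extend_vec ?N u (basis t) = basis (followed_by t u)"
      "extend_vec ?N u (basis (swap_entries i t)) = basis (followed_by (swap_entries i t) u)"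
      using u' len last by (simp_all add: extend_vec_basis)
    then show ?thesis
      unfolding young_rep_swap[OF \<pi> i t refl] extend_vec_lincomb
      by (simp only: young_rep_swap[OF \<rho> i' tu refl] ax sw)
  qed
  have "\<rho> ?s (extend_vec ?N u v) = (\<lambda>x. \<Sum>t\<in>tableaux \<kappa>. v t * \<rho> ?s (extend_vec ?N u (basis t)) x)"
    by (rule vecs_linear_expand[OF finite_tableaux[OF assms(3)] _ v])
      (simp add: extend_vec_lincomb young_rep_lincomb[OF \<rho> s(2)] extend_vec_in_vecs[OF _ u])
  also have "\<dots> = (\<lambda>x. \<Sum>t\<in>tableaux \<kappa>. v t * extend_vec ?N u (\<pi> ?s (basis t)) x)"
    by (simp add: on_basis)
  also have "\<dots> = extend_vec ?N u (\<pi> ?s v)"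
    by (rule vecs_linear_expand[OF finite_tableaux[OF assms(3)] _ v, symmetric])
      (simp add: extend_vec_lincomb young_rep_lincomb[OF \<pi> s(1)])
  finally show ?thesis .
qed

text \<open>
  The tableaux with a fixed tail \<open>u\<close> span a copy of the representation of the smaller group. It is
  enough to compare the two sides on generators.
\<close>

lemma restriction:
  assumes \<pi>: "young_orthogonal_rep \<kappa> \<pi>" and \<rho>: "young_orthogonal_rep \<mu> \<rho>"
    and fin: "finite \<kappa>" and u: "u \<in> paths \<kappa> \<mu>" and le: "card \<kappa> \<le> card \<mu>"
    and \<sigma>: "\<sigma> \<in> sym_group (card \<kappa>)" and v: "v \<in> vecs (tableaux \<kappa>)"
  shows "\<rho> \<sigma> (extend_vec (card \<kappa>) u v) = extend_vec (card \<kappa>) u (\<pi> \<sigma> v)"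
  using \<sigma>
proof (induction rule: sym_group_induct)
  case one
  show ?case
    by (simp add: young_rep_one[OF \<pi> v] young_rep_one[OF \<rho> extend_vec_in_vecs[OF v u]])
next
  case (swap i \<tau>)
  let ?s = "Perm.swap i (Suc i)"
  have \<tau>: "\<tau> \<in> sym_group (card \<mu>)"
    using swap(2) sym_group_mono[OF le] by blast
  have s: "?s \<in> sym_group (card \<kappa>)" "?s \<in> sym_group (card \<mu>)"
    using swap(1) le by (auto intro!: swap_in_sym_group)
  have "\<rho> (?s * \<tau>) (extend_vec (card \<kappa>) u v) = \<rho> ?s (extend_vec (card \<kappa>) u (\<pi> \<tau> v))"
    by (simp add: young_rep_times[OF \<rho> s(2) \<tau> extend_vec_in_vecs[OF v u]] swap(3))
  also have "\<dots> = extend_vec (card \<kappa>) u (\<pi> ?s (\<pi> \<tau> v))"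
    by (rule restriction_swap[OF \<pi> \<rho> fin u le swap(1) young_rep_in_vecs[OF \<pi> swap(2) v]])
  finally show ?case
    by (simp add: young_rep_times[OF \<pi> s(1) swap(2) v])
qed

lemma restriction_ga:
  assumes \<pi>: "young_orthogonal_rep \<kappa> \<pi>" and \<rho>: "young_orthogonal_rep \<mu> \<rho>"
    and fin: "finite \<kappa>" and u: "u \<in> paths \<kappa> \<mu>" and le: "card \<kappa> \<le> card \<mu>"
    and a: "a \<in> sym_algebra (card \<kappa>)" and v: "v \<in> vecs (tableaux \<kappa>)"
  shows "ga_act_vec \<rho> a (extend_vec (card \<kappa>) u v) = extend_vec (card \<kappa>) u (ga_act_vec \<pi> a v)"
  unfolding ga_act_vec_def extend_vec_sum
  using a restriction[OF \<pi> \<rho> fin u le _ v] by (intro ext sum.cong) (auto simp: sym_algebra_def)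

section \<open>Interpolation in algebras of functions\<close>

text \<open>
  Lagrange interpolation: a product of normalized separating functions is 1 at one point of \<open>S\<close> and
  0 at the others.
\<close>

lemma separating_algebra_interpolates:
  fixes F :: "('a \<Rightarrow> complex) set"
  assumes "finite S"
    and const: "\<And>c. (\<lambda>_. c) \<in> F"
    and add: "\<And>f g. f \<in> F \<Longrightarrow> g \<in> F \<Longrightarrow> (\<lambda>x. f x + g x) \<in> F"
    and mult: "\<And>f g. f \<in> F \<Longrightarrow> g \<in> F \<Longrightarrow> (\<lambda>x. f x * g x) \<in> F"
    and sep: "\<And>s t. s \<in> S \<Longrightarrow> t \<in> S \<Longrightarrow> s \<noteq> t \<Longrightarrow> \<exists>g\<in>F. g s \<noteq> g t"
  shows "\<exists>g\<in>F. \<forall>s\<in>S. g s = f s"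
proof -
  have peak: "\<exists>g\<in>F. g s = 1 \<and> (\<forall>t\<in>B. g t = 0)" if "finite B" "B \<subseteq> S - {s}" "s \<in> S" for B s
    using that
  proof (induction B rule: finite_induct)
    case empty
    show ?case using const[of 1] by auto
  next
    case (insert t B)
    then obtain g where g: "g \<in> F" "g s = 1" "\<forall>t\<in>B. g t = 0" by auto
    obtain d where d: "d \<in> F" "d s \<noteq> d t"
      using sep[of s t] insert by auto
    have "(\<lambda>x. g x * (1 / (d s - d t) * (d x + - d t))) \<in> F"
      by (intro mult add const g d)
    then show ?case
      using g d by (intro bexI) auto
  qed
  have "\<exists>g\<in>F. \<forall>s\<in>S. g s = (if s \<in> B then f s else 0)" if "finite B" "B \<subseteq> S" for B
    using that
  proof (induction B rule: finite_induct)
    case empty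
    show ?case using const[of 0] by auto
  next
    case (insert t B)
    then obtain g where g: "g \<in> F" "\<forall>s\<in>S. g s = (if s \<in> B then f s else 0)" by auto
    obtain d where d: "d \<in> F" "d t = 1" "\<forall>s\<in>S - {t}. d s = 0"
      using peak[of "S - {t}" t] insert assms(1) by auto
    have "(\<lambda>x. g x + f t * d x) \<in> F"
      by (intro mult add const g d)
    moreover have "\<forall>s\<in>S. g s + f t * d s = (if s \<in> insert t B then f s else 0)"
      using g d insert by auto
    ultimately show ?case
      by (intro bexI) 
  qed
  from this[OF assms(1) order_refl] show ?thesis by auto
qed

section \<open>Tableaux at the levels of the inductive limit\<close>

lemma t21_neq_t12: "t21 k j \<noteq> t12 k j"
  by (simp add: t21_def t12_def)

locale two_row_walk =
  fixes k :: nat and p q :: "nat \<Rightarrow> real"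
  assumes k: "1 \<le> k" and unit: "(p j)\<^sup>2 + (q j)\<^sup>2 = 1"
begin

abbreviation Tab :: "nat \<Rightarrow> path set" where
  "Tab j \<equiv> tableaux (two_row (k + j) j)"

lemma finite_Tab: "finite (Tab j)"
  by (simp add: finite_tableaux)

lemma Tab_length: "t \<in> Tab j \<Longrightarrow> length t = Suc (k + 2 * j)"
  using tableaux_length[of t] by simp

text \<open>
  The coefficient of \<open>s\<close> in the image of its parent under the embedding of level \<open>j\<close> into the
  next level. It is 0 if \<open>s\<close> does not pass through the diagram of level \<open>j\<close>.
\<close>

definition coef :: "nat \<Rightarrow> path \<Rightarrow> real" where
  "coef j s = (if drop (k + 2 * j) s = t21 k j then p j
     else if drop (k + 2 * j) s = t12 k j then q j else 0)"

definition parent :: "nat \<Rightarrow> path \<Rightarrow> path" where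
  "parent j s = take (Suc (k + 2 * j)) s"

text \<open>
  The embedding in coordinates, see \<open>iota_lift\<close>.
\<close>

definition lift :: "nat \<Rightarrow> (path \<Rightarrow> complex) \<Rightarrow> path \<Rightarrow> complex" where
  "lift j v s = of_real (coef j s) * v (parent j s)"

lemma lift_extend_vec:
  "lift j v = (\<lambda>s. of_real (p j) * extend_vec (k + 2 * j) (t21 k j) v s
     + of_real (q j) * extend_vec (k + 2 * j) (t12 k j) v s)"
  by (auto simp: lift_def coef_def parent_def extend_vec_def t21_neq_t12 t21_neq_t12[symmetric])

lemma t21_paths: "t21 k j \<in> paths (two_row (k + j) j) (two_row (k + Suc j) (Suc j))"
  and t12_paths: "t12 k j \<in> paths (two_row (k + j) j) (two_row (k + Suc j) (Suc j))"
  using t21_path[OF k, of j] t12_path[OF k, of j] by simp_all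

lemma lift_in_vecs: "v \<in> vecs (Tab j) \<Longrightarrow> lift j v \<in> vecs (Tab (Suc j))"
  unfolding lift_extend_vec
  using extend_vec_in_vecs[OF _ t21_paths] extend_vec_in_vecs[OF _ t12_paths]
  by (intro vecs_lincomb) (simp_all add: mult_2 add.assoc)

text \<open>
  Between two consecutive levels there are only two paths: the cell of the first row and the cell of
  the second row can be added in either order.
\<close>

lemma Tab_Suc_parent:
  assumes s: "s \<in> Tab (Suc j)" and nice: "s ! (k + 2 * j) = two_row (k + j) j"
  shows "parent j s \<in> Tab j"
    and "drop (k + 2 * j) s = t21 k j \<or> drop (k + 2 * j) s = t12 k j"
proof -
  show "parent j s \<in> Tab j"
    using tableaux_take[OF s, of "k + 2 * j"] nice by (simp add: parent_def)
  have len: "length s = Suc (Suc (Suc (k + 2 * j)))"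
    using Tab_length[OF s] by simp
  have "drop (k + 2 * j) s = [s ! (k + 2 * j), s ! Suc (k + 2 * j), s ! Suc (Suc (k + 2 * j))]"
    by (simp add: len Cons_nth_drop_Suc[symmetric])
  moreover have "s ! Suc (Suc (k + 2 * j)) = two_row (k + Suc j) (Suc j)"
    using tableaux_last[OF s] by (simp add: mult_2 add.assoc)
  moreover have "s ! Suc (k + 2 * j) = two_row (Suc (k + j)) j \<or> s ! Suc (k + 2 * j) = two_row (k + j) (Suc j)"
    using two_row_tableaux_step[OF s _ _ nice] by auto
  ultimately show "drop (k + 2 * j) s = t21 k j \<or> drop (k + 2 * j) s = t12 k j"
    using nice by (auto simp: t21_def t12_def)
qed

lemma coef_nonzero:
  assumes s: "s \<in> Tab (Suc j)" and c: "coef j s \<noteq> 0"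
  shows "s ! (k + 2 * j) = two_row (k + j) j"
proof -
  have "drop (k + 2 * j) s ! 0 = two_row (k + j) j"
    using c by (auto simp: coef_def t21_def t12_def split: if_splits)
  then show ?thesis
    using Tab_length[OF s] by simp
qed

lemma Tab_Suc_cases:
  assumes "s \<in> Tab (Suc j)"
  obtains "coef j s = 0" | "coef j s \<noteq> 0" "parent j s \<in> Tab j"
  using coef_nonzero[OF assms] Tab_Suc_parent(1)[OF assms] by blast

lemma Tab_contents_inj:
  assumes "s \<in> Tab j" "t \<in> Tab j" "s \<noteq> t"
  obtains i where "i < k + 2 * j" "cell_content (cell_of s i) \<noteq> cell_content (cell_of t i)"
  using two_row_contents_inj[OF assms(1) _ assms(2)] assms(3) by (auto simp: mult_2 add.assoc)

end

section \<open>The inductive limit\<close>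

lemma vinner_basis: "finite A \<Longrightarrow> t \<in> A \<Longrightarrow> vinner A (basis t) v = v t"
proof -
  assume "finite A" "t \<in> A"
  moreover have "vinner A (basis t) v = (\<Sum>x\<in>A. if x = t then v t else 0)"
    unfolding vinner_def by (intro sum.cong) (auto simp: basis_def)
  ultimately show ?thesis by simp
qed

locale schur_weyl = two_row_walk k p q
  for k :: nat and p q :: "nat \<Rightarrow> real" +
  fixes \<pi> :: "diagram \<Rightarrow> nat perm \<Rightarrow> (path \<Rightarrow> complex) \<Rightarrow> (path \<Rightarrow> complex)"
    and U :: "nat perm \<Rightarrow> 'h::chilbert_space \<Rightarrow> 'h"
    and \<iota> :: "nat \<Rightarrow> (path \<Rightarrow> complex) \<Rightarrow> 'h"
  assumes young: "young_diagram \<kappa> \<Longrightarrow> young_orthogonal_rep \<kappa> (\<pi> \<kappa>)"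
    and U: "unitary_rep U"
    and iota_lincomb: "v \<in> vecs (Tab j) \<Longrightarrow> w \<in> vecs (Tab j) \<Longrightarrow>
      \<iota> j (\<lambda>t. a * v t + b * w t) = a *\<^sub>C \<iota> j v + b *\<^sub>C \<iota> j w"
    and iota_inner: "v \<in> vecs (Tab j) \<Longrightarrow> w \<in> vecs (Tab j) \<Longrightarrow>
      cinner (\<iota> j v) (\<iota> j w) = vinner (Tab j) v w"
    and iota_equivariant: "\<sigma> \<in> sym_group (k + 2 * j) \<Longrightarrow> v \<in> vecs (Tab j) \<Longrightarrow>
      U \<sigma> (\<iota> j v) = \<iota> j (\<pi> (two_row (k + j) j) \<sigma> v)"
    and iota_embedding: "v \<in> vecs (Tab j) \<Longrightarrow>
      \<iota> (Suc j) (path_embedding (two_row (k + j) j) (two_row (k + j + 1) (j + 1))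
        (\<lambda>u. of_real (p j) * basis (t21 k j) u + of_real (q j) * basis (t12 k j) u) v) = \<iota> j v"
    and iota_dense: "closure (\<Union>j. \<iota> j ` vecs (Tab j)) = UNIV"
begin

definition level_vec :: "nat \<Rightarrow> path \<Rightarrow> 'h" where
  "level_vec j t = \<iota> j (basis t)"

lemma young_level: "young_orthogonal_rep (two_row (k + j) j) (\<pi> (two_row (k + j) j))"
  by (simp add: young young_diagram_two_row)

lemma iota_zero: "\<iota> j (\<lambda>_. 0) = 0"
  using iota_lincomb[OF zero_in_vecs zero_in_vecs, of j 0 0] by simp

lemma iota_scale: "v \<in> vecs (Tab j) \<Longrightarrow> \<iota> j (\<lambda>t. a * v t) = a *\<^sub>C \<iota> j v"
  using iota_lincomb[of v j "\<lambda>_. 0" a 0] by (simp add: zero_in_vecs)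

lemma iota_add: "v \<in> vecs (Tab j) \<Longrightarrow> w \<in> vecs (Tab j) \<Longrightarrow> \<iota> j (\<lambda>t. v t + w t) = \<iota> j v + \<iota> j w"
  using iota_lincomb[of v j w 1 1] by simp

lemma iota_diff: "v \<in> vecs (Tab j) \<Longrightarrow> w \<in> vecs (Tab j) \<Longrightarrow> \<iota> j (\<lambda>t. v t - w t) = \<iota> j v - \<iota> j w"
  using iota_lincomb[of v j w 1 "-1"] by (simp add: scaleC_minus1)

lemma iota_sum:
  "(\<And>i. i \<in> I \<Longrightarrow> f i \<in> vecs (Tab j)) \<Longrightarrow>
    \<iota> j (\<lambda>t. \<Sum>i\<in>I. c i * f i t) = (\<Sum>i\<in>I. c i *\<^sub>C \<iota> j (f i))"
proof (induction I rule: infinite_finite_induct)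
  case (insert i I)
  then show ?case
    using iota_lincomb[of "f i" j "\<lambda>t. \<Sum>i\<in>I. c i * f i t" "c i" 1] vecs_sum[of I f "Tab j" c] by simp
qed (simp_all add: iota_zero)

lemma iota_expand: "v \<in> vecs (Tab j) \<Longrightarrow> \<iota> j v = (\<Sum>t\<in>Tab j. v t *\<^sub>C level_vec j t)"
  using iota_sum[of "Tab j" basis j v] vecs_expand[OF finite_Tab, of v j]
  by (simp add: basis_in_vecs level_vec_def)

lemma cinner_level_vec_iota: "t \<in> Tab j \<Longrightarrow> v \<in> vecs (Tab j) \<Longrightarrow> cinner (level_vec j t) (\<iota> j v) = v t"
  by (simp add: level_vec_def iota_inner basis_in_vecs vinner_basis finite_Tab)

lemma cinner_level_vec: "s \<in> Tab j \<Longrightarrow> t \<in> Tab j \<Longrightarrow> cinner (level_vec j s) (level_vec j t) = (if s = t then 1 else 0)"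
  unfolding level_vec_def[of j t] by (simp add: cinner_level_vec_iota basis_in_vecs) (simp add: basis_def)

lemma norm_iota_sq: "v \<in> vecs (Tab j) \<Longrightarrow> (norm (\<iota> j v))\<^sup>2 = (\<Sum>t\<in>Tab j. (cmod (v t))\<^sup>2)"
  by (simp only: norm_sq_eq_cinner iota_inner vinner_def Re_sum) (simp add: cmod_power2 flip: power2_eq_square)

lemma iota_inj: "v \<in> vecs (Tab j) \<Longrightarrow> w \<in> vecs (Tab j) \<Longrightarrow> \<iota> j v = \<iota> j w \<Longrightarrow> v = w"
proof
  fix x assume *: "v \<in> vecs (Tab j)" "w \<in> vecs (Tab j)" "\<iota> j v = \<iota> j w"
  show "v x = w x"
  proof (cases "x \<in> Tab j")
    case True
    then show ?thesis
      using cinner_level_vec_iota[OF True *(1)] cinner_level_vec_iota[OF True *(2)] *(3) by simp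
  qed (use * in \<open>auto simp: vecs_def\<close>)
qed

lemma iota_lift:
  assumes v: "v \<in> vecs (Tab j)"
  shows "\<iota> (Suc j) (lift j v) = \<iota> j v"
proof -
  let ?P = "paths (two_row (k + j) j) (two_row (k + j + 1) (j + 1))"
  let ?h = "\<lambda>u. complex_of_real (p j) * basis (t21 k j) u + of_real (q j) * basis (t12 k j) u"
  have fin: "finite ?P"
    by (intro finite_paths finite_two_row)
  have sum: "(\<Sum>u\<in>?P. ?h u * g u) = p j * g (t21 k j) + q j * g (t12 k j)" for g :: "path \<Rightarrow> complex"
  proof -
    have delta: "(\<Sum>u\<in>?P. c * basis x u * g u) = c * g x" if "x \<in> ?P" for c x
    proof -
      have "(\<Sum>u\<in>?P. c * basis x u * g u) = (\<Sum>u\<in>?P. if u = x then c * g x else 0)"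
        by (intro sum.cong) (auto simp: basis_def)
      then show ?thesis using fin that by simp
    qed
    show ?thesis
      by (simp only: distrib_right sum.distrib delta[OF t21_path[OF k]] delta[OF t12_path[OF k]])
  qed
  have lin: "extend_vec (k + 2 * j) u v = (\<lambda>s. \<Sum>t\<in>Tab j. v t * basis (followed_by t u) s)"
    if "u \<in> ?P" for u
  proof -
    have "extend_vec (k + 2 * j) u (basis t) = basis (followed_by t u)" if "t \<in> Tab j" for t
      using \<open>u \<in> ?P\<close> that Tab_length[OF that]
      by (intro extend_vec_basis) (auto simp: paths_def tableaux_def)
    then show ?thesis
      using vecs_linear_expand[OF finite_Tab _ v, where f = "extend_vec (k + 2 * j) u"]
      by (simp add: extend_vec_lincomb)
  qed
  have "path_embedding (two_row (k + j) j) (two_row (k + j + 1) (j + 1)) ?h v = lift j v"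
    unfolding path_embedding_def lift_extend_vec lin[OF t21_path[OF k]] lin[OF t12_path[OF k]]
  proof
    fix s
    have "(\<Sum>t\<in>Tab j. \<Sum>u\<in>?P. v t * ?h u * basis (followed_by t u) s) =
        (\<Sum>t\<in>Tab j. v t * (\<Sum>u\<in>?P. ?h u * basis (followed_by t u) s))"
      by (simp only: sum_distrib_left mult.assoc)
    also have "\<dots> = p j * (\<Sum>t\<in>Tab j. v t * basis (followed_by t (t21 k j)) s)
        + q j * (\<Sum>t\<in>Tab j. v t * basis (followed_by t (t12 k j)) s)"
      by (simp only: sum sum_distrib_left distrib_left sum.distrib mult.left_commute)
    finally show "(\<Sum>t\<in>Tab j. \<Sum>u\<in>?P. v t * ?h u * basis (followed_by t u) s) = \<dots>" .
  qed
  with iota_embedding[OF v] show ?thesis by simp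
qed

lemma ga_act_diagonal:
  assumes a: "\<And>u. u \<in> Tab m \<Longrightarrow> ga_act U a (level_vec m u) = f u *\<^sub>C level_vec m u" and z: "z \<in> vecs (Tab m)"
  shows "ga_act U a (\<iota> m z) = \<iota> m (\<lambda>s. f s * z s)"
proof -
  have "(\<lambda>s. f s * z s) \<in> vecs (Tab m)"
    using z by (auto simp: vecs_def)
  then show ?thesis
    by (simp add: iota_expand z ga_act_sum_right[OF U] ga_act_scaleC_right[OF U] a scaleC_scaleC mult.commute)
qed

lemma lift_iterate:
  assumes "v \<in> vecs (Tab i)" "i \<le> j"
  obtains w where "w \<in> vecs (Tab j)" "\<iota> j w = \<iota> i v"
  using assms(2)
proof (induction j arbitrary: thesis rule: dec_induct)
  case base
  with assms show ?case by blast
next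
  case (step j)
  then show ?case
    using lift_in_vecs iota_lift by metis
qed

section \<open>The Gelfand-Tsetlin algebra acts diagonally\<close>

lemma iota_ga_act:
  assumes "a \<in> sym_algebra (k + 2 * j)" "v \<in> vecs (Tab j)"
  shows "ga_act U a (\<iota> j v) = \<iota> j (ga_act_vec (\<pi> (two_row (k + j) j)) a v)"
proof -
  have \<sigma>: "\<sigma> \<in> sym_group (k + 2 * j)" if "\<sigma> \<in> Poly_Mapping.keys a" for \<sigma>
    using assms(1) that by (auto simp: sym_algebra_def)
  then have "\<pi> (two_row (k + j) j) \<sigma> v \<in> vecs (Tab j)" if "\<sigma> \<in> Poly_Mapping.keys a" for \<sigma>
    using young_rep_in_vecs[OF young_level _ assms(2)] that by (simp add: mult_2 add.assoc)
  from iota_sum[OF this, of "Poly_Mapping.keys a" "\<lambda>\<sigma>. \<sigma>"] show ?thesis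
    unfolding ga_act_def ga_act_vec_def using \<sigma> by (simp add: iota_equivariant assms(2))
qed

lemma ga_act_vec_in_Tab:
  "a \<in> sym_algebra (k + 2 * j) \<Longrightarrow> v \<in> vecs (Tab j) \<Longrightarrow>
    ga_act_vec (\<pi> (two_row (k + j) j)) a v \<in> vecs (Tab j)"
  using ga_act_vec_in_vecs[OF young_level, of a j v] by (simp add: mult_2 add.assoc)

text \<open>
  Young's formula in the Hilbert space. When the swapped list is not a tableau, its coefficient
  vanishes and it disappears from the formula.
\<close>

lemma swap_level_vec:
  assumes t: "t \<in> Tab j" and i: "Suc i < k + 2 * j" and r: "r = real_of_int (axial_distance t i)"
  obtains "\<bar>r\<bar> = 1" "U (Perm.swap i (Suc i)) (level_vec j t) = of_real (1 / r) *\<^sub>C level_vec j t"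
  | t' \<beta> where "t' \<in> Tab j" "cell_of t' i = cell_of t (Suc i)" "r \<noteq> 0"
      "U (Perm.swap i (Suc i)) (level_vec j t) = of_real (1 / r) *\<^sub>C level_vec j t + \<beta> *\<^sub>C level_vec j t'"
proof -
  let ?s = "Perm.swap i (Suc i)" and ?t' = "swap_entries i t"
  let ?\<beta> = "complex_of_real (sqrt (1 - 1 / r\<^sup>2))"
  have "U ?s (level_vec j t) = \<iota> j (\<pi> (two_row (k + j) j) ?s (basis t))"
    unfolding level_vec_def by (rule iota_equivariant) (use i t in \<open>auto intro!: swap_in_sym_group basis_in_vecs\<close>)
  also have "\<pi> (two_row (k + j) j) ?s (basis t) = (\<lambda>s. of_real (1 / r) * basis t s + ?\<beta> * basis ?t' s)"
    by (rule young_rep_swap[OF young_level _ t r]) (use i in simp)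
  finally have U: "U ?s (level_vec j t) = \<iota> j (\<lambda>s. of_real (1 / r) * basis t s + ?\<beta> * basis ?t' s)" .
  from two_row_swap_cases[OF t, of i] i
  consider "\<bar>axial_distance t i\<bar> = 1" | "r \<noteq> 0" "?t' \<in> Tab j" "cell_of ?t' i = cell_of t (Suc i)"
    by (auto simp: r)
  then show thesis
  proof cases
    case 1
    then have r1: "\<bar>r\<bar> = 1" by (simp add: r flip: of_int_abs)
    then have "r\<^sup>2 = 1" by (simp add: abs_square_eq_1)
    then have 0: "?\<beta> = 0" by simp
    have "U ?s (level_vec j t) = of_real (1 / r) *\<^sub>C level_vec j t"
      unfolding U 0 by (simp only: level_vec_def mult_zero_left add_0_right iota_scale[OF basis_in_vecs[OF t]])
    with r1 that show ?thesis by blast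
  next
    case 2
    then have "U ?s (level_vec j t) = of_real (1 / r) *\<^sub>C level_vec j t + ?\<beta> *\<^sub>C level_vec j ?t'"
      unfolding U unfolding level_vec_def using t by (intro iota_lincomb basis_in_vecs)
    with 2 that show ?thesis by blast
  qed
qed

lemma ga_act_jucys_murphy: "ga_act U (jucys_murphy i) x = (\<Sum>l<i. U (Perm.swap l i) x)"
  by (simp add: jucys_murphy_eq ga_act_sum)

text \<open>
  The recursion for the Jucys-Murphy elements: conjugating the \<open>i\<close>-th one by the transposition
  of \<open>i\<close> and \<open>Suc i\<close> gives all but one of the summands of the next one.
\<close>

lemma ga_act_jucys_murphy_Suc:
  "ga_act U (jucys_murphy (Suc i)) x =
    U (Perm.swap i (Suc i)) (ga_act U (jucys_murphy i) (U (Perm.swap i (Suc i)) x)) + U (Perm.swap i (Suc i)) x"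
proof -
  let ?s = "Perm.swap i (Suc i)"
  have "Perm.swap l (Suc i) = ?s * (Perm.swap l i * ?s)" if "l < i" for l
    using conj_swap[of ?s l i] that by (simp add: mult.assoc)
  then have "U (Perm.swap l (Suc i)) x = U ?s (U (Perm.swap l i) (U ?s x))" if "l < i" for l
    using that by (simp add: unitary_rep_times[OF U])
  then show ?thesis
    by (simp add: ga_act_jucys_murphy unitary_rep_sum[OF U])
qed

text \<open>
  With \<open>s\<close> the transposition, \<open>c\<close> and \<open>d\<close> the contents of the two entries and \<open>J\<close> the
  Jucys-Murphy element, Young's formula gives \<open>J (s e) = d (s e) - e\<close>, whence
  \<open>s J s e + s e = d e\<close>.
\<close>

lemma jucys_murphy_level_vec:
  assumes "i < k + 2 * j" "t \<in> Tab j"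
  shows "ga_act U (jucys_murphy i) (level_vec j t) = of_int (cell_content (cell_of t i)) *\<^sub>C level_vec j t"
  using assms
proof (induction i arbitrary: t)
  case 0
  then show ?case
    using two_row_cell_of_0[of t "k + j" j] k by (simp add: ga_act_jucys_murphy cell_content_def)
next
  case (Suc i)
  let ?s = "Perm.swap i (Suc i)" and ?J = "ga_act U (jucys_murphy i)"
  define c where "c = (of_int (cell_content (cell_of t i)) :: complex)"
  define d where "d = (of_int (cell_content (cell_of t (Suc i))) :: complex)"
  define r where "r = real_of_int (axial_distance t i)"
  have r: "of_real r = d - c"
    by (simp add: r_def c_def d_def axial_distance_def)
  have J: "?J (level_vec j t) = c *\<^sub>C level_vec j t"
    using Suc by (simp add: c_def)
  \<comment> \<open>in the first case \<open>r\<close> is 1 or -1; in both cases \<open>c / r = d / r - 1\<close> since \<open>r = d - c\<close>\<close>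
  have key: "?J (U ?s (level_vec j t)) = d *\<^sub>C U ?s (level_vec j t) - level_vec j t"
  proof (rule swap_level_vec[OF Suc.prems(2,1) r_def])
    assume r1: "\<bar>r\<bar> = 1" and s: "U ?s (level_vec j t) = of_real (1 / r) *\<^sub>C level_vec j t"
    have "c / of_real r = d / of_real r - 1"
      using r1 r by (auto simp: field_simps)
    then have "(c / of_real r) *\<^sub>C level_vec j t = (d / of_real r) *\<^sub>C level_vec j t - level_vec j t"
      by (simp add: scaleC_diff_left)
    then show ?thesis
      unfolding s ga_act_scaleC_right[OF U] J scaleC_scaleC by (simp add: mult.commute)
  next
    fix t' \<beta>
    assume t': "t' \<in> Tab j" "cell_of t' i = cell_of t (Suc i)" and r0: "r \<noteq> 0"
      and s: "U ?s (level_vec j t) = of_real (1 / r) *\<^sub>C level_vec j t + \<beta> *\<^sub>C level_vec j t'"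
    have J': "?J (level_vec j t') = d *\<^sub>C level_vec j t'"
      using Suc.IH[of t'] Suc.prems t' by (simp add: d_def)
    have "c / of_real r = d / of_real r - 1"
      using r0 r by (auto simp: field_simps)
    then have "(c / of_real r) *\<^sub>C level_vec j t = (d / of_real r) *\<^sub>C level_vec j t - level_vec j t"
      by (simp add: scaleC_diff_left)
    then show ?thesis
      unfolding s ga_act_scaleC_right[OF U] ga_act_add_right[OF U] J J' scaleC_add_right scaleC_scaleC
      by (simp add: mult.commute)
  qed
  have "U ?s (U ?s (level_vec j t)) = level_vec j t"
    by (simp add: unitary_rep_one[OF U] flip: unitary_rep_times[OF U])
  then have "ga_act U (jucys_murphy (Suc i)) (level_vec j t) = d *\<^sub>C level_vec j t"
    unfolding ga_act_jucys_murphy_Suc key unitary_rep_diff[OF U] unitary_rep_scaleC[OF U] by simp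
  then show ?case by (simp add: d_def)
qed

text \<open>
  Of two symmetric groups one contains the other, so one of the two elements is central in an
  algebra that contains both.
\<close>

lemma center_commute:
  assumes "a \<in> sym_algebra_center M" "b \<in> sym_algebra_center N"
  shows "ga_act U a (ga_act U b x) = ga_act U b (ga_act U a x)"
proof -
  have "sym_algebra M \<subseteq> sym_algebra N \<or> sym_algebra N \<subseteq> sym_algebra M"
    using sym_group_mono[of M N] sym_group_mono[of N M] by (cases "M \<le> N") (auto simp: sym_algebra_def)
  then have "ga_mult a b = ga_mult b a"
    using assms by (auto simp: sym_algebra_center_def)
  then show ?thesis
    by (simp flip: ga_act_mult[OF U])
qed

lemma gelfand_tsetlin_commute:
  assumes "a \<in> gelfand_tsetlin"
  shows "ga_act U a (ga_act U (jucys_murphy i) x) = ga_act U (jucys_murphy i) (ga_act U a x)"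
  using assms
proof (induction arbitrary: x)
  case (center N a)
  then show ?case
    unfolding jucys_murphy_def ga_act_add ga_act_add_right[OF U]
    by (simp add: center_commute[OF _ transpositions_central])
next
  case (add a b)
  then show ?case
    by (simp add: ga_act_add ga_act_add_right[OF U])
next
  case (mult a b)
  then show ?case
    by (simp add: ga_act_mult[OF U])
qed

text \<open>
  The element preserves the level, and it commutes with the Jucys-Murphy elements, whose joint
  eigenspaces in the level are lines because the contents determine the tableau.
\<close>

lemma gelfand_tsetlin_eigenvector:
  assumes a: "a \<in> gelfand_tsetlin" "a \<in> sym_algebra (k + 2 * j)" and t: "t \<in> Tab j"
  obtains c where "ga_act U a (level_vec j t) = c *\<^sub>C level_vec j t"
proof -
  define w where "w = ga_act_vec (\<pi> (two_row (k + j) j)) a (basis t)"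
  have w: "w \<in> vecs (Tab j)"
    unfolding w_def by (intro ga_act_vec_in_Tab a basis_in_vecs t)
  have y: "ga_act U a (level_vec j t) = \<iota> j w"
    unfolding w_def level_vec_def by (intro iota_ga_act a basis_in_vecs t)
  have "w s = 0" if s: "s \<in> Tab j" "s \<noteq> t" for s
  proof -
    obtain i where i: "i < k + 2 * j" "cell_content (cell_of s i) \<noteq> cell_content (cell_of t i)"
      using Tab_contents_inj[OF s(1) t s(2)] .
    let ?c = "\<lambda>t. (of_int (cell_content (cell_of t i)) :: complex)"
    have "?c t *\<^sub>C \<iota> j w = ga_act U (jucys_murphy i) (\<iota> j w)"
      using gelfand_tsetlin_commute[OF a(1), of i "level_vec j t"]
      by (simp add: jucys_murphy_level_vec[OF i(1) t] ga_act_scaleC_right[OF U] y)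
    also have "\<dots> = \<iota> j (\<lambda>s. \<Sum>u\<in>Tab j. (w u * ?c u) * basis u s)"
      by (simp add: iota_expand[OF w] ga_act_sum_right[OF U] ga_act_scaleC_right[OF U]
          jucys_murphy_level_vec[OF i(1)] scaleC_scaleC iota_sum basis_in_vecs flip: level_vec_def)
    finally have eq: "?c t *\<^sub>C \<iota> j w = \<iota> j (\<lambda>s. \<Sum>u\<in>Tab j. (w u * ?c u) * basis u s)" .
    have "(\<lambda>s. \<Sum>u\<in>Tab j. (w u * ?c u) * basis u s) \<in> vecs (Tab j)"
      by (intro vecs_sum basis_in_vecs)
    from cinner_level_vec_iota[OF s(1) this] cinner_level_vec_iota[OF s(1) w]
    have "?c t * w s = (\<Sum>u\<in>Tab j. (w u * ?c u) * basis u s)"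
      unfolding eq[symmetric] cinner_scaleC_right by (simp only:)
    also have "\<dots> = w s * ?c s"
      using s(1) finite_Tab[of j] by (simp add: basis_def if_distrib cong: if_cong)
    finally have "(?c t - ?c s) * w s = 0"
      by (simp only: left_diff_distrib mult.commute[of "w s"] cancel_comm_monoid_add_class.diff_cancel)
    then show ?thesis
      using i(2) by simp
  qed
  then have w_eq: "w = (\<lambda>s. w t * basis t s)"
    using w by (auto simp: vecs_def basis_def fun_eq_iff)
  have "ga_act U a (level_vec j t) = w t *\<^sub>C level_vec j t"
    unfolding y by (subst w_eq) (simp only: level_vec_def iota_scale[OF basis_in_vecs[OF t]])
  with that show thesis .
qed

text \<open>
  Attaching the rest \<open>drop N u\<close> of the tableau is injective and commutes with the action, so an
  element of the group algebra of degree \<open>N\<close> does not see this rest.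
\<close>

lemma eigenvalue_initial_part:
  assumes a: "a \<in> sym_algebra N" and N: "N \<le> k + 2 * m" and u: "u \<in> Tab m"
  shows "ga_act U a (level_vec m u) = c *\<^sub>C level_vec m u \<longleftrightarrow>
    ga_act_vec (\<pi> (u ! N)) a (basis (take (Suc N) u)) = (\<lambda>s. c * basis (take (Suc N) u) s)"
    (is "_ \<longleftrightarrow> ?v = _")
proof -
  let ?\<kappa> = "u ! N" and ?t = "take (Suc N) u" and ?\<mu> = "two_row (k + m) m"
  obtain a' b' where \<kappa>: "?\<kappa> = two_row a' b'" "b' \<le> a'" "a' + b' = N"
    by (rule two_row_tableaux_nth[OF u, of N]) (use N in auto)
  have card: "card ?\<kappa> = N" "finite ?\<kappa>"
    using \<kappa> by simp_all
  have young': "young_orthogonal_rep ?\<kappa> (\<pi> ?\<kappa>)"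
    by (simp add: \<kappa> young young_diagram_two_row)
  have t: "?t \<in> tableaux ?\<kappa>"
    using tableaux_take[OF u, of N] N by simp
  have tail: "drop N u \<in> paths ?\<kappa> ?\<mu>"
    using paths_take_drop(2)[of u "{}" ?\<mu> N] u N Tab_length[OF u] by (simp add: tableaux_def)
  have a': "a \<in> sym_algebra (k + 2 * m)"
    using a sym_group_mono[OF N] by (auto simp: sym_algebra_def)
  have ext: "extend_vec N (drop N u) (basis ?t) = basis u"
    using followed_by_take_drop[of N u] N Tab_length[OF u] tail t
    by (subst extend_vec_basis) (auto simp: paths_def tableaux_def)
  have v: "?v \<in> vecs (tableaux ?\<kappa>)"
    using ga_act_vec_in_vecs[OF young' _ basis_in_vecs[OF t]] a card by simp
  have cv: "(\<lambda>s. c * basis ?t s) \<in> vecs (tableaux ?\<kappa>)"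
    by (intro vecs_scale basis_in_vecs t)
  have ext_c: "extend_vec N (drop N u) (\<lambda>s. c * basis ?t s) = (\<lambda>s. c * basis u s)"
    using extend_vec_lincomb[of N "drop N u" c "basis ?t" 0 "basis ?t"] by (simp add: ext)
  have "ga_act U a (level_vec m u) = \<iota> m (ga_act_vec (\<pi> ?\<mu>) a (basis u))"
    unfolding level_vec_def by (intro iota_ga_act a' basis_in_vecs u)
  also have "ga_act_vec (\<pi> ?\<mu>) a (basis u) = extend_vec N (drop N u) ?v"
    using restriction_ga[OF young' young_level card(2) tail _ _ basis_in_vecs[OF t]] card(1) a N
    by (simp add: ext)
  finally have "ga_act U a (level_vec m u) = \<iota> m (extend_vec N (drop N u) ?v)" .
  moreover have "c *\<^sub>C level_vec m u = \<iota> m (extend_vec N (drop N u) (\<lambda>s. c * basis ?t s))"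
    unfolding level_vec_def ext_c by (simp add: iota_scale basis_in_vecs u)
  moreover have "extend_vec N (drop N u) w \<in> vecs (Tab m)" if "w \<in> vecs (tableaux ?\<kappa>)" for w
    using extend_vec_in_vecs[OF that tail] card by simp
  ultimately show ?thesis
    using iota_inj[of "extend_vec N (drop N u) ?v" m] extend_vec_inj[OF v cv tail] card v cv
    by (metis (no_types, lifting))
qed

lemma eigenvalue_later_level:
  assumes a: "a \<in> sym_algebra (k + 2 * j)" and u: "u \<in> Tab m" and "j \<le> m"
    and s: "take (Suc (k + 2 * j)) u \<in> Tab j"
  shows "ga_act U a (level_vec m u) = c *\<^sub>C level_vec m u \<longleftrightarrow>
    ga_act U a (level_vec j (take (Suc (k + 2 * j)) u)) = c *\<^sub>C level_vec j (take (Suc (k + 2 * j)) u)"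
proof -
  let ?s = "take (Suc (k + 2 * j)) u"
  have "?s ! (k + 2 * j) = u ! (k + 2 * j)" "take (Suc (k + 2 * j)) ?s = ?s"
    using Tab_length[OF s] Tab_length[OF u] by simp_all
  then show ?thesis
    using eigenvalue_initial_part[OF a _ u] eigenvalue_initial_part[OF a _ s] assms(3) by simp
qed

text \<open>
  The contents of the entries separate the tableaux with \<open>N\<close> entries, so polynomials in the
  Jucys-Murphy elements realize every function of the initial segment.
\<close>

lemma gelfand_tsetlin_interpolation:
  fixes f :: "path \<Rightarrow> complex"
  obtains a where "a \<in> gelfand_tsetlin"
    "\<And>m u. N \<le> k + 2 * m \<Longrightarrow> u \<in> Tab m \<Longrightarrow> ga_act U a (level_vec m u) = f (take (Suc N) u) *\<^sub>C level_vec m u"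
proof -
  define S where "S = (\<Union>a\<le>N. \<Union>b\<in>{b. b \<le> a \<and> a + b = N}. tableaux (two_row a b))"
  define F where "F = {g. \<exists>a\<in>gelfand_tsetlin. \<forall>m u. N \<le> k + 2 * m \<longrightarrow> u \<in> Tab m \<longrightarrow>
    ga_act U a (level_vec m u) = g (take (Suc N) u) *\<^sub>C level_vec m u}"
  have "\<exists>g\<in>F. \<forall>s\<in>S. g s = f s"
  proof (rule separating_algebra_interpolates)
    show "finite S"
      unfolding S_def by (intro finite_UN_I finite_tableaux finite_two_row finite_atMost)
        (auto intro: finite_subset[of _ "{..N}"])
    show "(\<lambda>_. c) \<in> F" for c
      unfolding F_def using scalar_in_gelfand_tsetlin[of c]
      by (auto intro!: bexI[of _ "Poly_Mapping.single 1 c"] simp: unitary_rep_one[OF U])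
    fix g h assume "g \<in> F" "h \<in> F"
    then obtain a b where a: "a \<in> gelfand_tsetlin" "b \<in> gelfand_tsetlin"
      and *: "\<And>m u. N \<le> k + 2 * m \<Longrightarrow> u \<in> Tab m \<Longrightarrow> ga_act U a (level_vec m u) = g (take (Suc N) u) *\<^sub>C level_vec m u"
        "\<And>m u. N \<le> k + 2 * m \<Longrightarrow> u \<in> Tab m \<Longrightarrow> ga_act U b (level_vec m u) = h (take (Suc N) u) *\<^sub>C level_vec m u"
      by (auto simp: F_def)
    show "(\<lambda>x. g x + h x) \<in> F"
      unfolding F_def using gelfand_tsetlin.add[OF a] *
      by (auto intro!: bexI[of _ "a + b"] simp: ga_act_add scaleC_add_left)
    show "(\<lambda>x. g x * h x) \<in> F"
      unfolding F_def using gelfand_tsetlin.mult[OF a] *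
      by (auto intro!: bexI[of _ "ga_mult a b"]
          simp: ga_act_mult[OF U] ga_act_scaleC_right[OF U] scaleC_scaleC mult.commute)
  next
    fix s t assume "s \<in> S" "t \<in> S" "s \<noteq> t"
    then obtain i where i: "i < N" "cell_content (cell_of s i) \<noteq> cell_content (cell_of t i)"
    proof -
      obtain a b c d where "b \<le> a" "a + b = N" "s \<in> tableaux (two_row a b)"
        "d \<le> c" "c + d = N" "t \<in> tableaux (two_row c d)"
        using \<open>s \<in> S\<close> \<open>t \<in> S\<close> unfolding S_def by blast
      with \<open>s \<noteq> t\<close> that two_row_contents_inj[of s a b t c d] show thesis by metis
    qed
    have "cell_of (take (Suc N) u) i = cell_of u i" for u
      using i(1) by (simp add: cell_of_def)
    then have "(\<lambda>u. of_int (cell_content (cell_of u i))) \<in> F"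
      unfolding F_def using jucys_murphy_in_gelfand_tsetlin[of i] i(1) jucys_murphy_level_vec[of i]
      by (auto intro!: bexI[of _ "jucys_murphy i"])
    with i(2) show "\<exists>g\<in>F. g s \<noteq> g t"
      by (intro bexI) auto
  qed
  then obtain g a where g: "\<forall>s\<in>S. g s = f s" and a: "a \<in> gelfand_tsetlin"
    "\<And>m u. N \<le> k + 2 * m \<Longrightarrow> u \<in> Tab m \<Longrightarrow> ga_act U a (level_vec m u) = g (take (Suc N) u) *\<^sub>C level_vec m u"
    unfolding F_def by blast
  have "take (Suc N) u \<in> S" if m: "N \<le> k + 2 * m" and u: "u \<in> Tab m" for m u
  proof -
    obtain a' b' where "u ! N = two_row a' b'" "b' \<le> a'" "a' + b' = N"
      by (rule two_row_tableaux_nth[OF u, of N]) (use m in auto)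
    then show ?thesis
      using tableaux_take[OF u, of N] m by (auto simp: S_def)
  qed
  with a g that show thesis by auto
qed

end

section \<open>A cyclic vector\<close>

context schur_weyl
begin

text \<open>
  The coordinates at level \<open>j\<close> of an approximation to a cyclic vector. A vector of level \<open>j\<close> has the
  coordinate 0 at a tableau \<open>s\<close> of the next level with \<open>coef j s = 0\<close>; these coordinates are filled
  with numbers so small that the approximations converge. All other coordinates are multiplied by
  nonzero coefficients, so no coordinate ever vanishes.
\<close>

primrec cyclic_coords :: "nat \<Rightarrow> path \<Rightarrow> complex" where
  "cyclic_coords 0 s = (if s \<in> Tab 0 then 1 else 0)"
| "cyclic_coords (Suc j) s = lift j (cyclic_coords j) s +
    (if s \<in> Tab (Suc j) \<and> coef j s = 0 then of_real ((1 / 2) ^ j / (1 + card (Tab (Suc j)))) else 0)"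

lemma cyclic_coords_in_vecs: "cyclic_coords j \<in> vecs (Tab j)"
proof (induction j)
  case (Suc j)
  then show ?case
    using lift_in_vecs[OF Suc] by (auto simp: vecs_def)
qed (simp add: vecs_def)

lemma cyclic_coords_nonzero: "s \<in> Tab j \<Longrightarrow> cyclic_coords j s \<noteq> 0"
proof (induction j arbitrary: s)
  case (Suc j)
  show ?case
  proof (cases rule: Tab_Suc_cases[OF Suc.prems])
    case 1
    have "complex_of_real ((1 / 2) ^ j / (1 + card (Tab (Suc j)))) \<noteq> 0"
      unfolding of_real_eq_0_iff by (simp add: add_nonneg_eq_0_iff)
    with 1 Suc.prems show ?thesis by (simp add: lift_def)
  next
    case 2
    with Suc.IH show ?thesis by (simp add: lift_def)
  qed
qed simp

definition cyclic_approx :: "nat \<Rightarrow> 'h" where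
  "cyclic_approx j = \<iota> j (cyclic_coords j)"

lemma cyclic_approx_step: "norm (cyclic_approx (Suc j) - cyclic_approx j) \<le> (1 / 2) ^ j"
proof -
  let ?n = "real (card (Tab (Suc j)))"
  \<comment> \<open>there are at most \<open>?n\<close> new coordinates, each of them \<open>\<delta>\<close>\<close>
  define \<delta> where "\<delta> = (1 / 2) ^ j / (1 + ?n)"
  define d :: "path \<Rightarrow> complex" where
    "d = (\<lambda>s. if s \<in> Tab (Suc j) \<and> coef j s = 0 then of_real \<delta> else 0)"
  have d: "d \<in> vecs (Tab (Suc j))"
    by (auto simp: d_def vecs_def)
  have "cyclic_coords (Suc j) = (\<lambda>s. lift j (cyclic_coords j) s + d s)"
    by (simp add: d_def \<delta>_def fun_eq_iff)
  then have "cyclic_approx (Suc j) = cyclic_approx j + \<iota> (Suc j) d"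
    using iota_add[OF lift_in_vecs[OF cyclic_coords_in_vecs] d] by (simp add: cyclic_approx_def iota_lift cyclic_coords_in_vecs)
  then have "(norm (cyclic_approx (Suc j) - cyclic_approx j))\<^sup>2 = (\<Sum>s\<in>Tab (Suc j). (cmod (d s))\<^sup>2)"
    using norm_iota_sq[OF d] by simp
  also have "\<dots> \<le> (\<Sum>s\<in>Tab (Suc j). \<delta>\<^sup>2)"
    by (intro sum_mono) (auto simp: d_def)
  also have "\<dots> = ?n * \<delta>\<^sup>2"
    by simp
  also have "\<dots> \<le> (1 + ?n)\<^sup>2 * \<delta>\<^sup>2"
    by (intro mult_right_mono) (auto simp: power2_eq_square algebra_simps)
  also have "\<dots> = ((1 / 2) ^ j)\<^sup>2"
  proof -
    have "1 + ?n \<noteq> 0"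
      by (simp add: add_nonneg_eq_0_iff)
    then have "(1 + ?n) * \<delta> = (1 / 2) ^ j"
      by (simp add: \<delta>_def)
    then show ?thesis
      by (metis power_mult_distrib)
  qed
  finally show ?thesis
    by (rule power2_le_imp_le) simp
qed

lemma cyclic_approx_diff: "j \<le> m \<Longrightarrow> norm (cyclic_approx m - cyclic_approx j) \<le> 2 * (1 / 2) ^ j - 2 * (1 / 2) ^ m"
proof (induction m rule: dec_induct)
  case (step m)
  have "norm (cyclic_approx (Suc m) - cyclic_approx j) \<le>
      norm (cyclic_approx (Suc m) - cyclic_approx m) + norm (cyclic_approx m - cyclic_approx j)"
    using norm_triangle_ineq[of "cyclic_approx (Suc m) - cyclic_approx m" "cyclic_approx m - cyclic_approx j"] by simp
  then show ?case
    using step cyclic_approx_step[of m] by simp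
qed simp

lemma cyclic_approx_tail: "j \<le> m \<Longrightarrow> norm (cyclic_approx m - cyclic_approx j) \<le> 2 * (1 / 2) ^ j"
  by (rule order_trans[OF cyclic_approx_diff]) simp_all

lemma geometric_small: "(\<epsilon>::real) > 0 \<Longrightarrow> \<exists>m\<ge>i. C * (1 / 2) ^ m < \<epsilon>"
proof -
  assume "\<epsilon> > 0"
  have "(\<lambda>m. C * (1 / 2) ^ m) \<longlonglongrightarrow> C * 0"
    by (intro tendsto_intros) simp
  then have "\<forall>\<^sub>F m in sequentially. C * (1 / 2) ^ m < \<epsilon> \<and> i \<le> m"
    using \<open>\<epsilon> > 0\<close> by (intro eventually_conj order_tendstoD(2) eventually_ge_at_top) auto
  then show ?thesis
    by (auto dest: eventually_happens)
qed

lemma cyclic_approx_converges: obtains x where "cyclic_approx \<longlonglongrightarrow> x"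
proof -
  have "Cauchy cyclic_approx"
  proof (rule metric_CauchyI)
    fix \<epsilon> :: real assume "\<epsilon> > 0"
    then obtain M where M: "4 * (1 / 2) ^ M < \<epsilon>"
      using geometric_small by blast
    have "dist (cyclic_approx m) (cyclic_approx n) < \<epsilon>" if "m \<ge> M" "n \<ge> M" for m n
      using cyclic_approx_tail[OF that(1)] cyclic_approx_tail[OF that(2)] M
        dist_triangle2[of "cyclic_approx m" "cyclic_approx n" "cyclic_approx M"] by (simp add: dist_norm)
    then show "\<exists>M. \<forall>m\<ge>M. \<forall>n\<ge>M. dist (cyclic_approx m) (cyclic_approx n) < \<epsilon>" by blast
  qed
  then show thesis
    using that Cauchy_convergent convergent_def by blast
qed

text \<open>
  Passing to the next level multiplies the coordinates of both vectors by the same coefficients, and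
  it makes the other coordinates of the first vector 0. The constant \<open>K\<close> thus does not depend on the
  level, although there are more and more coordinates.
\<close>

lemma cyclic_coords_dominate:
  assumes w: "w \<in> vecs (Tab i)" and K: "\<And>s. s \<in> Tab i \<Longrightarrow> cmod (w s) \<le> K * cmod (cyclic_coords i s)" and "0 \<le> K"
    and "i \<le> m"
  shows "\<exists>w'\<in>vecs (Tab m). \<iota> m w' = \<iota> i w \<and> (\<forall>s\<in>Tab m. cmod (w' s) \<le> K * cmod (cyclic_coords m s))"
  using \<open>i \<le> m\<close>
proof (induction m rule: dec_induct)
  case base
  then show ?case using w K by blast
next
  case (step m)
  then obtain w' where w': "w' \<in> vecs (Tab m)" "\<iota> m w' = \<iota> i w"
    "\<forall>s\<in>Tab m. cmod (w' s) \<le> K * cmod (cyclic_coords m s)" by blast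
  have "cmod (lift m w' s) \<le> K * cmod (cyclic_coords (Suc m) s)" if s: "s \<in> Tab (Suc m)" for s
  proof (cases rule: Tab_Suc_cases[OF s])
    case 1
    then show ?thesis using \<open>0 \<le> K\<close> by (simp add: lift_def)
  next
    case 2
    then show ?thesis
      using w'(3) mult_left_mono[of "cmod (w' (parent m s))" "K * cmod (cyclic_coords m (parent m s))" "\<bar>coef m s\<bar>"]
      by (simp add: lift_def norm_mult mult.left_commute)
  qed
  then show ?case
    using lift_in_vecs[OF w'(1)] iota_lift[OF w'(1)] w'(2) by (intro bexI[of _ "lift m w'"]) auto
qed

text \<open>
  The limit \<open>x\<close> of the approximations is cyclic. Given a vector \<open>\<iota> i w\<close>, let the Gelfand-Tsetlin
  element \<open>a\<close> act at a high level \<open>m\<close> as the multiplication by the quotient of the coordinates of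
  \<open>\<iota> i w\<close> and of the \<open>m\<close>-th approximation. It maps this approximation to \<open>\<iota> i w\<close>, and since the
  quotients are bounded by a constant \<open>K\<close> that does not depend on \<open>m\<close>, it maps the rest of \<open>x\<close> to
  a vector of norm at most \<open>2 K / 2^m\<close>.
\<close>

lemma simple_spectrum: "simple_gt_spectrum U"
proof -
  obtain x where x: "cyclic_approx \<longlonglongrightarrow> x"
    by (rule cyclic_approx_converges)
  have "\<exists>a\<in>gelfand_tsetlin. dist (ga_act U a x) y < \<epsilon>" if "\<epsilon> > 0" for y and \<epsilon> :: real
  proof -
    have "y \<in> closure (\<Union>j. \<iota> j ` vecs (Tab j))"
      using iota_dense by simp
    then obtain i w where w: "w \<in> vecs (Tab i)" "dist (\<iota> i w) y < \<epsilon> / 2"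
      using \<open>\<epsilon> > 0\<close> by (auto simp: closure_approachable dest!: spec[of _ "\<epsilon> / 2"])
    define K where "K = (\<Sum>s\<in>Tab i. cmod (w s) / cmod (cyclic_coords i s))"
    have "0 \<le> K"
      unfolding K_def by (intro sum_nonneg) auto
    have K: "cmod (w s) \<le> K * cmod (cyclic_coords i s)" if s: "s \<in> Tab i" for s
    proof -
      have "cmod (w s) / cmod (cyclic_coords i s) \<le> K"
        unfolding K_def by (rule member_le_sum[OF s _ finite_Tab]) auto
      then show ?thesis
        using cyclic_coords_nonzero[OF s] by (simp add: field_simps)
    qed
    \<comment> \<open>the operator constructed at level \<open>m\<close> will map the rest of \<open>x\<close> to at most \<open>K * (2 / 2 ^ m)\<close>\<close>
    obtain m where m: "m \<ge> i" "2 * K * (1 / 2) ^ m < \<epsilon> / 2"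
      using geometric_small[of "\<epsilon> / 2" i "2 * K"] \<open>\<epsilon> > 0\<close> by auto
    obtain w' where w': "w' \<in> vecs (Tab m)" "\<iota> m w' = \<iota> i w"
      and bound: "\<And>s. s \<in> Tab m \<Longrightarrow> cmod (w' s) \<le> K * cmod (cyclic_coords m s)"
      using cyclic_coords_dominate[OF w(1) K \<open>0 \<le> K\<close> m(1)] by blast
    define f where "f s = (if s \<in> Tab m then w' s / cyclic_coords m s else 0)" for s
    have f: "cmod (f s) \<le> K" for s
      using bound[of s] cyclic_coords_nonzero[of s m] \<open>0 \<le> K\<close> by (auto simp: f_def norm_divide field_simps)
    obtain a where a: "a \<in> gelfand_tsetlin"
      and act: "\<And>l u. k + 2 * m \<le> k + 2 * l \<Longrightarrow> u \<in> Tab l \<Longrightarrow>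
        ga_act U a (level_vec l u) = f (take (Suc (k + 2 * m)) u) *\<^sub>C level_vec l u"
      using gelfand_tsetlin_interpolation[of "k + 2 * m" f] by blast
    have "ga_act U a (cyclic_approx m) = \<iota> m (\<lambda>s. f s * cyclic_coords m s)"
      unfolding cyclic_approx_def
      by (rule ga_act_diagonal[OF _ cyclic_coords_in_vecs]) (use act[of m] Tab_length in simp)
    also have "(\<lambda>s. f s * cyclic_coords m s) = w'"
      using w'(1) cyclic_coords_nonzero by (auto simp: f_def vecs_def fun_eq_iff)
    finally have am: "ga_act U a (cyclic_approx m) = \<iota> i w"
      using w'(2) by simp
    have "norm (ga_act U a (cyclic_approx l) - ga_act U a (cyclic_approx m)) \<le> K * (2 * (1 / 2) ^ m)" if lm: "m \<le> l" for l
    proof -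
      obtain z where z: "z \<in> vecs (Tab l)" "\<iota> l z = cyclic_approx m"
        using lift_iterate[OF cyclic_coords_in_vecs lm] unfolding cyclic_approx_def by blast
      define d where "d = (\<lambda>s. cyclic_coords l s - z s)"
      have d: "d \<in> vecs (Tab l)" "\<iota> l d = cyclic_approx l - cyclic_approx m"
        unfolding d_def using z cyclic_coords_in_vecs by (auto intro: vecs_diff simp: iota_diff cyclic_approx_def)
      let ?f = "\<lambda>s. f (take (Suc (k + 2 * m)) s)"
      have "ga_act U a (\<iota> l d) = \<iota> l (\<lambda>s. ?f s * d s)"
        by (rule ga_act_diagonal[OF _ d(1)]) (use act[of l] lm in simp)
      moreover have "(\<lambda>s. ?f s * d s) \<in> vecs (Tab l)"
        using d(1) by (auto simp: vecs_def)
      ultimately have "(norm (ga_act U a (\<iota> l d)))\<^sup>2 = (\<Sum>s\<in>Tab l. (cmod (?f s) * cmod (d s))\<^sup>2)"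
        by (simp add: norm_iota_sq norm_mult)
      also have "\<dots> \<le> (\<Sum>s\<in>Tab l. (K * cmod (d s))\<^sup>2)"
        by (intro sum_mono power_mono mult_right_mono f) auto
      also have "\<dots> = (K * norm (\<iota> l d))\<^sup>2"
        by (simp add: power_mult_distrib norm_iota_sq[OF d(1)] sum_distrib_left)
      finally have "norm (ga_act U a (\<iota> l d)) \<le> K * norm (\<iota> l d)"
        by (rule power2_le_imp_le) (simp add: \<open>0 \<le> K\<close>)
      also have "\<dots> \<le> K * (2 * (1 / 2) ^ m)"
        unfolding d(2) by (intro mult_left_mono cyclic_approx_tail lm \<open>0 \<le> K\<close>)
      finally show ?thesis
        by (simp add: d(2) ga_act_diff_right[OF U])
    qed
    then have "norm (ga_act U a x - ga_act U a (cyclic_approx m)) \<le> K * (2 * (1 / 2) ^ m)"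
      by (intro tendsto_upperbound[OF tendsto_norm[OF tendsto_diff[OF tendsto_ga_act[OF U x] tendsto_const]]])
        (auto simp: eventually_sequentially)
    then have "dist (ga_act U a x) (\<iota> i w) < \<epsilon> / 2"
      using m(2) by (simp add: dist_norm am)
    then have "dist (ga_act U a x) y < \<epsilon>"
      using w(2) dist_triangle[of "ga_act U a x" y "\<iota> i w"] by simp
    with a show ?thesis by blast
  qed
  then have "closure ((\<lambda>a. ga_act U a x) ` gelfand_tsetlin) = UNIV"
    by (auto simp: closure_approachable)
  then show ?thesis
    unfolding simple_gt_spectrum_def by blast
qed

end

section \<open>Nice cylinders of infinite tableaux\<close>

lemma infinite_tableau_segment:
  assumes "\<omega> \<in> infinite_tableaux"
  shows "initial_segment \<omega> N \<in> tableaux (\<omega> N)"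
  by (rule tableauxI[of _ N]) (use assms in \<open>auto simp: initial_segment_def infinite_tableaux_def nth_append simp del: upt_Suc\<close>)

lemma length_initial_segment [simp]: "length (initial_segment \<omega> N) = Suc N"
  by (simp add: initial_segment_def)

lemma initial_segment_nth: "n \<le> N \<Longrightarrow> initial_segment \<omega> N ! n = \<omega> n"
  by (simp add: initial_segment_def nth_append del: upt_Suc)

lemma take_initial_segment: "n \<le> N \<Longrightarrow> take (Suc n) (initial_segment \<omega> N) = initial_segment \<omega> n"
  by (simp add: initial_segment_def take_map del: upt_Suc)

lemma initial_segment_eq_iff: "initial_segment \<omega> N = initial_segment \<omega>' N \<longleftrightarrow> (\<forall>n\<le>N. \<omega> n = \<omega>' n)"
  by (auto simp: initial_segment_def list_eq_iff_nth_eq less_Suc_eq_le simp del: upt_Suc)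

lemma cylinder_in_sets: "cylinder s \<in> sets tableau_space"
  using cylinder_subset by (auto simp: tableau_space_def sets_measure_of)

lemma level_in_sets:
  assumes "finite \<kappa>"
  shows "{\<omega> \<in> infinite_tableaux. \<omega> (card \<kappa>) = \<kappa>} \<in> sets tableau_space"
proof -
  have "{\<omega> \<in> infinite_tableaux. \<omega> (card \<kappa>) = \<kappa>} = (\<Union>s\<in>tableaux \<kappa>. cylinder s)"
  proof (intro equalityI subsetI)
    fix \<omega> assume \<omega>: "\<omega> \<in> {\<omega> \<in> infinite_tableaux. \<omega> (card \<kappa>) = \<kappa>}"
    then have "initial_segment \<omega> (card \<kappa>) \<in> tableaux \<kappa>"
      using infinite_tableau_segment[of \<omega> "card \<kappa>"] by simp
    with \<omega> show "\<omega> \<in> (\<Union>s\<in>tableaux \<kappa>. cylinder s)"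
      by (auto simp: cylinder_def cells_def intro!: bexI[of _ "initial_segment \<omega> (card \<kappa>)"])
  next
    fix \<omega> assume "\<omega> \<in> (\<Union>s\<in>tableaux \<kappa>. cylinder s)"
    then obtain s where s: "s \<in> tableaux \<kappa>" "\<omega> \<in> infinite_tableaux" "initial_segment \<omega> (card \<kappa>) = s"
      using tableaux_length by (fastforce simp: cylinder_def cells_def)
    then show "\<omega> \<in> {\<omega> \<in> infinite_tableaux. \<omega> (card \<kappa>) = \<kappa>}"
      using tableaux_last[OF s(1)] initial_segment_nth[of "card \<kappa>" "card \<kappa>" \<omega>] by simp
  qed
  then show ?thesis
    using finite_tableaux[OF assms] by (auto intro!: sets.finite_UN cylinder_in_sets)
qed

context two_row_walk
begin

text \<open>
  The infinite tableaux that pass through the diagrams of all levels from \<open>j\<close> on: all their steps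
  of length two after level \<open>j\<close> are nice.
\<close>

definition nice_after :: "nat \<Rightarrow> (nat \<Rightarrow> diagram) set" where
  "nice_after j = {\<omega> \<in> infinite_tableaux. \<forall>i\<ge>j. \<omega> (k + 2 * i) = two_row (k + i) i}"

definition nice_cylinder :: "nat \<Rightarrow> path \<Rightarrow> (nat \<Rightarrow> diagram) set" where
  "nice_cylinder j s = {\<omega> \<in> nice_after j. initial_segment \<omega> (k + 2 * j) = s}"

text \<open>
  The product of the coefficients along the nice steps at the end of \<open>s\<close>, since \<open>coef\<close> last
  vanished.
\<close>

primrec weight :: "nat \<Rightarrow> path \<Rightarrow> real" where
  "weight 0 s = 1"
| "weight (Suc j) s = (if coef j s = 0 then 1 else coef j s * weight j (parent j s))"

lemma weight_nonzero: "weight j s \<noteq> 0"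
  by (induction j arbitrary: s) auto

lemma nice_after_mono: "i \<le> j \<Longrightarrow> nice_after i \<subseteq> nice_after j"
  by (auto simp: nice_after_def)

lemma nice_after_in_sets: "nice_after j \<in> sets tableau_space"
proof -
  have "nice_after j = (\<Inter>i\<in>{j..}. {\<omega> \<in> infinite_tableaux. \<omega> (card (two_row (k + i) i)) = two_row (k + i) i})"
    by (auto simp: nice_after_def mult_2 add.assoc)
  also have "\<dots> \<in> sets tableau_space"
    using level_in_sets[OF finite_two_row] by (intro sets.countable_INT') auto
  finally show ?thesis .
qed

lemma nice_after_segment:
  assumes "\<omega> \<in> nice_after j" "j \<le> i"
  shows "initial_segment \<omega> (k + 2 * i) \<in> Tab i"
  using assms infinite_tableau_segment[of \<omega> "k + 2 * i"] by (simp add: nice_after_def)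

lemma nice_cylinder_in_sets: "s \<in> Tab j \<Longrightarrow> nice_cylinder j s \<in> sets tableau_space"
proof -
  assume s: "s \<in> Tab j"
  have "nice_cylinder j s = nice_after j \<inter> cylinder s"
    using Tab_length[OF s] by (auto simp: nice_cylinder_def nice_after_def cylinder_def cells_def)
  then show ?thesis
    using nice_after_in_sets cylinder_in_sets by auto
qed

lemma nice_cylinder_mem: "\<omega> \<in> nice_after j \<Longrightarrow> \<omega> \<in> nice_cylinder j (initial_segment \<omega> (k + 2 * j))"
  by (simp add: nice_cylinder_def)

lemma nice_cylinder_nested:
  assumes "j \<le> i" "\<omega> \<in> nice_cylinder j s" "\<omega> \<in> nice_cylinder i u"
  shows "nice_cylinder i u \<subseteq> nice_cylinder j s"
proof
  fix \<omega>' assume \<omega>': "\<omega>' \<in> nice_cylinder i u"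
  have eq: "\<omega>' n = \<omega> n" if "n \<le> k + 2 * i" for n
    using \<omega>' assms(3) that initial_segment_eq_iff[of \<omega>' "k + 2 * i" \<omega>] by (simp add: nice_cylinder_def)
  have "\<omega>' (k + 2 * l) = two_row (k + l) l" if "l \<ge> j" for l
    using that eq[of "k + 2 * l"] assms(2) \<omega>' by (cases "l \<le> i") (auto simp: nice_cylinder_def nice_after_def)
  moreover have "initial_segment \<omega>' (k + 2 * j) = initial_segment \<omega> (k + 2 * j)"
    using eq assms(1) by (auto simp: initial_segment_eq_iff)
  ultimately show "\<omega>' \<in> nice_cylinder j s"
    using assms(2) \<omega>' by (auto simp: nice_cylinder_def nice_after_def)
qed

section \<open>Probabilities of the random walk\<close>

text \<open>
  The choices are independent, and \<open>1 - p^2 = q^2\<close> is the probability of the second one.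
\<close>

lemma choice_space_cylinder:
  assumes "finite J"
  shows "emeasure (choice_space p) {\<omega>. \<forall>l\<in>J. \<omega> l = \<beta> l} =
    (\<Prod>l\<in>J. ennreal ((if \<beta> l then p l else q l)\<^sup>2))"
proof -
  let ?M = "\<lambda>l. measure_pmf (bernoulli_pmf ((p l)\<^sup>2))"
  interpret product_prob_space ?M UNIV
    by unfold_locales
  have "emeasure (?M l) {\<beta> l} = ennreal ((if \<beta> l then p l else q l)\<^sup>2)" for l
  proof -
    have "0 \<le> (p l)\<^sup>2" "(p l)\<^sup>2 \<le> 1" "1 - (p l)\<^sup>2 = (q l)\<^sup>2"
      using unit[of l] zero_le_power2[of "p l"] zero_le_power2[of "q l"] by linarith+
    then show ?thesis
      by (cases "\<beta> l") (simp_all add: emeasure_pmf_single)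
  qed
  then show ?thesis
    using emeasure_PiM_Collect[of J "\<lambda>l. {\<beta> l}"] assms by (simp add: choice_space_def space_PiM)
qed

lemma choices_extend:
  "{\<omega>. \<forall>l\<in>{b..<b + m}. \<omega> l = \<beta> l} \<inter> {\<omega>. \<omega> (b + m) = c} =
    {\<omega>. \<forall>l\<in>{b..<Suc (b + m)}. \<omega> l = (\<beta>(b + m := c)) l}"
  by (auto simp: less_Suc_eq)

text \<open>
  A finite path of the walk records all choices made so far, so it determines them.
\<close>

lemma walk_segment_set:
  assumes t: "t \<in> Tab b"
  shows "{\<omega>. walk_segment k t \<omega> m = s} = {} \<or>
    (\<exists>\<beta>. {\<omega>. walk_segment k t \<omega> m = s} = {\<omega>. \<forall>l\<in>{b..<b + m}. \<omega> l = \<beta> l})"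
proof (induction m arbitrary: s)
  case 0
  show ?case by (auto simp: add.commute)
next
  case (Suc m)
  show ?case
  proof (cases "{\<omega>. walk_segment k t \<omega> (Suc m) = s} = {}")
    case False
    then obtain \<omega>0 where \<omega>0: "walk_segment k t \<omega>0 (Suc m) = s" by blast
    have len: "length (walk_segment k t \<omega> m) = Suc (k + 2 * (b + m))" for \<omega>
      using walk_segment_length[OF k t] .
    have "walk_segment k t \<omega> (Suc m) = s \<longleftrightarrow>
        walk_segment k t \<omega> m = walk_segment k t \<omega>0 m \<and> \<omega> (b + m) = \<omega>0 (b + m)" for \<omega>
    proof -
      have "tl (t21 k (b + m)) \<noteq> tl (t12 k (b + m))"
        by (simp add: t21_def t12_def)
      then show ?thesis
        unfolding \<omega>0[symmetric] walk_segment_Suc[OF k t] followed_by_def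
        by (cases "\<omega> (b + m)"; cases "\<omega>0 (b + m)") (simp_all add: append_eq_append_conv len)
    qed
    moreover obtain \<beta> where \<beta>: "{\<omega>. walk_segment k t \<omega> m = walk_segment k t \<omega>0 m} =
        {\<omega>. \<forall>l\<in>{b..<b + m}. \<omega> l = \<beta> l}"
      using Suc[of "walk_segment k t \<omega>0 m"] by auto
    ultimately have "{\<omega>. walk_segment k t \<omega> (Suc m) = s} =
        {\<omega>. \<forall>l\<in>{b..<b + m}. \<omega> l = \<beta> l} \<inter> {\<omega>. \<omega> (b + m) = \<omega>0 (b + m)}"
      by (simp only: Collect_conj_eq)
    then show ?thesis
      unfolding choices_extend add_Suc_right by blast
  qed simp
qed

lemma walk_segment_prob_Suc:
  assumes t: "t \<in> Tab b" and s: "s \<in> Tab (Suc (b + m))"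
  shows "emeasure (choice_space p) {\<omega>. walk_segment k t \<omega> (Suc m) = s} =
    ennreal ((coef (b + m) s)\<^sup>2) *
    emeasure (choice_space p) {\<omega>. walk_segment k t \<omega> m = parent (b + m) s}"
proof -
  let ?j = "b + m" and ?P = "emeasure (choice_space p)"
  have step: "walk_segment k t \<omega> (Suc m) = s \<longleftrightarrow> walk_segment k t \<omega> m = parent ?j s \<and>
      drop (k + 2 * ?j) s = (if \<omega> ?j then t21 k ?j else t12 k ?j)" for \<omega>
  proof -
    have y: "length (walk_segment k t \<omega> m) = Suc (k + 2 * ?j)" "last (walk_segment k t \<omega> m) = two_row (k + ?j) ?j"
      using walk_segment_length[OF k t] walk_segment_tableaux[OF k t, of \<omega> m]
      by (auto simp: tableaux_def paths_def)
    let ?u = "if \<omega> ?j then t21 k ?j else t12 k ?j"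
    have u: "?u \<noteq> []" "last (walk_segment k t \<omega> m) = hd ?u"
      using y(2) by (auto simp: t21_def t12_def)
    show ?thesis
      unfolding walk_segment_Suc[OF k t] parent_def eq_commute[of _ s] followed_by_iff[OF y(1) u]
      by (auto simp only: eq_commute[of _ "take _ _"])
  qed
  consider (empty) "{\<omega>. walk_segment k t \<omega> m = parent ?j s} = {}"
    | (cyl) \<beta> where "{\<omega>. walk_segment k t \<omega> m = parent ?j s} = {\<omega>. \<forall>l\<in>{b..<?j}. \<omega> l = \<beta> l}"
    using walk_segment_set[OF t, of m "parent ?j s"] by blast
  then show ?thesis
  proof cases
    case empty
    then have "{\<omega>. walk_segment k t \<omega> (Suc m) = s} = {}"
      unfolding step by blast
    with empty show ?thesis by simp
  next
    case cyl
    have choice: "?P {\<omega>. walk_segment k t \<omega> (Suc m) = s} = ennreal ((if c then p ?j else q ?j)\<^sup>2) * ?P {\<omega>. walk_segment k t \<omega> m = parent ?j s}"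
      if c: "\<And>\<omega>. drop (k + 2 * ?j) s = (if \<omega> ?j then t21 k ?j else t12 k ?j) \<longleftrightarrow> \<omega> ?j = c" for c
    proof -
      have "{\<omega>. walk_segment k t \<omega> (Suc m) = s} = {\<omega>. \<forall>l\<in>{b..<Suc ?j}. \<omega> l = (\<beta>(?j := c)) l}"
        unfolding step c Collect_conj_eq cyl choices_extend ..
      then show ?thesis
        unfolding cyl by (simp add: choice_space_cylinder prod.atLeastLessThan_Suc mult.commute)
    qed
    consider (21) "drop (k + 2 * ?j) s = t21 k ?j" | (12) "drop (k + 2 * ?j) s = t12 k ?j"
      | (none) "drop (k + 2 * ?j) s \<noteq> t21 k ?j" "drop (k + 2 * ?j) s \<noteq> t12 k ?j"
      by blast
    then show ?thesis
    proof cases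
      case 21
      then show ?thesis
        using choice[of True] t21_neq_t12[of k ?j] by (simp add: coef_def)
    next
      case 12
      then show ?thesis
        using choice[of False] t21_neq_t12[of k ?j] by (auto simp: coef_def)
    next
      case none
      then show ?thesis
        unfolding step by (simp add: coef_def)
    qed
  qed
qed

text \<open>
  Only the diagram two steps before the end matters. At level 0 there is no room for a nice step,
  whether \<open>k\<close> is 1 or larger.
\<close>

lemma proper_iff:
  assumes t: "t \<in> Tab i"
  shows "t \<in> proper_tableaux k \<longleftrightarrow> i = 0 \<or> t ! (k + 2 * (i - 1)) \<noteq> two_row (k + (i - 1)) (i - 1)"
proof -
  have cells: "cells t = k + 2 * i" and last: "last t = two_row (k + i) i"
    using Tab_length[OF t] t by (auto simp: cells_def tableaux_def paths_def)
  have "t \<in> proper_tableaux k \<longleftrightarrow>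
      2 \<le> k + 2 * i \<and> \<not> nice (t ! (k + 2 * i - 2)) (two_row (k + i) i) \<or> k = 1 \<and> k + 2 * i = 1"
    unfolding proper_tableaux_def mem_Collect_eq cells last using t by (auto simp: add.commute)
  then show ?thesis
    using k by (cases i) (auto simp: nice_def)
qed

lemma proper_obtain:
  assumes "t \<in> proper_tableaux k"
  obtains i where "t \<in> Tab i"
  using assms by (auto simp: proper_tableaux_def add.commute)

lemma walk_nice_after:
  assumes t: "t \<in> Tab i"
  shows "walk_tableau k t \<omega> \<in> nice_after i"
    and "initial_segment (walk_tableau k t \<omega>) (k + 2 * (i + m)) = walk_segment k t \<omega> m"
proof -
  have nth: "walk_tableau k t \<omega> n = walk_segment k t \<omega> m ! n" if "n \<le> k + 2 * (i + m)" for n m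
    using walk_tableau_nth[OF k t that] .
  have len: "length (walk_segment k t \<omega> m) = Suc (k + 2 * (i + m))" for m
    using walk_segment_length[OF k t] .
  show "initial_segment (walk_tableau k t \<omega>) (k + 2 * (i + m)) = walk_segment k t \<omega> m"
    by (rule nth_equalityI) (use len[of m] nth[of _ m] in \<open>auto simp: initial_segment_nth\<close>)
  have "walk_tableau k t \<omega> (k + 2 * l) = two_row (k + l) l" if "l \<ge> i" for l
    using nth[of "k + 2 * l" "l - i"] that tableaux_last[OF walk_segment_tableaux[OF k t, of \<omega> "l - i"]]
    by (simp add: mult_2 add.assoc)
  then show "walk_tableau k t \<omega> \<in> nice_after i"
    using walk_tableau_infinite[OF k t] by (simp add: nice_after_def)
qed

lemma emeasure_walk_measure:
  assumes "t \<in> proper_tableaux k" "A \<in> sets tableau_space"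
  shows "emeasure (walk_measure k p t) A = emeasure (choice_space p) {\<omega>. walk_tableau k t \<omega> \<in> A}"
  unfolding walk_measure_def
  by (subst emeasure_distr[OF measurable_walk_tableau[OF k assms(1)] assms(2)]) (simp add: vimage_def)

text \<open>
  A walk that starts above level \<open>j\<close> does not pass through the diagram of the level just below its
  starting point, since its starting point is proper.
\<close>

lemma walk_measure_nice_cylinder:
  assumes t: "t \<in> proper_tableaux k" "t \<in> Tab i" and s: "s \<in> Tab j"
  shows "i \<le> j \<Longrightarrow> emeasure (walk_measure k p t) (nice_cylinder j s) =
      emeasure (choice_space p) {\<omega>. walk_segment k t \<omega> (j - i) = s}"
    and "j < i \<Longrightarrow> emeasure (walk_measure k p t) (nice_cylinder j s) = 0"
proof -
  note em = emeasure_walk_measure[OF t(1) nice_cylinder_in_sets[OF s]]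
  show "emeasure (walk_measure k p t) (nice_cylinder j s) =
      emeasure (choice_space p) {\<omega>. walk_segment k t \<omega> (j - i) = s}" if "i \<le> j"
  proof -
    have "walk_tableau k t \<omega> \<in> nice_cylinder j s \<longleftrightarrow> walk_segment k t \<omega> (j - i) = s" for \<omega>
      using that walk_nice_after(1)[OF t(2), of \<omega>] walk_nice_after(2)[OF t(2), of \<omega> "j - i"]
        nice_after_mono[OF that] by (auto simp: nice_cylinder_def)
    then show ?thesis
      unfolding em by simp
  qed
  show "emeasure (walk_measure k p t) (nice_cylinder j s) = 0" if "j < i"
  proof -
    have "walk_tableau k t \<omega> \<notin> nice_cylinder j s" for \<omega>
    proof
      assume "walk_tableau k t \<omega> \<in> nice_cylinder j s"
      then have "walk_tableau k t \<omega> (k + 2 * (i - 1)) = two_row (k + (i - 1)) (i - 1)"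
        using that by (auto simp: nice_cylinder_def nice_after_def)
      moreover have "walk_tableau k t \<omega> (k + 2 * (i - 1)) = t ! (k + 2 * (i - 1))"
        using walk_tableau_nth[OF k t(2), of "k + 2 * (i - 1)" 0] by simp
      ultimately show False
        using t(1) that unfolding proper_iff[OF t(2)] by simp
    qed
    then show ?thesis unfolding em by simp
  qed
qed

lemma emeasure_choice_space_UNIV: "emeasure (choice_space p) UNIV = 1"
  using prob_space.emeasure_space_1[OF prob_space_choice_space[of p]] by simp

lemma sum_over_proper_single:
  assumes s: "s \<in> proper_tableaux k"
    and one: "f s = 1" and other: "\<And>t. t \<in> proper_tableaux k \<Longrightarrow> t \<noteq> s \<Longrightarrow> f t = 0"
  shows "(\<integral>\<^sup>+ t. f t \<partial>count_space (proper_tableaux k)) = (1::ennreal)"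
proof -
  have "(\<integral>\<^sup>+ t. f t \<partial>count_space (proper_tableaux k)) =
      (\<integral>\<^sup>+ t. indicator {s} t \<partial>count_space (proper_tableaux k))"
    by (intro nn_integral_cong) (use one other in \<open>auto simp: indicator_def\<close>)
  also have "\<dots> = emeasure (count_space (proper_tableaux k)) {s}"
    using s by (intro nn_integral_indicator) auto
  finally show ?thesis
    using s by simp
qed

end

text \<open>
  If \<open>p j = 0\<close>, then no walk takes the path \<open>t21 k j\<close>, and no walk starts at a tableau that ends
  with it, although such a tableau contributes a vector to the inductive limit: the nice cylinder
  over it is a null set. The same happens with \<open>t12 k j\<close> if \<open>q j = 0\<close>.
\<close>

locale nondegenerate_walk = two_row_walk +
  assumes nonzero: "p j \<noteq> 0" "q j \<noteq> 0"
begin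

lemma coef_zero_iff: "s \<in> Tab (Suc j) \<Longrightarrow> coef j s = 0 \<longleftrightarrow> s ! (k + 2 * j) \<noteq> two_row (k + j) j"
  using coef_nonzero[of s j] Tab_Suc_parent(2)[of s j] nonzero by (auto simp: coef_def)

text \<open>
  By induction on the level. If \<open>s\<close> is proper, then only the walk from \<open>s\<close> itself reaches the
  cylinder, and it does so with probability 1. Otherwise every walk that reaches it comes through the
  parent of \<open>s\<close>, and its last choice has the probability \<open>(coef j s)^2\<close>.
\<close>

lemma spectral_measure_nice_cylinder:
  "s \<in> Tab j \<Longrightarrow> emeasure (spectral_measure k p) (nice_cylinder j s) = ennreal ((weight j s)\<^sup>2)"
proof (induction j arbitrary: s)
  case 0
  have "(\<integral>\<^sup>+ t. emeasure (walk_measure k p t) (nice_cylinder 0 s) \<partial>count_space (proper_tableaux k)) = 1"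
  proof (rule sum_over_proper_single)
    show s: "s \<in> proper_tableaux k"
      using proper_iff[OF 0] by simp
    show "emeasure (walk_measure k p s) (nice_cylinder 0 s) = 1"
      using walk_measure_nice_cylinder(1)[OF s 0 0] by (simp add: emeasure_choice_space_UNIV)
    fix t assume t: "t \<in> proper_tableaux k" "t \<noteq> s"
    obtain i where i: "t \<in> Tab i" by (rule proper_obtain[OF t(1)])
    show "emeasure (walk_measure k p t) (nice_cylinder 0 s) = 0"
      using walk_measure_nice_cylinder[OF t(1) i 0] t(2) by (cases i) auto
  qed
  then show ?case
    using emeasure_spectral_measure[OF nice_cylinder_in_sets[OF 0]] by simp
next
  case (Suc j)
  note s = Suc.prems
  show ?case
  proof (cases "coef j s = 0")
    case True
    have "(\<integral>\<^sup>+ t. emeasure (walk_measure k p t) (nice_cylinder (Suc j) s) \<partial>count_space (proper_tableaux k)) = 1"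
    proof (rule sum_over_proper_single)
      show sp: "s \<in> proper_tableaux k"
        using proper_iff[OF s] True coef_zero_iff[OF s] by simp
      show "emeasure (walk_measure k p s) (nice_cylinder (Suc j) s) = 1"
        using walk_measure_nice_cylinder(1)[OF sp s s] by (simp add: emeasure_choice_space_UNIV)
      fix t assume t: "t \<in> proper_tableaux k" "t \<noteq> s"
      obtain i where i: "t \<in> Tab i" by (rule proper_obtain[OF t(1)])
      consider "i \<le> j" | "i = Suc j" | "i > Suc j" by linarith
      then show "emeasure (walk_measure k p t) (nice_cylinder (Suc j) s) = 0"
      proof cases
        case 1
        then show ?thesis
          using walk_measure_nice_cylinder(1)[OF t(1) i s] walk_segment_prob_Suc[OF i, of s "j - i"] s True
          by (simp add: Suc_diff_le del: walk_segment.simps)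
      next
        case 2
        then show ?thesis
          using walk_measure_nice_cylinder(1)[OF t(1) i s] t(2) by simp
      next
        case 3
        then show ?thesis
          using walk_measure_nice_cylinder(2)[OF t(1) i s] by simp
      qed
    qed
    then show ?thesis
      using emeasure_spectral_measure[OF nice_cylinder_in_sets[OF s]] True by simp
  next
    case False
    have par: "parent j s \<in> Tab j" and notproper: "s \<notin> proper_tableaux k"
      using Tab_Suc_parent(1)[OF s] coef_nonzero[OF s False] proper_iff[OF s] by auto
    have "emeasure (walk_measure k p t) (nice_cylinder (Suc j) s) =
        ennreal ((coef j s)\<^sup>2) * emeasure (walk_measure k p t) (nice_cylinder j (parent j s))"
      if t: "t \<in> proper_tableaux k" for t
    proof -
      obtain i where i: "t \<in> Tab i" by (rule proper_obtain[OF t])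
      consider "i \<le> j" | "i = Suc j" | "i > Suc j" by linarith
      then show ?thesis
      proof cases
        case 1
        then show ?thesis
          using walk_measure_nice_cylinder(1)[OF t i s] walk_measure_nice_cylinder(1)[OF t i par]
            walk_segment_prob_Suc[OF i, of s "j - i"] s
          by (simp add: Suc_diff_le del: walk_segment.simps)
      next
        case 2
        then show ?thesis
          using walk_measure_nice_cylinder(1)[OF t i s] walk_measure_nice_cylinder(2)[OF t i par]
            t notproper by auto
      next
        case 3
        then show ?thesis
          using walk_measure_nice_cylinder(2)[OF t i s] walk_measure_nice_cylinder(2)[OF t i par] by simp
      qed
    qed
    then have "emeasure (spectral_measure k p) (nice_cylinder (Suc j) s) =
        ennreal ((coef j s)\<^sup>2) * emeasure (spectral_measure k p) (nice_cylinder j (parent j s))"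
      unfolding emeasure_spectral_measure[OF nice_cylinder_in_sets[OF s]]
        emeasure_spectral_measure[OF nice_cylinder_in_sets[OF par]]
      by (subst nn_integral_cmult[symmetric]) (auto intro!: nn_integral_cong)
    then show ?thesis
      using False by (simp add: Suc.IH[OF par] power_mult_distrib ennreal_mult)
  qed
qed

lemma spectral_measure_AE_nice: "AE \<omega> in spectral_measure k p. \<exists>j. \<omega> \<in> nice_after j"
proof (rule AE_I)
  let ?N = "infinite_tableaux - (\<Union>j. nice_after j)"
  have N: "?N \<in> sets tableau_space"
    using sets.compl_sets[of "\<Union>j. nice_after j" tableau_space] nice_after_in_sets by auto
  then show "?N \<in> sets (spectral_measure k p)" by simp
  have "emeasure (walk_measure k p t) ?N = 0" if t: "t \<in> proper_tableaux k" for t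
  proof -
    obtain i where i: "t \<in> Tab i" by (rule proper_obtain[OF t])
    then have "walk_tableau k t \<omega> \<notin> ?N" for \<omega>
      using walk_nice_after(1)[OF i] by blast
    then have "{\<omega>. walk_tableau k t \<omega> \<in> ?N} = {}" by blast
    then show ?thesis
      unfolding emeasure_walk_measure[OF t N] by (simp only: emeasure_empty)
  qed
  then show "emeasure (spectral_measure k p) ?N = 0"
    by (simp add: emeasure_spectral_measure[OF N] nn_integral_0_iff_AE AE_count_space)
qed (auto simp: space_spectral_measure)

lemma sigma_finite_spectral_measure: "sigma_finite_measure (spectral_measure k p)"
proof
  let ?N = "infinite_tableaux - (\<Union>j. nice_after j)"
  let ?C = "insert ?N (\<Union>j. nice_cylinder j ` Tab j)"
  have N: "?N \<in> sets tableau_space"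
    using sets.compl_sets[of "\<Union>j. nice_after j" tableau_space] nice_after_in_sets by auto
  have "AE \<omega> in spectral_measure k p. \<omega> \<notin> ?N"
    using spectral_measure_AE_nice by eventually_elim auto
  then have "?N \<in> null_sets (spectral_measure k p)"
    using N by (simp add: AE_iff_null_sets)
  then have "emeasure (spectral_measure k p) ?N = 0"
    by (rule null_setsD1)
  then have "\<forall>a\<in>?C. emeasure (spectral_measure k p) a \<noteq> \<infinity>"
    by (auto simp: spectral_measure_nice_cylinder)
  moreover have "countable ?C"
    by (intro countable_insert countable_UN[OF countableI_type] countable_finite finite_imageI finite_Tab)
  moreover have "?C \<subseteq> sets (spectral_measure k p)"
    using N nice_cylinder_in_sets by auto
  moreover have "\<Union>?C = space (spectral_measure k p)"
  proof -
    have "\<omega> \<in> (\<Union>s\<in>Tab j. nice_cylinder j s)" if "\<omega> \<in> nice_after j" for \<omega> j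
      using nice_cylinder_mem[OF that] nice_after_segment[OF that order_refl] by blast
    then show ?thesis
      by (fastforce simp: nice_cylinder_def nice_after_def)
  qed
  ultimately show "\<exists>A. countable A \<and> A \<subseteq> sets (spectral_measure k p) \<and>
      \<Union> A = space (spectral_measure k p) \<and> (\<forall>a\<in>A. emeasure (spectral_measure k p) a \<noteq> \<infinity>)"
    by blast
qed

end

section \<open>Square-integrable functions\<close>

lemma cmod_sq_eq_Re: "(cmod z)\<^sup>2 = Re (cnj z * z)"
  by (simp add: cmod_power2) (simp add: power2_eq_square)

lemma borel_measurable_cnj [measurable]:
  "f \<in> borel_measurable M \<Longrightarrow> (\<lambda>x. cnj (f x)) \<in> borel_measurable M"
  by (rule measurable_compose[OF _ borel_measurable_continuous_onI]) (auto intro: continuous_intros)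

context
  fixes M :: "'a measure"
begin

lemma square_integrable_add:
  assumes "square_integrable M f" "square_integrable M g"
  shows "square_integrable M (\<lambda>x. f x + g x)"
proof -
  have meas: "f \<in> borel_measurable M" "g \<in> borel_measurable M"
    using assms by (auto simp: square_integrable_def)
  have "integrable M (\<lambda>x. (cmod (f x + g x))\<^sup>2)"
  proof (rule Bochner_Integration.integrable_bound)
    show "integrable M (\<lambda>x. 2 * (cmod (f x))\<^sup>2 + 2 * (cmod (g x))\<^sup>2)"
      using assms by (auto simp: square_integrable_def)
    have "(cmod (a + b))\<^sup>2 \<le> 2 * (cmod a)\<^sup>2 + 2 * (cmod b)\<^sup>2" for a b
      using power_mono[OF norm_triangle_ineq[of a b] norm_ge_zero, of 2]
        zero_le_power2[of "cmod a - cmod b"] by (simp add: power2_eq_square algebra_simps)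
    then show "AE x in M. norm ((cmod (f x + g x))\<^sup>2) \<le> norm (2 * (cmod (f x))\<^sup>2 + 2 * (cmod (g x))\<^sup>2)"
      by (simp add: abs_of_nonneg)
  qed (use meas in measurable)
  with meas show ?thesis
    by (simp add: square_integrable_def)
qed

lemma square_integrable_scale: "square_integrable M f \<Longrightarrow> square_integrable M (\<lambda>x. c * f x)"
  by (auto simp: square_integrable_def norm_mult power_mult_distrib)

lemma square_integrable_diff:
  "square_integrable M f \<Longrightarrow> square_integrable M g \<Longrightarrow> square_integrable M (\<lambda>x. f x - g x)"
  using square_integrable_add[of f "\<lambda>x. - 1 * g x"] square_integrable_scale[of g "- 1"] by simp

lemma norm_mult_le_squares: "cmod (cnj a * b) \<le> (cmod a)\<^sup>2 + (cmod b)\<^sup>2"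
  unfolding norm_mult complex_mod_cnj
  using sum_squares_bound[of "cmod a" "cmod b"] mult_nonneg_nonneg[OF norm_ge_zero norm_ge_zero, of a b]
  by linarith

lemma square_integrable_mult:
  assumes "square_integrable M f" "square_integrable M g"
  shows "integrable M (\<lambda>x. cnj (f x) * g x)"
proof (rule Bochner_Integration.integrable_bound)
  show "integrable M (\<lambda>x. (cmod (f x))\<^sup>2 + (cmod (g x))\<^sup>2)"
    using assms by (auto simp: square_integrable_def)
  show "(\<lambda>x. cnj (f x) * g x) \<in> borel_measurable M"
    using assms by (auto simp: square_integrable_def)
  show "AE x in M. norm (cnj (f x) * g x) \<le> norm ((cmod (f x))\<^sup>2 + (cmod (g x))\<^sup>2)"
    using norm_mult_le_squares by (simp add: abs_of_nonneg)
qed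

lemma integral_norm_add_sq:
  assumes "square_integrable M f" "square_integrable M g"
  shows "(LINT x|M. (cmod (f x + g x))\<^sup>2) =
    (LINT x|M. (cmod (f x))\<^sup>2) + (LINT x|M. (cmod (g x))\<^sup>2) + 2 * Re (LINT x|M. cnj (f x) * g x)"
proof -
  have *: "(cmod (a + b))\<^sup>2 = (cmod a)\<^sup>2 + (cmod b)\<^sup>2 + 2 * Re (cnj a * b)" for a b
    unfolding cmod_power2 by (simp add: power2_eq_square algebra_simps)
  have "integrable M (\<lambda>x. Re (cnj (f x) * g x))"
    using square_integrable_mult[OF assms] by (rule integrable_Re)
  then have "(LINT x|M. (cmod (f x + g x))\<^sup>2) =
    (LINT x|M. (cmod (f x))\<^sup>2) + (LINT x|M. (cmod (g x))\<^sup>2) + 2 * (LINT x|M. Re (cnj (f x) * g x))"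
    unfolding * using assms by (simp add: square_integrable_def del: times_complex.simps)
  then show ?thesis
    using integral_Re[OF square_integrable_mult[OF assms]] by simp
qed

lemma integral_norm_diff_sq:
  assumes "square_integrable M f" "square_integrable M g"
  shows "(LINT x|M. (cmod (f x - g x))\<^sup>2) =
    (LINT x|M. (cmod (f x))\<^sup>2) + (LINT x|M. (cmod (g x))\<^sup>2) - 2 * Re (LINT x|M. cnj (f x) * g x)"
  using integral_norm_add_sq[OF assms(1) square_integrable_scale[OF assms(2), of "- 1"]] by simp

text \<open>
  The Riesz-Fischer argument: the integral of \<open>S = (\<Sum>n. 4^n * |f (n + 1) - f n|^2)\<close> is at most
  \<open>\<Sum>n. 4^n / 8^n = 2\<close>, so \<open>S\<close> is finite almost everywhere, and \<open>|f (n + 1) - f n| \<le> sqrt S / 2^n\<close>.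
  This gives both the limit and a dominating function.
\<close>

lemma L2_limit:
  assumes si: "\<And>n. square_integrable M (f n)"
    and fast: "\<And>n. (LINT x|M. (cmod (f (Suc n) x - f n x))\<^sup>2) \<le> (1 / 8) ^ n"
  obtains g G where "square_integrable M g" "integrable M (\<lambda>x. (G x :: real)\<^sup>2)"
    "AE x in M. (\<lambda>n. f n x) \<longlonglongrightarrow> g x" "AE x in M. \<forall>n. cmod (f n x) \<le> G x"
proof -
  have [measurable]: "f n \<in> borel_measurable M" for n
    using si by (simp add: square_integrable_def)
  define D where "D n x = 4 ^ n * (cmod (f (Suc n) x - f n x))\<^sup>2" for n x
  have [measurable]: "D n \<in> borel_measurable M" for n
    unfolding D_def by measurable
  have D_int: "integrable M (D n)" for n
    unfolding D_def using square_integrable_diff[OF si si] by (simp add: square_integrable_def)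
  have D_le: "(LINT x|M. D n x) \<le> (1 / 2) ^ n" for n
  proof -
    have "(LINT x|M. D n x) \<le> 4 ^ n * (1 / 8) ^ n"
      unfolding D_def using fast by (simp add: mult_left_mono)
    also have "\<dots> = (1 / 2) ^ n"
      by (simp flip: power_mult_distrib)
    finally show ?thesis .
  qed
  have D0: "0 \<le> D n x" for n x
    by (simp add: D_def)
  have D_sum: "summable (\<lambda>n. LINT x|M. norm (D n x))"
    using D_le D0 by (intro summable_comparison_test'[OF summable_geometric[of "1 / 2 :: real"], of 0])
      (auto simp: integral_nonneg_AE)
  have AE_sum: "AE x in M. summable (\<lambda>n. norm (D n x))"
  proof -
    have "(\<integral>\<^sup>+ x. suminf (\<lambda>n. ennreal (D n x)) \<partial>M) = suminf (\<lambda>n. \<integral>\<^sup>+ x. ennreal (D n x) \<partial>M)"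
      by (rule nn_integral_suminf) measurable
    also have "\<dots> = suminf (\<lambda>n. ennreal (LINT x|M. D n x))"
      using D_int D0 by (simp add: nn_integral_eq_integral)
    also have "\<dots> \<noteq> \<infinity>"
      using D_sum D0 by (subst suminf_ennreal_eq[OF _ summable_sums]) (auto intro: integral_nonneg_AE)
    finally have "AE x in M. suminf (\<lambda>n. ennreal (D n x)) \<noteq> \<infinity>"
      by (intro nn_integral_PInf_AE) auto
    then show ?thesis
      by eventually_elim (use D0 in \<open>auto intro: summable_suminf_not_top\<close>)
  qed
  define S where "S x = suminf (\<lambda>n. D n x)" for x
  have S_int: "integrable M S"
    unfolding S_def using D_int AE_sum D_sum by (rule integrable_suminf)
  define G where "G x = cmod (f 0 x) + 2 * sqrt (S x)" for x
  have step: "cmod (f (Suc n) x - f n x) \<le> sqrt (S x) * (1 / 2) ^ n"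
    if "summable (\<lambda>n. norm (D n x))" for n x
  proof -
    have "(\<Sum>i\<in>{n}. D i x) \<le> S x"
      unfolding S_def by (rule sum_le_suminf) (use that D0 in auto)
    then have "(cmod (f (Suc n) x - f n x))\<^sup>2 \<le> S x * (1 / 4) ^ n"
      by (simp add: D_def field_simps)
    also have "\<dots> = S x * ((1 / 2) ^ n)\<^sup>2"
      by (simp add: power2_eq_square flip: power_mult_distrib)
    finally show ?thesis
      by (metis real_le_rsqrt real_sqrt_mult real_sqrt_abs abs_of_nonneg zero_le_power zero_le_divide_1_iff zero_le_numeral)
  qed
  have S0: "0 \<le> S x" if "summable (\<lambda>n. norm (D n x))" for x
    unfolding S_def by (rule suminf_nonneg) (use that D0 in auto)
  have bound: "cmod (f n x) \<le> G x" if x: "summable (\<lambda>n. norm (D n x))" for n x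
  proof -
    have "cmod (f n x) \<le> cmod (f 0 x) + sqrt (S x) * (2 - 2 * (1 / 2) ^ n)"
    proof (induction n)
      case (Suc n)
      have "cmod (f (Suc n) x) \<le> cmod (f n x) + cmod (f (Suc n) x - f n x)"
        using norm_triangle_ineq[of "f n x" "f (Suc n) x - f n x"] by simp
      then show ?case
        using Suc step[OF x, of n] by (simp add: algebra_simps)
    qed simp
    also have "\<dots> \<le> G x"
      using mult_left_mono[of "2 - 2 * (1 / 2) ^ n" "2 :: real" "sqrt (S x)"] S0[OF x] by (simp add: G_def)
    finally show ?thesis .
  qed
  define g where "g x = lim (\<lambda>n. f n x)" for x
  have [measurable]: "g \<in> borel_measurable M"
    unfolding g_def by measurable
  have conv: "(\<lambda>n. f n x) \<longlonglongrightarrow> g x" if x: "summable (\<lambda>n. norm (D n x))" for x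
  proof -
    have "summable (\<lambda>n. f (Suc n) x - f n x)"
    proof (rule summable_comparison_test'[of _ 0])
      show "summable (\<lambda>n. sqrt (S x) * (1 / 2) ^ n)"
        by (intro summable_mult summable_geometric) simp
    qed (use step[OF x] in auto)
    then have "convergent (\<lambda>n. \<Sum>i<n. f (Suc i) x - f i x)"
      by (simp add: summable_iff_convergent)
    then have "convergent (\<lambda>n. f n x - f 0 x)"
      by (simp only: sum_lessThan_telescope[of "\<lambda>n. f n x"])
    then have "convergent (\<lambda>n. f n x)"
      using convergent_add[of "\<lambda>n. f n x - f 0 x" "\<lambda>_. f 0 x"] by (simp add: convergent_const)
    then show ?thesis
      by (simp add: g_def convergent_LIMSEQ_iff)
  qed
  have G_int: "integrable M (\<lambda>x. (G x)\<^sup>2)"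
  proof (rule Bochner_Integration.integrable_bound)
    show "integrable M (\<lambda>x. 2 * (cmod (f 0 x))\<^sup>2 + 8 * S x)"
      using si[of 0] S_int by (auto simp: square_integrable_def)
    show "(\<lambda>x. (G x)\<^sup>2) \<in> borel_measurable M"
      unfolding G_def using borel_measurable_integrable[OF S_int] by measurable
    have sq: "(a + 2 * b)\<^sup>2 \<le> 2 * a\<^sup>2 + 8 * b\<^sup>2" for a b :: real
      using zero_le_power2[of "a - 2 * b"] by (simp add: power2_eq_square algebra_simps)
    show "AE x in M. norm ((G x)\<^sup>2) \<le> norm (2 * (cmod (f 0 x))\<^sup>2 + 8 * S x)"
      using AE_sum
    proof eventually_elim
      case (elim x)
      then show ?case
        using sq[of "cmod (f 0 x)" "sqrt (S x)"] S0[OF elim] by (simp add: G_def)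
    qed
  qed
  have "integrable M (\<lambda>x. (cmod (g x))\<^sup>2)"
  proof (rule Bochner_Integration.integrable_bound[OF G_int])
    show "AE x in M. norm ((cmod (g x))\<^sup>2) \<le> norm ((G x)\<^sup>2)"
      using AE_sum
    proof eventually_elim
      case (elim x)
      have "cmod (g x) \<le> G x"
        by (rule tendsto_upperbound[OF tendsto_norm[OF conv[OF elim]]]) (use bound[OF elim] in auto)
      then show ?case by (auto intro: power_mono)
    qed
  qed measurable
  then have "square_integrable M g"
    by (simp add: square_integrable_def)
  then show thesis
    using G_int by (rule that) (use AE_sum conv bound in \<open>auto elim!: eventually_mono\<close>)
qed

lemma L2_limit_integrals:
  assumes si: "\<And>n. square_integrable M (f n)" and g: "square_integrable M g"
    and G: "integrable M (\<lambda>x. (G x :: real)\<^sup>2)"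
    and conv: "AE x in M. (\<lambda>n. f n x) \<longlonglongrightarrow> g x" and bound: "AE x in M. \<forall>n. cmod (f n x) \<le> G x"
  shows "square_integrable M h \<Longrightarrow> (\<lambda>n. LINT x|M. cnj (h x) * f n x) \<longlonglongrightarrow> (LINT x|M. cnj (h x) * g x)"
    and "(\<lambda>n. LINT x|M. (cmod (f n x))\<^sup>2) \<longlonglongrightarrow> (LINT x|M. (cmod (g x))\<^sup>2)"
proof -
  have [measurable]: "f n \<in> borel_measurable M" "g \<in> borel_measurable M" for n
    using si g by (simp_all add: square_integrable_def)
  show "(\<lambda>n. LINT x|M. (cmod (f n x))\<^sup>2) \<longlonglongrightarrow> (LINT x|M. (cmod (g x))\<^sup>2)"
  proof (rule integral_dominated_convergence[OF _ _ G])
    show "AE x in M. (\<lambda>n. (cmod (f n x))\<^sup>2) \<longlonglongrightarrow> (cmod (g x))\<^sup>2"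
      using conv by eventually_elim (intro tendsto_intros)
    show "AE x in M. norm ((cmod (f n x))\<^sup>2) \<le> (G x)\<^sup>2" for n
      using bound by eventually_elim (auto intro: power_mono)
  qed measurable
  assume h: "square_integrable M h"
  then have [measurable]: "h \<in> borel_measurable M"
    by (simp add: square_integrable_def)
  show "(\<lambda>n. LINT x|M. cnj (h x) * f n x) \<longlonglongrightarrow> (LINT x|M. cnj (h x) * g x)"
  proof (rule integral_dominated_convergence)
    show "integrable M (\<lambda>x. (cmod (h x))\<^sup>2 + (G x)\<^sup>2)"
      using h G by (simp add: square_integrable_def)
    show "AE x in M. (\<lambda>n. cnj (h x) * f n x) \<longlonglongrightarrow> cnj (h x) * g x"
      using conv by eventually_elim (intro tendsto_intros)
    show "AE x in M. norm (cnj (h x) * f n x) \<le> (cmod (h x))\<^sup>2 + (G x)\<^sup>2" for n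
      using bound
    proof eventually_elim
      case (elim x)
      then have "(cmod (f n x))\<^sup>2 \<le> (G x)\<^sup>2"
        by (auto intro: power_mono)
      then show ?case
        using norm_mult_le_squares[of "h x" "f n x"] by linarith
    qed
  qed measurable
qed

end

section \<open>The functions that realize the levels\<close>

locale nondegenerate_schur_weyl = schur_weyl k p q \<pi> U \<iota> + nondegenerate_walk k p q
  for k :: nat and p q :: "nat \<Rightarrow> real"
    and \<pi> :: "diagram \<Rightarrow> nat perm \<Rightarrow> (path \<Rightarrow> complex) \<Rightarrow> (path \<Rightarrow> complex)"
    and U :: "nat perm \<Rightarrow> 'h::chilbert_space \<Rightarrow> 'h"
    and \<iota> :: "nat \<Rightarrow> (path \<Rightarrow> complex) \<Rightarrow> 'h"
begin

abbreviation \<mu> :: "(nat \<Rightarrow> diagram) measure" where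
  "\<mu> \<equiv> spectral_measure k p"

text \<open>
  The function that realizes \<open>\<iota> j v\<close>: the basis vector of a tableau \<open>s\<close> becomes the indicator of the
  nice cylinder over \<open>s\<close>, divided by \<open>weight j s\<close> because the cylinder has the measure
  \<open>(weight j s)^2\<close>.
\<close>

definition level_fun :: "nat \<Rightarrow> (path \<Rightarrow> complex) \<Rightarrow> (nat \<Rightarrow> diagram) \<Rightarrow> complex" where
  "level_fun j v \<omega> = (let s = initial_segment \<omega> (k + 2 * j) in
     if \<omega> \<in> nice_after j then v s / of_real (weight j s) else 0)"

text \<open>
  A nice cylinder splits into the nice cylinders over the two extensions of its tableau. Passing to
  an extension multiplies both the coordinate and the weight by the same coefficient.
\<close>

lemma level_fun_lift: "level_fun (Suc j) (lift j v) = level_fun j v"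
proof
  fix \<omega>
  let ?s = "initial_segment \<omega> (k + 2 * Suc j)"
  have par: "parent j ?s = initial_segment \<omega> (k + 2 * j)"
    unfolding parent_def by (rule take_initial_segment) simp
  show "level_fun (Suc j) (lift j v) \<omega> = level_fun j v \<omega>"
  proof (cases "\<omega> \<in> nice_after (Suc j)")
    case True
    have s: "?s \<in> Tab (Suc j)"
      by (rule nice_after_segment[OF True order_refl])
    have "?s ! (k + 2 * j) = \<omega> (k + 2 * j)"
      by (rule initial_segment_nth) simp
    then have "coef j ?s = 0 \<longleftrightarrow> \<omega> \<notin> nice_after j"
      using coef_zero_iff[OF s] True by (auto simp: nice_after_def le_less_Suc_eq Suc_le_eq dest: le_neq_implies_less)
    with True show ?thesis
      by (auto simp: level_fun_def Let_def lift_def par simp del: mult_Suc_right)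
  next
    case False
    then have "\<omega> \<notin> nice_after j"
      using nice_after_mono[of j "Suc j"] by auto
    with False show ?thesis by (simp add: level_fun_def)
  qed
qed

lemma level_fun_expand:
  "level_fun j v \<omega> = (\<Sum>s\<in>Tab j. v s / of_real (weight j s) * indicator (nice_cylinder j s) \<omega>)"
proof (cases "\<omega> \<in> nice_after j")
  case True
  let ?s = "initial_segment \<omega> (k + 2 * j)"
  have "(\<Sum>s\<in>Tab j. v s / of_real (weight j s) * indicator (nice_cylinder j s) \<omega>) =
      (\<Sum>s\<in>Tab j. if s = ?s then v ?s / of_real (weight j ?s) else 0)"
    using True by (intro sum.cong) (auto simp: nice_cylinder_def indicator_def)
  then show ?thesis
    using True nice_after_segment[OF True order_refl] finite_Tab[of j]
    by (simp add: level_fun_def Let_def)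
next
  case False
  then show ?thesis
    by (simp add: level_fun_def nice_cylinder_def indicator_def)
qed

lemma nice_cylinder_sets [measurable]: "s \<in> Tab j \<Longrightarrow> nice_cylinder j s \<in> sets \<mu>"
  using nice_cylinder_in_sets by simp

lemma measure_nice_cylinder: "s \<in> Tab j \<Longrightarrow> measure \<mu> (nice_cylinder j s) = (weight j s)\<^sup>2"
  by (simp add: measure_def spectral_measure_nice_cylinder)

lemma integral_nice_cylinder:
  fixes c :: complex
  assumes "s \<in> Tab j"
  shows "integrable \<mu> (\<lambda>\<omega>. c * indicator (nice_cylinder j s) \<omega>)"
    and "(LINT \<omega>|\<mu>. c * indicator (nice_cylinder j s) \<omega>) = c * of_real ((weight j s)\<^sup>2)"
proof -
  have "has_bochner_integral \<mu> (\<lambda>\<omega>. indicator (nice_cylinder j s) \<omega> *\<^sub>R c)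
      (measure \<mu> (nice_cylinder j s) *\<^sub>R c)"
    using assms by (intro has_bochner_integral_indicator nice_cylinder_sets)
      (simp_all add: spectral_measure_nice_cylinder)
  also have "(\<lambda>\<omega>. indicator (nice_cylinder j s) \<omega> *\<^sub>R c) = (\<lambda>\<omega>. c * indicator (nice_cylinder j s) \<omega>)"
    by (auto simp: indicator_def)
  also have "measure \<mu> (nice_cylinder j s) *\<^sub>R c = c * of_real ((weight j s)\<^sup>2)"
    by (simp add: measure_nice_cylinder[OF assms] scaleR_conv_of_real)
  finally show "integrable \<mu> (\<lambda>\<omega>. c * indicator (nice_cylinder j s) \<omega>)"
    "(LINT \<omega>|\<mu>. c * indicator (nice_cylinder j s) \<omega>) = c * of_real ((weight j s)\<^sup>2)"
    by (simp_all add: has_bochner_integral_iff)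
qed

lemma level_fun_mult: "cnj (level_fun j v \<omega>) * level_fun j w \<omega> =
    (\<Sum>s\<in>Tab j. cnj (v s) * w s / of_real ((weight j s)\<^sup>2) * indicator (nice_cylinder j s) \<omega>)"
  using level_fun_expand[of j "\<lambda>s. cnj (v s) * w s / of_real (weight j s)" \<omega>]
  by (simp add: level_fun_def Let_def power2_eq_square split: if_splits)

lemma level_fun_inner:
  assumes "v \<in> vecs (Tab j)" "w \<in> vecs (Tab j)"
  shows "(LINT \<omega>|\<mu>. cnj (level_fun j v \<omega>) * level_fun j w \<omega>) = cinner (\<iota> j v) (\<iota> j w)"
proof -
  have "(LINT \<omega>|\<mu>. cnj (level_fun j v \<omega>) * level_fun j w \<omega>) =
      (\<Sum>s\<in>Tab j. cnj (v s) * w s / of_real ((weight j s)\<^sup>2) * of_real ((weight j s)\<^sup>2))"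
    unfolding level_fun_mult
    by (subst Bochner_Integration.integral_sum) (simp_all only: integral_nice_cylinder cong: sum.cong)
  also have "\<dots> = cinner (\<iota> j v) (\<iota> j w)"
    using weight_nonzero by (simp add: iota_inner[OF assms] vinner_def)
  finally show ?thesis .
qed

lemma square_integrable_level_fun: "square_integrable \<mu> (level_fun j v)"
proof -
  have "level_fun j v \<in> borel_measurable \<mu>"
    unfolding level_fun_expand[abs_def] by measurable
  moreover have "integrable \<mu> (\<lambda>\<omega>. (cmod (level_fun j v \<omega>))\<^sup>2)"
  proof -
    have "integrable \<mu> (\<lambda>\<omega>. cnj (level_fun j v \<omega>) * level_fun j v \<omega>)"
      unfolding level_fun_mult by (intro Bochner_Integration.integrable_sum integral_nice_cylinder)
    then have "integrable \<mu> (\<lambda>\<omega>. Re (cnj (level_fun j v \<omega>) * level_fun j v \<omega>))"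
      by (rule integrable_Re)
    then show ?thesis
      by (simp only: cmod_sq_eq_Re)
  qed
  ultimately show ?thesis
    by (simp add: square_integrable_def)
qed

lemma lift_iterate_level_fun:
  assumes "v \<in> vecs (Tab i)" "i \<le> j"
  obtains w where "w \<in> vecs (Tab j)" "\<iota> j w = \<iota> i v" "level_fun j w = level_fun i v"
  using assms(2)
proof (induction j arbitrary: thesis rule: dec_induct)
  case base
  with assms show ?case by blast
next
  case (step j)
  then show ?case
    using lift_in_vecs iota_lift level_fun_lift by metis
qed

lemma level_fun_inner_levels:
  assumes "v \<in> vecs (Tab i)" "w \<in> vecs (Tab j)"
  shows "(LINT \<omega>|\<mu>. cnj (level_fun i v \<omega>) * level_fun j w \<omega>) = cinner (\<iota> i v) (\<iota> j w)"
proof -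
  obtain v' where v': "v' \<in> vecs (Tab (max i j))" "\<iota> (max i j) v' = \<iota> i v" "level_fun (max i j) v' = level_fun i v"
    using lift_iterate_level_fun[OF assms(1), of "max i j"] by (metis max.cobounded1)
  obtain w' where w': "w' \<in> vecs (Tab (max i j))" "\<iota> (max i j) w' = \<iota> j w" "level_fun (max i j) w' = level_fun j w"
    using lift_iterate_level_fun[OF assms(2), of "max i j"] by (metis max.cobounded2)
  show ?thesis
    using level_fun_inner[OF v'(1) w'(1)] by (simp add: v' w')
qed

lemma level_fun_norm: "v \<in> vecs (Tab j) \<Longrightarrow> (LINT \<omega>|\<mu>. (cmod (level_fun j v \<omega>))\<^sup>2) = (norm (\<iota> j v))\<^sup>2"
proof -
  assume v: "v \<in> vecs (Tab j)"
  have "(LINT \<omega>|\<mu>. (cmod (level_fun j v \<omega>))\<^sup>2) = (LINT \<omega>|\<mu>. Re (cnj (level_fun j v \<omega>) * level_fun j v \<omega>))"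
    by (simp only: cmod_sq_eq_Re)
  also have "\<dots> = Re (LINT \<omega>|\<mu>. cnj (level_fun j v \<omega>) * level_fun j v \<omega>)"
    by (intro integral_Re square_integrable_mult square_integrable_level_fun)
  finally show ?thesis
    by (simp add: level_fun_inner[OF v v] norm_sq_eq_cinner)
qed

lemma level_fun_norm_levels:
  assumes "v \<in> vecs (Tab i)" "w \<in> vecs (Tab j)"
  shows "(LINT \<omega>|\<mu>. (cmod (level_fun i v \<omega> - level_fun j w \<omega>))\<^sup>2) = (norm (\<iota> i v - \<iota> j w))\<^sup>2"
  by (simp add: integral_norm_diff_sq square_integrable_level_fun level_fun_norm assms level_fun_inner_levels norm_diff_sq)

section \<open>Functions that represent a vector\<close>

text \<open>
  The condition for \<open>f\<close> to be the image of \<open>x\<close> under the unitary map. It only tests inner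
  products with vectors of the levels; it is linear in \<open>x\<close> and \<open>f\<close> and determines \<open>f\<close> almost everywhere by
  \<open>represents_unique\<close>.
\<close>

definition represents :: "'h \<Rightarrow> ((nat \<Rightarrow> diagram) \<Rightarrow> complex) \<Rightarrow> bool" where
  "represents x f \<longleftrightarrow> square_integrable \<mu> f \<and>
     (\<forall>j. \<forall>v\<in>vecs (Tab j). (LINT \<omega>|\<mu>. cnj (level_fun j v \<omega>) * f \<omega>) = cinner (\<iota> j v) x)"

lemma represents_add:
  assumes "represents x f" "represents y g"
  shows "represents (x + y) (\<lambda>\<omega>. f \<omega> + g \<omega>)"
  using assms square_integrable_mult[OF square_integrable_level_fun]
  by (auto simp: represents_def square_integrable_add distrib_left cinner_add_right)

lemma represents_scale: "represents x f \<Longrightarrow> represents (c *\<^sub>C x) (\<lambda>\<omega>. c * f \<omega>)"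
  by (auto simp: represents_def square_integrable_scale cinner_scaleC_right mult.left_commute[of _ c])

lemma represents_diff:
  assumes "represents x f" "represents y g"
  shows "represents (x - y) (\<lambda>\<omega>. f \<omega> - g \<omega>)"
  using represents_add[OF assms(1) represents_scale[OF assms(2), of "- 1"]] by (simp add: scaleC_minus1)

lemma level_fun_basis: "s \<in> Tab j \<Longrightarrow> level_fun j (basis s) \<omega> = indicator (nice_cylinder j s) \<omega> / of_real (weight j s)"
  by (auto simp: level_fun_def Let_def basis_def nice_cylinder_def indicator_def)

lemma represents_nice_cylinder:
  assumes "represents x f" "s \<in> Tab j"
  shows "(LINT \<omega>|\<mu>. indicator (nice_cylinder j s) \<omega> * f \<omega>) = of_real (weight j s) * cinner (level_vec j s) x"
proof -
  have "cinner (level_vec j s) x = (LINT \<omega>|\<mu>. cnj (level_fun j (basis s) \<omega>) * f \<omega>)"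
    using assms basis_in_vecs[OF assms(2)] by (auto simp: represents_def level_vec_def)
  also have "\<dots> = (LINT \<omega>|\<mu>. (1 / of_real (weight j s)) * (indicator (nice_cylinder j s) \<omega> * f \<omega>))"
    by (intro Bochner_Integration.integral_cong refl) (simp add: level_fun_basis[OF assms(2)] indicator_def)
  also have "\<dots> = (1 / of_real (weight j s)) * (LINT \<omega>|\<mu>. indicator (nice_cylinder j s) \<omega> * f \<omega>)"
    by (rule integral_mult_right_zero)
  finally show ?thesis
    using weight_nonzero[of j s] by simp
qed

lemma integrable_on_nice_cylinder:
  assumes "square_integrable \<mu> f" "s \<in> Tab j"
  shows "integrable \<mu> (\<lambda>\<omega>. indicator (nice_cylinder j s) \<omega> * f \<omega>)"
proof -
  have "integrable \<mu> (\<lambda>\<omega>. of_real (weight j s) * (cnj (level_fun j (basis s) \<omega>) * f \<omega>))"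
    by (intro integrable_mult_right square_integrable_mult square_integrable_level_fun assms)
  also have "(\<lambda>\<omega>. of_real (weight j s) * (cnj (level_fun j (basis s) \<omega>) * f \<omega>)) =
      (\<lambda>\<omega>. indicator (nice_cylinder j s) \<omega> * f \<omega>)"
    using weight_nonzero[of j s] by (auto simp: level_fun_basis[OF assms(2)] indicator_def)
  finally show ?thesis .
qed

text \<open>
  Two nice cylinders are nested or disjoint, and inside a nice cylinder they generate the
  \<open>\<sigma>\<close>-algebra. So the integral of \<open>f\<close> vanishes over every measurable subset.
\<close>

lemma zero_on_nice_cylinder:
  assumes f: "square_integrable \<mu> f" and s: "s \<in> Tab j"
    and zero: "\<And>i u. j \<le> i \<Longrightarrow> u \<in> Tab i \<Longrightarrow> nice_cylinder i u \<subseteq> nice_cylinder j s \<Longrightarrow>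
      (LINT \<omega>|\<mu>. indicator (nice_cylinder i u) \<omega> * f \<omega>) = 0"
  shows "AE \<omega> in \<mu>. \<omega> \<in> nice_cylinder j s \<longrightarrow> f \<omega> = 0"
proof -
  let ?A = "nice_cylinder j s"
  define G where "G = insert {} {nice_cylinder i u | i u. j \<le> i \<and> u \<in> Tab i \<and> nice_cylinder i u \<subseteq> ?A}"
  have A: "?A \<in> sets \<mu>" "?A \<subseteq> infinite_tableaux"
    using nice_cylinder_sets[OF s] sets.sets_into_space[of ?A \<mu>] by (auto simp only: space_spectral_measure)
  have G_Pow: "G \<subseteq> Pow ?A"
    by (auto simp: G_def)
  have AG: "?A \<in> G"
    unfolding G_def using s by blast
  have Int: "Int_stable G"
  proof (rule Int_stableI)
    have nested: "a \<inter> b \<in> G" if "a = nice_cylinder i u" "b = nice_cylinder i' u'" "i \<le> i'" "a \<in> G" "b \<in> G"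
      for a b i i' u u'
    proof (cases "a \<inter> b = {}")
      case False
      then have "b \<subseteq> a"
        using nice_cylinder_nested[of i i' _ u u'] that by blast
      with that show ?thesis by (simp add: Int_absorb1)
    qed (simp add: G_def)
    fix a b assume ab: "a \<in> G" "b \<in> G"
    show "a \<inter> b \<in> G"
    proof (cases "a = {} \<or> b = {}")
      case False
      then obtain i u i' u' where "a = nice_cylinder i u" "b = nice_cylinder i' u'"
        using ab by (auto simp: G_def)
      then show ?thesis
        using nested[of a i u b i' u'] nested[of b i' u' a i u] ab by (cases "i \<le> i'") (auto simp: Int_commute)
    qed (auto simp: G_def)
  qed
  have G_sets: "sigma_sets ?A G \<subseteq> sets \<mu>"
  proof
    fix B assume "B \<in> sigma_sets ?A G"
    then show "B \<in> sets \<mu>"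
    proof induction
      case (Basic B)
      then show ?case by (auto simp: G_def intro: nice_cylinder_in_sets)
    qed (use A in auto)
  qed
  have int: "integrable \<mu> (\<lambda>\<omega>. indicator B \<omega> * f \<omega>)" if "B \<in> sets \<mu>" "B \<subseteq> ?A" for B
  proof -
    have "(\<lambda>\<omega>. indicator B \<omega> * f \<omega>) = (\<lambda>\<omega>. indicator B \<omega> *\<^sub>R (indicator ?A \<omega> * f \<omega>))"
      using that(2) by (auto simp: fun_eq_iff indicator_def)
    then show ?thesis
      using integrable_mult_indicator[OF that(1) integrable_on_nice_cylinder[OF f s]] by simp
  qed
  have zeroG: "(LINT \<omega>|\<mu>. indicator B \<omega> * f \<omega>) = 0" if "B \<in> G" for B
    using that zero by (auto simp: G_def)
  have zeroS: "(LINT \<omega>|\<mu>. indicator B \<omega> * f \<omega>) = 0" if "B \<in> sigma_sets ?A G" for B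
    using Int G_Pow that
  proof (induction rule: sigma_sets_induct_disjoint)
    case (basic B)
    then show ?case by (rule zeroG)
  next
    case empty
    show ?case by simp
  next
    case (compl B)
    have B: "B \<in> sets \<mu>" "B \<subseteq> ?A"
      using compl(1) G_sets sigma_sets_into_sp[OF G_Pow] by auto
    have "(\<lambda>\<omega>. indicator (?A - B) \<omega> * f \<omega>) = (\<lambda>\<omega>. indicator ?A \<omega> * f \<omega> - indicator B \<omega> * f \<omega>)"
      using B(2) by (auto simp: fun_eq_iff indicator_def)
    then show ?case
      using zeroG[OF AG] compl(2) int[OF A(1)] int[OF B] by simp
  next
    case (union B)
    have B: "B i \<in> sets \<mu>" "B i \<subseteq> ?A" for i
      using union(2) G_sets sigma_sets_into_sp[OF G_Pow] by auto
    have lebesgue: "set_lebesgue_integral \<mu> C f = (LINT \<omega>|\<mu>. indicator C \<omega> * f \<omega>)" for C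
      unfolding set_lebesgue_integral_def by (intro Bochner_Integration.integral_cong) (auto simp: indicator_def)
    have "set_integrable \<mu> (\<Union>i. B i) f"
    proof -
      have "integrable \<mu> (\<lambda>\<omega>. indicator (\<Union>i. B i) \<omega> * f \<omega>)"
        by (rule int) (use B in auto)
      then show ?thesis
        unfolding set_integrable_def by (rule Bochner_Integration.integrable_cong[THEN iffD1, rotated -1]) (auto simp: indicator_def)
    qed
    then have "(LINT \<omega>|\<mu>. indicator (\<Union>i. B i) \<omega> * f \<omega>) = suminf (\<lambda>i. LINT \<omega>|\<mu>. indicator (B i) \<omega> * f \<omega>)"
      unfolding lebesgue[symmetric]
      by (intro lebesgue_integral_countable_add) (use B union(1) in \<open>auto simp: disjoint_family_on_def\<close>)
    then show ?case
      using union(3) by simp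
  qed
  have restrict: "B \<inter> ?A \<in> sigma_sets ?A G" if "B \<in> sets \<mu>" for B
  proof -
    have "(\<inter>) ?A ` sigma_sets infinite_tableaux (range cylinder) = sigma_sets ?A ((\<inter>) ?A ` range cylinder)"
      using A cylinder_subset by (intro sigma_sets_Int) (auto simp: tableau_space_def)
    also have "\<dots> \<subseteq> sigma_sets ?A G"
    proof (rule sigma_sets_mono)
      show "(\<inter>) ?A ` range cylinder \<subseteq> sigma_sets ?A G"
      proof
        fix C assume "C \<in> (\<inter>) ?A ` range cylinder"
        then obtain c where C: "C = ?A \<inter> cylinder c" by blast
        \<comment> \<open>level \<open>i\<close> is high enough for its tableaux to decide the membership in the cylinder\<close>
        define i where "i = max j (cells c)"
        let ?V = "{u \<in> Tab i. nice_cylinder i u \<subseteq> C}"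
        have "C = (\<Union>u\<in>?V. nice_cylinder i u)"
        proof (intro equalityI subsetI)
          fix \<omega> assume \<omega>: "\<omega> \<in> C"
          then have "\<omega> \<in> nice_after j"
            by (simp add: C nice_cylinder_def)
          let ?u = "initial_segment \<omega> (k + 2 * i)"
          have u: "?u \<in> Tab i" "\<omega> \<in> nice_cylinder i ?u"
            using nice_after_segment[OF \<open>\<omega> \<in> nice_after j\<close>, of i] nice_after_mono[of j i]
              nice_cylinder_mem[of \<omega> i] \<open>\<omega> \<in> nice_after j\<close> by (auto simp: i_def)
          have "nice_cylinder i ?u \<subseteq> ?A"
            using \<omega> u(2) by (intro nice_cylinder_nested[of j i \<omega>]) (auto simp: C i_def)
          moreover have "nice_cylinder i ?u \<subseteq> cylinder c"
          proof
            fix \<omega>' assume "\<omega>' \<in> nice_cylinder i ?u"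
            then have "\<omega>' \<in> infinite_tableaux" "initial_segment \<omega>' (k + 2 * i) = ?u"
              by (auto simp: nice_cylinder_def nice_after_def)
            moreover have "cells c \<le> k + 2 * i"
              by (simp add: i_def)
            ultimately show "\<omega>' \<in> cylinder c"
              using \<omega> by (auto simp: C cylinder_def initial_segment_eq_iff)
                (metis initial_segment_eq_iff order_trans)
          qed
          ultimately show "\<omega> \<in> (\<Union>u\<in>?V. nice_cylinder i u)"
            using u by (auto simp: C)
        qed auto
        also have "\<dots> \<in> sigma_sets ?A G"
        proof (rule sigma_sets_UNION)
          show "countable (nice_cylinder i ` ?V)"
            using finite_Tab[of i] by (intro countable_finite) auto
          show "b \<in> sigma_sets ?A G" if "b \<in> nice_cylinder i ` ?V" for b
            using that by (intro sigma_sets.Basic) (auto simp: G_def C i_def)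
        qed
        finally show "C \<in> sigma_sets ?A G" .
      qed
    qed
    finally have sub: "(\<inter>) ?A ` sigma_sets infinite_tableaux (range cylinder) \<subseteq> sigma_sets ?A G" .
    have "B \<in> sigma_sets infinite_tableaux (range cylinder)"
      using that cylinder_subset by (simp add: tableau_space_def sets_measure_of)
    then have "?A \<inter> B \<in> (\<inter>) ?A ` sigma_sets infinite_tableaux (range cylinder)"
      by blast
    with sub show ?thesis
      by (metis Int_commute subsetD)
  qed
  interpret sigma_finite_measure \<mu>
    by (rule sigma_finite_spectral_measure)
  have "AE \<omega> in \<mu>. indicator ?A \<omega> * f \<omega> = 0"
  proof (rule density_zero[OF integrable_on_nice_cylinder[OF f s]])
    fix B assume B: "B \<in> sets \<mu>"
    have "(\<lambda>\<omega>. indicator B \<omega> *\<^sub>R (indicator ?A \<omega> * f \<omega>)) = (\<lambda>\<omega>. indicator (B \<inter> ?A) \<omega> * f \<omega>)"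
      by (auto simp: indicator_def)
    then show "set_lebesgue_integral \<mu> B (\<lambda>\<omega>. indicator ?A \<omega> * f \<omega>) = 0"
      unfolding set_lebesgue_integral_def using zeroS[OF restrict[OF B]] by simp
  qed
  then show ?thesis
    by eventually_elim (auto simp: indicator_def)
qed

text \<open>
  There are countably many nice cylinders, and those of the levels from \<open>J\<close> on cover almost the whole
  space.
\<close>

lemma AE_on_nice_cylinders:
  assumes "\<And>j s. J \<le> j \<Longrightarrow> s \<in> Tab j \<Longrightarrow> AE \<omega> in \<mu>. \<omega> \<in> nice_cylinder j s \<longrightarrow> P \<omega>"
  shows "AE \<omega> in \<mu>. P \<omega>"
proof -
  have "AE \<omega> in \<mu>. \<forall>j\<in>{J..}. \<forall>s\<in>Tab j. \<omega> \<in> nice_cylinder j s \<longrightarrow> P \<omega>"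
    unfolding AE_ball_countable[OF countableI_type] AE_ball_countable[OF countable_finite[OF finite_Tab]]
    using assms by blast
  then show ?thesis
    using spectral_measure_AE_nice
  proof eventually_elim
    case (elim \<omega>)
    then obtain j where "\<omega> \<in> nice_after (max J j)"
      using nice_after_mono[of _ "max J _"] by (metis max.cobounded2 subsetD)
    then show ?case
      using elim(1) nice_cylinder_mem nice_after_segment by (meson atLeast_iff max.cobounded1 order_refl)
  qed
qed

lemma represents_zero_AE:
  assumes "represents 0 f"
  shows "AE \<omega> in \<mu>. f \<omega> = 0"
proof (rule AE_on_nice_cylinders[of 0])
  fix j s assume s: "s \<in> Tab j"
  show "AE \<omega> in \<mu>. \<omega> \<in> nice_cylinder j s \<longrightarrow> f \<omega> = 0"
    by (rule zero_on_nice_cylinder[OF _ s])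
      (use assms represents_nice_cylinder[OF assms] in \<open>auto simp: represents_def\<close>)
qed

lemma represents_unique:
  assumes "represents x f" "represents x g"
  shows "AE \<omega> in \<mu>. f \<omega> = g \<omega>"
  using represents_zero_AE[of "\<lambda>\<omega>. f \<omega> - g \<omega>"] represents_diff[OF assms] by simp

end

section \<open>The unitary map and the action of the Gelfand-Tsetlin algebra\<close>

context schur_weyl
begin

lemma approx_by_levels: "\<epsilon> > 0 \<Longrightarrow> \<exists>j. \<exists>v\<in>vecs (Tab j). dist (\<iota> j v) x < \<epsilon>"
proof -
  assume "\<epsilon> > 0"
  moreover have "x \<in> closure (\<Union>j. \<iota> j ` vecs (Tab j))"
    using iota_dense by simp
  ultimately show ?thesis
    by (force simp: closure_approachable)
qed

text \<open>
  A Gelfand-Tsetlin element also multiplies the coordinates of vectors outside the level: the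
  component of \<open>x\<close> orthogonal to level \<open>j\<close> stays orthogonal to it, because the symmetric group of
  degree \<open>k + 2 * j\<close> acts by unitary operators and preserves the level.
\<close>

lemma cinner_level_vec_ga_act:
  assumes a: "a \<in> gelfand_tsetlin" "a \<in> sym_algebra (k + 2 * j)"
    and s: "s \<in> Tab j" and c: "ga_act U a (level_vec j s) = c *\<^sub>C level_vec j s"
  shows "cinner (level_vec j s) (ga_act U a x) = c * cinner (level_vec j s) x"
proof -
  \<comment> \<open>\<open>\<iota> j w\<close> is the orthogonal projection of \<open>x\<close> to level \<open>j\<close>\<close>
  define w where "w t = (if t \<in> Tab j then cinner (level_vec j t) x else 0)" for t
  have w: "w \<in> vecs (Tab j)"
    by (auto simp: w_def vecs_def)
  define z where "z = x - \<iota> j w"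
  have z: "cinner (\<iota> j v) z = 0" if "v \<in> vecs (Tab j)" for v
  proof -
    have 0: "cinner (level_vec j t) z = 0" if "t \<in> Tab j" for t
      using that by (simp add: z_def cinner_diff_right cinner_level_vec_iota[OF that w] w_def)
    have "cinner z (\<iota> j v) = (\<Sum>t\<in>Tab j. v t * cinner z (level_vec j t))"
      by (simp add: iota_expand[OF that] cinner_sum_right cinner_scaleC_right)
    also have "\<dots> = 0"
      using 0 by (intro sum.neutral) (metis cinner_commute complex_cnj_zero mult_zero_right)
    finally show ?thesis
      by (metis cinner_commute complex_cnj_zero)
  qed
  have "cinner (level_vec j s) (U \<sigma> z) = 0" if "\<sigma> \<in> Poly_Mapping.keys a" for \<sigma>
  proof -
    have \<sigma>: "inverse \<sigma> \<in> sym_group (k + 2 * j)"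
      using a(2) that by (auto simp: sym_algebra_def intro: inverse_in_sym_group)
    then have "\<pi> (two_row (k + j) j) (inverse \<sigma>) (basis s) \<in> vecs (Tab j)"
      using young_rep_in_vecs[OF young_level _ basis_in_vecs[OF s]] by (simp add: mult_2 add.assoc)
    then show ?thesis
      unfolding unitary_rep_adjoint[OF U] using z \<sigma>
      by (simp add: level_vec_def iota_equivariant basis_in_vecs s)
  qed
  then have 1: "cinner (level_vec j s) (ga_act U a z) = 0"
    unfolding ga_act_def by (simp add: cinner_sum_right cinner_scaleC_right)
  obtain f where f: "\<And>t. t \<in> Tab j \<Longrightarrow> ga_act U a (level_vec j t) = f t *\<^sub>C level_vec j t"
  proof -
    have "\<forall>t\<in>Tab j. \<exists>c. ga_act U a (level_vec j t) = c *\<^sub>C level_vec j t"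
      by (meson gelfand_tsetlin_eigenvector[OF a])
    with that show thesis by (metis bchoice)
  qed
  have fw: "(\<lambda>t. f t * w t) \<in> vecs (Tab j)"
    using w by (auto simp: vecs_def)
  have "f s = c"
    using f[OF s] c cinner_level_vec[OF s s] by (metis cinner_scaleC_right mult.right_neutral)
  have "ga_act U a (\<iota> j w) = \<iota> j (\<lambda>t. f t * w t)"
    by (rule ga_act_diagonal[OF f w])
  then have 2: "cinner (level_vec j s) (ga_act U a (\<iota> j w)) = c * cinner (level_vec j s) x"
    using cinner_level_vec_iota[OF s fw] s \<open>f s = c\<close> by (simp only:) (simp add: w_def)
  have "x = \<iota> j w + z"
    by (simp add: z_def)
  then have "ga_act U a x = ga_act U a (\<iota> j w) + ga_act U a z"
    by (metis ga_act_add_right[OF U])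
  then show ?thesis
    by (simp add: cinner_add_right 1 2)
qed

end

context nondegenerate_schur_weyl
begin

text \<open>
  The functions of a fast sequence of vectors of the levels converge, since vectors of the levels are
  mapped isometrically to their functions.
\<close>

lemma represents_exists:
  obtains f where "represents x f" "(LINT \<omega>|\<mu>. (cmod (f \<omega>))\<^sup>2) = (norm x)\<^sup>2"
proof -
  \<comment> \<open>consecutive approximations then differ by at most \<open>(1 / 3) ^ n\<close>, whose square is below \<open>(1 / 8) ^ n\<close>\<close>
  have "\<forall>n. \<exists>j. \<exists>v\<in>vecs (Tab j). dist (\<iota> j v) x < (1 / 3) ^ n / 2"
    by (intro allI approx_by_levels) simp
  then obtain j v where v: "\<And>n. v n \<in> vecs (Tab (j n))"
    and close: "\<And>n. dist (\<iota> (j n) (v n)) x < (1 / 3) ^ n / 2"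
    by metis
  define y where "y n = \<iota> (j n) (v n)" for n
  define f where "f n = level_fun (j n) (v n)" for n
  have si: "square_integrable \<mu> (f n)" for n
    by (simp add: f_def square_integrable_level_fun)
  have "(LINT \<omega>|\<mu>. (cmod (f (Suc n) \<omega> - f n \<omega>))\<^sup>2) \<le> (1 / 8) ^ n" for n
  proof -
    have "norm (y (Suc n) - y n) \<le> dist (y (Suc n)) x + dist (y n) x"
      using dist_triangle2[of "y (Suc n)" "y n" x] by (simp add: dist_norm)
    also have "\<dots> \<le> (1 / 3) ^ n"
      using close[of n] close[of "Suc n"] zero_le_power[of "1 / 3 :: real" n]
      unfolding y_def power_Suc by linarith
    finally have "(norm (y (Suc n) - y n))\<^sup>2 \<le> ((1 / 3) ^ n)\<^sup>2"
      by (intro power_mono) auto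
    also have "\<dots> = (1 / 9) ^ n"
      by (simp add: power2_eq_square flip: power_mult_distrib)
    also have "\<dots> \<le> (1 / 8 :: real) ^ n"
      by (intro power_mono) auto
    finally show ?thesis
      by (simp add: f_def y_def level_fun_norm_levels v)
  qed
  from L2_limit[OF si this] obtain g G where g: "square_integrable \<mu> g"
    and G: "integrable \<mu> (\<lambda>x. (G x :: real)\<^sup>2)"
      "AE \<omega> in \<mu>. (\<lambda>n. f n \<omega>) \<longlonglongrightarrow> g \<omega>" "AE \<omega> in \<mu>. \<forall>n. cmod (f n \<omega>) \<le> G \<omega>"
    by blast
  note limits = L2_limit_integrals[OF si g G]
  have "(\<lambda>n. (1 / 3 :: real) ^ n / 2) \<longlonglongrightarrow> 0 / 2"
    by (intro tendsto_intros) auto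
  then have "(\<lambda>n. dist (y n) x) \<longlonglongrightarrow> 0"
    by (intro Lim_null_comparison[of "\<lambda>n. dist (y n) x" "\<lambda>n. (1 / 3 :: real) ^ n / 2"])
      (use close[THEN less_imp_le] in \<open>simp_all add: y_def\<close>)
  then have y: "y \<longlonglongrightarrow> x"
    by (rule tendsto_dist_iff[THEN iffD2])
  have "(LINT \<omega>|\<mu>. cnj (level_fun i w \<omega>) * g \<omega>) = cinner (\<iota> i w) x" if w: "w \<in> vecs (Tab i)" for i w
  proof -
    have "(\<lambda>n. cinner (\<iota> i w) (y n)) \<longlonglongrightarrow> (LINT \<omega>|\<mu>. cnj (level_fun i w \<omega>) * g \<omega>)"
      using limits(1)[OF square_integrable_level_fun[of i w]] by (simp add: f_def y_def level_fun_inner_levels w v)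
    moreover have "(\<lambda>n. cinner (\<iota> i w) (y n)) \<longlonglongrightarrow> cinner (\<iota> i w) x"
      by (intro tendsto_cinner tendsto_const y)
    ultimately show ?thesis
      by (rule LIMSEQ_unique)
  qed
  then have "represents x g"
    using g by (simp add: represents_def)
  moreover have "(LINT \<omega>|\<mu>. (cmod (g \<omega>))\<^sup>2) = (norm x)\<^sup>2"
  proof (rule LIMSEQ_unique[OF limits(2)])
    have "(LINT \<omega>|\<mu>. (cmod (f n \<omega>))\<^sup>2) = (norm (y n))\<^sup>2" for n
      by (simp add: f_def y_def level_fun_norm v)
    then show "(\<lambda>n. LINT \<omega>|\<mu>. (cmod (f n \<omega>))\<^sup>2) \<longlonglongrightarrow> (norm x)\<^sup>2"
      using y by (simp add: tendsto_norm tendsto_power)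
  qed
  ultimately show thesis by (rule that)
qed

lemma represents_norm:
  assumes "represents x f"
  shows "(LINT \<omega>|\<mu>. (cmod (f \<omega>))\<^sup>2) = (norm x)\<^sup>2"
proof -
  obtain g where g: "represents x g" "(LINT \<omega>|\<mu>. (cmod (g \<omega>))\<^sup>2) = (norm x)\<^sup>2"
    by (rule represents_exists)
  have [measurable]: "f \<in> borel_measurable \<mu>" "g \<in> borel_measurable \<mu>"
    using assms g(1) by (auto simp: represents_def square_integrable_def)
  have "(LINT \<omega>|\<mu>. (cmod (f \<omega>))\<^sup>2) = (LINT \<omega>|\<mu>. (cmod (g \<omega>))\<^sup>2)"
  proof (rule integral_cong_AE)
    show "AE \<omega> in \<mu>. (cmod (f \<omega>))\<^sup>2 = (cmod (g \<omega>))\<^sup>2"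
      using represents_unique[OF assms g(1)] by eventually_elim simp
  qed measurable
  with g(2) show ?thesis by simp
qed

text \<open>
  By polarization, from the equality of the norms for \<open>x + y\<close> and \<open>x + \<i> y\<close>.
\<close>

lemma represents_inner:
  assumes f: "represents x f" and g: "represents y g"
  shows "(LINT \<omega>|\<mu>. cnj (f \<omega>) * g \<omega>) = cinner x y"
proof (rule complex_eqI)
  have si: "square_integrable \<mu> f" "square_integrable \<mu> g"
    using assms by (auto simp: represents_def)
  have Re: "Re (LINT \<omega>|\<mu>. cnj (f \<omega>) * h \<omega>) = Re (cinner x z)" if h: "represents z h" for z h
  proof -
    have "square_integrable \<mu> h"
      using h by (simp add: represents_def)
    from integral_norm_add_sq[OF si(1) this] show ?thesis
      using represents_norm[OF f] represents_norm[OF h] represents_norm[OF represents_add[OF f h]]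
        norm_add_sq[of x z] by simp
  qed
  show "Re (LINT \<omega>|\<mu>. cnj (f \<omega>) * g \<omega>) = Re (cinner x y)"
    by (rule Re[OF g])
  have "(LINT \<omega>|\<mu>. cnj (f \<omega>) * (\<i> * g \<omega>)) = \<i> * (LINT \<omega>|\<mu>. cnj (f \<omega>) * g \<omega>)"
    by (simp add: mult.left_commute)
  with Re[OF represents_scale[OF g, of \<i>]] show "Im (LINT \<omega>|\<mu>. cnj (f \<omega>) * g \<omega>) = Im (cinner x y)"
    by (simp add: cinner_scaleC_right)
qed

text \<open>
  The vector is the limit of the projections \<open>y j\<close> of \<open>f\<close> to the levels. They form a martingale:
  \<open>|y i - y j|^2 = |y j|^2 - |y i|^2\<close> for \<open>i \<le> j\<close>, and their norms increase and are bounded by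
  the norm of \<open>f\<close>.
\<close>

lemma represents_surjective:
  assumes f: "square_integrable \<mu> f"
  obtains x where "represents x f"
proof -
  define w where "w j s = (if s \<in> Tab j then LINT \<omega>|\<mu>. cnj (level_fun j (basis s) \<omega>) * f \<omega> else 0)" for j s
  define y where "y j = \<iota> j (w j)" for j
  have w: "w j \<in> vecs (Tab j)" for j
    by (auto simp: w_def vecs_def)
  have same: "cinner (\<iota> j v) (y j) = (LINT \<omega>|\<mu>. cnj (level_fun j v \<omega>) * f \<omega>)" if v: "v \<in> vecs (Tab j)" for j v
  proof -
    have "cnj (level_fun j v \<omega>) * f \<omega> = (\<Sum>s\<in>Tab j. cnj (v s) * (cnj (level_fun j (basis s) \<omega>) * f \<omega>))" for \<omega>
      by (simp add: level_fun_expand[of j v] level_fun_basis sum_distrib_right sum_distrib_left indicator_def mult.assoc)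
    then have "(LINT \<omega>|\<mu>. cnj (level_fun j v \<omega>) * f \<omega>) =
        (\<Sum>s\<in>Tab j. cnj (v s) * (LINT \<omega>|\<mu>. cnj (level_fun j (basis s) \<omega>) * f \<omega>))"
      using square_integrable_mult[OF square_integrable_level_fun f] by simp
    also have "\<dots> = (\<Sum>s\<in>Tab j. cnj (v s) * w j s)"
      by (intro sum.cong) (auto simp: w_def)
    finally show ?thesis
      using iota_inner[OF v w] by (simp add: y_def vinner_def)
  qed
  have later: "cinner (\<iota> i v) (y j) = (LINT \<omega>|\<mu>. cnj (level_fun i v \<omega>) * f \<omega>)"
    if v: "v \<in> vecs (Tab i)" and "i \<le> j" for i j v
  proof -
    obtain v' where "v' \<in> vecs (Tab j)" "\<iota> j v' = \<iota> i v" "level_fun j v' = level_fun i v"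
      using lift_iterate_level_fun[OF v \<open>i \<le> j\<close>] by blast
    with same[of v' j] show ?thesis by simp
  qed
  have inner: "cinner (y i) (y j) = cinner (y i) (y i)" if "i \<le> j" for i j
    using later[OF w that] later[OF w order_refl, of i] by (simp add: y_def)
  have dist: "(norm (y i - y j))\<^sup>2 = (norm (y j))\<^sup>2 - (norm (y i))\<^sup>2" if "i \<le> j" for i j
    unfolding norm_diff_sq using inner[OF that] by (simp add: norm_sq_eq_cinner)
  have bound: "(norm (y j))\<^sup>2 \<le> (LINT \<omega>|\<mu>. (cmod (f \<omega>))\<^sup>2)" for j
  proof -
    have "(LINT \<omega>|\<mu>. (cmod (level_fun j (w j) \<omega>))\<^sup>2) = (norm (y j))\<^sup>2"
      by (simp add: y_def level_fun_norm w)
    moreover have "0 \<le> (LINT \<omega>|\<mu>. (cmod (level_fun j (w j) \<omega> - f \<omega>))\<^sup>2)"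
      by (rule integral_nonneg_AE) simp
    ultimately show ?thesis
      using integral_norm_diff_sq[OF square_integrable_level_fun f, of j "w j"] same[OF w, of j]
      by (simp add: y_def norm_sq_eq_cinner)
  qed
  have "incseq (\<lambda>j. (norm (y j))\<^sup>2)"
  proof (rule incseq_SucI)
    show "(norm (y j))\<^sup>2 \<le> (norm (y (Suc j)))\<^sup>2" for j
      using dist[of j "Suc j"] zero_le_power2[of "norm (y j - y (Suc j))"] by simp
  qed
  then have "Cauchy (\<lambda>j. (norm (y j))\<^sup>2)"
    using bound by (intro convergent_Cauchy) (metis incseq_convergent convergentI)
  have "Cauchy y"
  proof (rule metric_CauchyI)
    fix \<epsilon> :: real assume "\<epsilon> > 0"
    then obtain N where N: "\<And>m n. m \<ge> N \<Longrightarrow> n \<ge> N \<Longrightarrow> dist ((norm (y m))\<^sup>2) ((norm (y n))\<^sup>2) < \<epsilon>\<^sup>2"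
      using metric_CauchyD[OF \<open>Cauchy (\<lambda>j. (norm (y j))\<^sup>2)\<close>, of "\<epsilon>\<^sup>2"] by auto
    have close: "dist (y m) (y n) < \<epsilon>" if "m \<ge> N" "n \<ge> N" "m \<le> n" for m n
    proof -
      have "(norm (y m - y n))\<^sup>2 < \<epsilon>\<^sup>2"
        using dist[OF that(3)] N[OF that(1,2)] by (simp add: dist_real_def)
      then show ?thesis
        using \<open>\<epsilon> > 0\<close> by (simp add: dist_norm power2_less_imp_less)
    qed
    have "dist (y m) (y n) < \<epsilon>" if "m \<ge> N" "n \<ge> N" for m n
      using close[of m n] close[of n m] that by (cases "m \<le> n") (auto simp: dist_commute)
    then show "\<exists>N. \<forall>m\<ge>N. \<forall>n\<ge>N. dist (y m) (y n) < \<epsilon>" by blast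
  qed
  then obtain x where x: "y \<longlonglongrightarrow> x"
    using Cauchy_convergent convergent_def by blast
  have "(LINT \<omega>|\<mu>. cnj (level_fun i v \<omega>) * f \<omega>) = cinner (\<iota> i v) x" if v: "v \<in> vecs (Tab i)" for i v
  proof (rule LIMSEQ_unique)
    show "(\<lambda>j. cinner (\<iota> i v) (y j)) \<longlonglongrightarrow> cinner (\<iota> i v) x"
      by (intro tendsto_cinner tendsto_const x)
    show "(\<lambda>j. cinner (\<iota> i v) (y j)) \<longlonglongrightarrow> (LINT \<omega>|\<mu>. cnj (level_fun i v \<omega>) * f \<omega>)"
      by (rule tendsto_eventually) (use later[OF v] in \<open>auto simp: eventually_sequentially\<close>)
  qed
  then have "represents x f"
    using f by (simp add: represents_def)
  then show thesis by (rule that)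
qed

lemma gt_eigenvalue_nice_cylinder:
  assumes a: "a \<in> sym_algebra (k + 2 * j)" and s: "s \<in> Tab j"
    and c: "ga_act U a (level_vec j s) = c *\<^sub>C level_vec j s" and \<omega>: "\<omega> \<in> nice_cylinder j s"
  shows "gt_eigenvalue \<pi> a \<omega> c"
  unfolding gt_eigenvalue_def
proof (intro allI impI)
  fix N assume N: "a \<in> sym_algebra N"
  define m where "m = max j N"
  let ?u = "initial_segment \<omega> (k + 2 * m)"
  have u: "?u \<in> Tab m"
    using \<omega> by (intro nice_after_segment[of \<omega> j]) (auto simp: nice_cylinder_def m_def)
  have "take (Suc (k + 2 * j)) ?u = s"
    using \<omega> by (subst take_initial_segment) (auto simp: nice_cylinder_def m_def)
  then have "ga_act U a (level_vec m ?u) = c *\<^sub>C level_vec m ?u"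
    using eigenvalue_later_level[OF a u, of c] s c by (simp add: m_def)
  then show "ga_act_vec (\<pi> (\<omega> N)) a (basis (initial_segment \<omega> N)) =
      (\<lambda>s. c * basis (initial_segment \<omega> N) s)"
    using eigenvalue_initial_part[OF N _ u, of c] take_initial_segment[of N "k + 2 * m" \<omega>]
      initial_segment_nth[of N "k + 2 * m" \<omega>] by (simp add: m_def)
qed

text \<open>
  On a nice cylinder of a level on which \<open>a\<close> acts, the eigenvalue of \<open>a\<close> is constant, and both
  functions have the same integrals over the smaller nice cylinders.
\<close>

lemma represents_ga_act:
  assumes a: "a \<in> gelfand_tsetlin" and f: "represents x f" and g: "represents (ga_act U a x) g"
  shows "AE \<omega> in \<mu>. \<exists>c. gt_eigenvalue \<pi> a \<omega> c \<and> g \<omega> = c * f \<omega>"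
proof -
  have "finite (\<Union>\<sigma>\<in>Poly_Mapping.keys a. affected \<sigma>)"
    by simp
  \<comment> \<open>\<open>a\<close> involves only finitely many numbers, so it lies in the group algebras of all high levels\<close>
  then obtain J where J: "(\<Union>\<sigma>\<in>Poly_Mapping.keys a. affected \<sigma>) \<subseteq> {..<J}"
    using finite_nat_iff_bounded by auto
  have aj: "a \<in> sym_algebra (k + 2 * j)" if "J \<le> j" for j
    using J that by (fastforce simp: sym_algebra_def sym_group_def)
  show ?thesis
  proof (rule AE_on_nice_cylinders[of J])
    fix j s assume j: "J \<le> j" and s: "s \<in> Tab j"
    obtain c where c: "ga_act U a (level_vec j s) = c *\<^sub>C level_vec j s"
      by (rule gelfand_tsetlin_eigenvector[OF a aj[OF j] s])
    have diff: "represents (ga_act U a x - c *\<^sub>C x) (\<lambda>\<omega>. g \<omega> - c * f \<omega>)"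
      by (intro represents_diff g represents_scale f)
    have "AE \<omega> in \<mu>. \<omega> \<in> nice_cylinder j s \<longrightarrow> g \<omega> - c * f \<omega> = 0"
    proof (rule zero_on_nice_cylinder[OF _ s])
      show "square_integrable \<mu> (\<lambda>\<omega>. g \<omega> - c * f \<omega>)"
        using diff by (simp add: represents_def)
      fix i u assume i: "j \<le> i" and u: "u \<in> Tab i" and sub: "nice_cylinder i u \<subseteq> nice_cylinder j s"
      show "(LINT \<omega>|\<mu>. indicator (nice_cylinder i u) \<omega> * (g \<omega> - c * f \<omega>)) = 0"
      proof (cases "nice_cylinder i u = {}")
        case False
        then obtain \<omega> where "\<omega> \<in> nice_cylinder i u" "\<omega> \<in> nice_cylinder j s"
          using sub by blast
        then have "take (Suc (k + 2 * j)) u = s"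
          using i by (auto simp: nice_cylinder_def take_initial_segment)
        then have "ga_act U a (level_vec i u) = c *\<^sub>C level_vec i u"
          using eigenvalue_later_level[OF aj[OF j] u i, of c] s c by simp
        then have "cinner (level_vec i u) (ga_act U a x - c *\<^sub>C x) = 0"
          using cinner_level_vec_ga_act[OF a aj u] i j by (simp add: cinner_diff_right cinner_scaleC_right)
        then show ?thesis
          using represents_nice_cylinder[OF diff u] by simp
      qed simp
    qed
    then show "AE \<omega> in \<mu>. \<omega> \<in> nice_cylinder j s \<longrightarrow> (\<exists>c. gt_eigenvalue \<pi> a \<omega> c \<and> g \<omega> = c * f \<omega>)"
      by eventually_elim (use gt_eigenvalue_nice_cylinder[OF aj[OF j] s c] in auto)
  qed
qed

lemma realization: "realized_in_L2 \<pi> U \<mu>"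
proof -
  obtain \<Phi> where \<Phi>: "\<And>x. represents x (\<Phi> x)"
  proof -
    have "\<forall>x. \<exists>f. represents x f"
      using represents_exists by blast
    then show thesis
      using that by (auto dest: choice)
  qed
  have "unitary_onto_L2 \<mu> \<Phi>"
    unfolding unitary_onto_L2_def
  proof (intro conjI allI impI)
    show "square_integrable \<mu> (\<Phi> x)" for x
      using \<Phi>[of x] by (simp add: represents_def)
    show "AE \<omega> in \<mu>. \<Phi> (x + y) \<omega> = \<Phi> x \<omega> + \<Phi> y \<omega>" for x y
      by (intro represents_unique[OF \<Phi>] represents_add \<Phi>)
    show "AE \<omega> in \<mu>. \<Phi> (a *\<^sub>C x) \<omega> = a * \<Phi> x \<omega>" for a x
      by (intro represents_unique[OF \<Phi>] represents_scale \<Phi>)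
    show "(LINT \<omega>|\<mu>. cnj (\<Phi> x \<omega>) * \<Phi> y \<omega>) = cinner x y" for x y
      by (intro represents_inner \<Phi>)
    show "\<exists>x. AE \<omega> in \<mu>. \<Phi> x \<omega> = f \<omega>" if "square_integrable \<mu> f" for f
      by (rule represents_surjective[OF that]) (use represents_unique[OF \<Phi>] in blast)
  qed
  then show ?thesis
    unfolding realized_in_L2_def using represents_ga_act[OF _ \<Phi> \<Phi>] by blast
qed

end

theorem theorem2:
  fixes k :: nat
    and p q :: "nat \<Rightarrow> real"
    and h :: "nat \<Rightarrow> path \<Rightarrow> complex"
    and \<pi> :: "diagram \<Rightarrow> nat perm \<Rightarrow> (path \<Rightarrow> complex) \<Rightarrow> (path \<Rightarrow> complex)"
    and U :: "nat perm \<Rightarrow> 'h::chilbert_space \<Rightarrow> 'h"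
  assumes "1 \<le> k"
    and "\<And>j. h j = (\<lambda>u. of_real (p j) * basis (t21 k j) u + of_real (q j) * basis (t12 k j) u)"
    and "\<And>j. (p j)\<^sup>2 + (q j)\<^sup>2 = 1"
    and "\<And>\<kappa>. young_diagram \<kappa> \<Longrightarrow> young_orthogonal_rep \<kappa> (\<pi> \<kappa>)"
    and "is_schur_weyl_rep k h \<pi> U"
  shows "simple_gt_spectrum U \<and>
    ((\<forall>j. p j \<noteq> 0 \<and> q j \<noteq> 0) \<longrightarrow> realized_in_L2 \<pi> U (spectral_measure k p))"
proof -
  have card: "card (two_row (k + j) j) = k + 2 * j" for j
    by simp
  have U: "unitary_rep U"
    using assms(5) by (simp add: is_schur_weyl_rep_def is_inductive_limit_def)
  from assms(5) obtain \<iota> :: "nat \<Rightarrow> (path \<Rightarrow> complex) \<Rightarrow> 'h" where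
    lin: "\<forall>j. \<forall>v\<in>vecs (tableaux (two_row (k + j) j)). \<forall>w\<in>vecs (tableaux (two_row (k + j) j)). \<forall>a b.
      \<iota> j (\<lambda>t. a * v t + b * w t) = a *\<^sub>C \<iota> j v + b *\<^sub>C \<iota> j w"
    and inner: "\<forall>j. \<forall>v\<in>vecs (tableaux (two_row (k + j) j)). \<forall>w\<in>vecs (tableaux (two_row (k + j) j)).
      cinner (\<iota> j v) (\<iota> j w) = vinner (tableaux (two_row (k + j) j)) v w"
    and equi: "\<forall>j. \<forall>\<sigma>\<in>sym_group (k + 2 * j). \<forall>v\<in>vecs (tableaux (two_row (k + j) j)).
      U \<sigma> (\<iota> j v) = \<iota> j (\<pi> (two_row (k + j) j) \<sigma> v)"
    and embed: "\<forall>j. \<forall>v\<in>vecs (tableaux (two_row (k + j) j)).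
      \<iota> (Suc j) (path_embedding (two_row (k + j) j) (two_row (k + j + 1) (j + 1)) (h j) v) = \<iota> j v"
    and dense: "closure (\<Union>j. \<iota> j ` vecs (tableaux (two_row (k + j) j))) = UNIV"
    unfolding is_schur_weyl_rep_def is_inductive_limit_def card by (elim conjE exE) (rule that)
  interpret schur_weyl k p q \<pi> U \<iota>
  proof unfold_locales
    show "1 \<le> k" "(p j)\<^sup>2 + (q j)\<^sup>2 = 1" for j
      by (fact assms)+
  qed (use assms(4) U lin inner equi embed[unfolded assms(2)] dense in \<open>simp_all only:\<close>)
  have "realized_in_L2 \<pi> U (spectral_measure k p)" if "\<forall>j. p j \<noteq> 0 \<and> q j \<noteq> 0"
  proof -
    interpret nondegenerate_schur_weyl k p q \<pi> U \<iota>
      by unfold_locales (use that in auto)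
    show ?thesis by (rule realization)
  qed
  then show ?thesis
    using simple_spectrum by blast
qed

end
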